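(* Let $d\ge 1$, let $D\subset\mathbb{R}^d$ be a domain (connected open set) with finite Lebesgue measure, let $c_1\in(0,1)$ and $x_0\in D$, and for each integer $k$ let $\mathcal{A}_k$ be the associated family of grid cubes of edge length $2^{-k}$ inside $D$ and $\mathcal{A}'_k$ the family of edges of these cubes, as defined in the context. Then there exists a countable sequence of bounded functions $\{\varphi_j\}_{j\ge1}\subset W^{1,2}(D)\cap C^\infty(D)$ such that: (i) $\{\varphi_j\}_{j\ge 1}$ is dense in $W^{1,2}(D)$; (ii) $\{\varphi_j\}_{j\ge1}$ separates points in $D$; (iii) for each $j\ge 1$, $$\limsup_{k\to\infty} 2^{k(2-d)}\sum_{\overline{xy}\in\mathcal{A}'_k}\bigl(\varphi_j(x)-\varphi_j(y)\bigr)^2\le 2\int_D|\nabla\varphi_j(x)|^2\,dx .$$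
   Context: $W^{1,2}(D)$ is the Sobolev space of functions $f\in L^2(D)$ whose distributional gradient $\nabla f$ is in $L^2(D)$, with norm $\|f\|_{1,2}=(\|f\|_{L^2(D)}^2+\|\nabla f\|_{L^2(D)}^2)^{1/2}$; density in (i) is with respect to this norm. For each integer $k$, $\mathcal{A}_k$ is the family of all closed $d$-dimensional cubes $Q\subset D$ with edge length $2^{-k}$ such that: (a) the vertices of $Q$ belong to $(2^{-k}\mathbb{Z})^d$; (b) the distance from $Q$ to $\partial D$ is greater than $c_1 2^{-k}$; (c) there exists a sequence of cubes $Q_1,Q_2,\dots,Q_m=Q$, each satisfying (a) and (b) (closed cubes in $D$ of edge length $2^{-k}$), such that $x_0\in Q_1$ and $Q_i\cap Q_{i+1}$ is a $(d-1)$-dimensional cube for all $i=1,\dots,m-1$. $\mathcal{A}'_k$ is the family of all edges of all cubes $Q\in\mathcal{A}_k$. $\overline{xy}$ denotes the line segment with endpoints $x$ and $y$; if $\overline{xy}\in\mathcal{A}'_k$ then also $\overline{yx}\in\mathcal{A}'_k$, and each edge is counted twice in the sum (i.e. the sum is over ordered pairs $(x,y)$ of endpoints of edges). *)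

theory Defs
  imports "HOL-Analysis.Analysis"
begin

section \<open>Smooth functions and test functions\<close>

definition partial_deriv :: "'n \<Rightarrow> (real ^ 'n \<Rightarrow> real) \<Rightarrow> real ^ 'n \<Rightarrow> real"
  where "partial_deriv i f x = frechet_derivative f (at x) (axis i 1)"

definition grad :: "(real ^ 'n \<Rightarrow> real) \<Rightarrow> real ^ 'n \<Rightarrow> real ^ 'n"
  where "grad f x = (\<chi> i. partial_deriv i f x)"

text \<open>Used for open \<open>D\<close> only, where differentiability within \<open>D\<close> and the derivative at a point
  of \<open>D\<close> do not depend on the values outside \<open>D\<close>.\<close>

primrec Ck_on :: "nat \<Rightarrow> (real ^ 'n) set \<Rightarrow> (real ^ 'n \<Rightarrow> real) \<Rightarrow> bool" where
  "Ck_on 0 D f \<longleftrightarrow> continuous_on D f"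
| "Ck_on (Suc k) D f \<longleftrightarrow> f differentiable_on D \<and> (\<forall>i. Ck_on k D (partial_deriv i f))"

definition Cinf :: "(real ^ 'n) set \<Rightarrow> (real ^ 'n \<Rightarrow> real) set"
  where "Cinf D = {f. \<forall>k. Ck_on k D f}"

definition test_functions :: "(real ^ 'n) set \<Rightarrow> (real ^ 'n \<Rightarrow> real) set"
  where "test_functions D =
    {\<psi> \<in> Cinf UNIV. compact (closure {x. \<psi> x \<noteq> 0}) \<and> closure {x. \<psi> x \<noteq> 0} \<subseteq> D}"

section \<open>The Sobolev space \<open>W\<^sup>1\<^sup>,\<^sup>2(D)\<close>\<close>

text \<open>Elements of \<open>L\<^sup>2(D)\<close> and \<open>W\<^sup>1\<^sup>,\<^sup>2(D)\<close> are represented by total functions whose values outside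
  \<open>D\<close> are irrelevant; functions equal almost everywhere on \<open>D\<close> are not identified.\<close>

definition L2_on :: "(real ^ 'n) set \<Rightarrow> (real ^ 'n \<Rightarrow> 'b::euclidean_space) set"
  where "L2_on D = {f \<in> borel_measurable (lebesgue_on D).
    integrable (lebesgue_on D) (\<lambda>x. (norm (f x))\<^sup>2)}"

definition has_L2_weak_grad ::
    "(real ^ 'n) set \<Rightarrow> (real ^ 'n \<Rightarrow> real) \<Rightarrow> (real ^ 'n \<Rightarrow> real ^ 'n) \<Rightarrow> bool"
  where "has_L2_weak_grad D f G \<longleftrightarrow> G \<in> L2_on D \<and>
    (\<forall>\<psi> \<in> test_functions D. \<forall>i.
      (LINT x|lebesgue_on D. f x * partial_deriv i \<psi> x) = - (LINT x|lebesgue_on D. G x $ i * \<psi> x))"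

definition W12 :: "(real ^ 'n) set \<Rightarrow> (real ^ 'n \<Rightarrow> real) set"
  where "W12 D = {f \<in> L2_on D. \<exists>G. has_L2_weak_grad D f G}"

text \<open>The distributional gradient is unique up to a null set, so the choice does not affect
  the norm below.\<close>

definition weak_grad :: "(real ^ 'n) set \<Rightarrow> (real ^ 'n \<Rightarrow> real) \<Rightarrow> real ^ 'n \<Rightarrow> real ^ 'n"
  where "weak_grad D f = (SOME G. has_L2_weak_grad D f G)"

definition W12_norm :: "(real ^ 'n) set \<Rightarrow> (real ^ 'n \<Rightarrow> real) \<Rightarrow> real"
  where "W12_norm D f = sqrt ((LINT x|lebesgue_on D. (norm (f x))\<^sup>2) +
    (LINT x|lebesgue_on D. (norm (weak_grad D f x))\<^sup>2))"

section \<open>Grid cubes and their edges\<close>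

text \<open>A closed \<open>m\<close>-dimensional cube with edge length \<open>s\<close>, whose edges are parallel to the axes
  \<open>i \<in> J\<close>. Restricting to axis-parallel cubes loses nothing below: the edge vectors of a cube of
  edge length \<open>2\<^sup>-\<^sup>k\<close> with vertices in \<open>(2\<^sup>-\<^sup>k\<int>)\<^sup>d\<close> are \<open>2\<^sup>-\<^sup>k\<close> times integer vectors of length 1.\<close>

definition is_cube :: "nat \<Rightarrow> real \<Rightarrow> (real ^ 'n) set \<Rightarrow> bool"
  where "is_cube m s Q \<longleftrightarrow> s > 0 \<and>
    (\<exists>a J. card J = m \<and> Q = cbox a (\<chi> i. a $ i + (if i \<in> J then s else 0)))"

definition grid :: "int \<Rightarrow> (real ^ 'n) set"
  where "grid k = {x. \<forall>i. \<exists>z::int. x $ i = of_int z * 2 powi (- k)}"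

text \<open>Conditions (a) and (b). The junk value \<open>setdist Q {} = 0\<close> does not occur when \<open>D\<close> is
  nonempty and of finite measure, as then \<open>frontier D \<noteq> {}\<close>.\<close>

definition admissible_cube :: "(real ^ 'n) set \<Rightarrow> real \<Rightarrow> int \<Rightarrow> (real ^ 'n) set \<Rightarrow> bool"
  where "admissible_cube D c\<^sub>1 k Q \<longleftrightarrow>
    is_cube CARD('n) (2 powi (- k)) Q \<and> Q \<subseteq> D \<and>
    (\<forall>v. v extreme_point_of Q \<longrightarrow> v \<in> grid k) \<and>
    setdist Q (frontier D) > c\<^sub>1 * 2 powi (- k)"

definition grid_cubes :: "(real ^ 'n) set \<Rightarrow> real \<Rightarrow> real ^ 'n \<Rightarrow> int \<Rightarrow> (real ^ 'n) set set"
  where "grid_cubes D c\<^sub>1 x\<^sub>0 k = {Q. admissible_cube D c\<^sub>1 k Q \<and>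
    (\<exists>m\<ge>1. \<exists>R :: nat \<Rightarrow> (real ^ 'n) set.
      (\<forall>i\<in>{1..m}. admissible_cube D c\<^sub>1 k (R i)) \<and> x\<^sub>0 \<in> R 1 \<and> R m = Q \<and>
      (\<forall>i\<in>{1..<m}. \<exists>s. is_cube (CARD('n) - 1) s (R i \<inter> R (i + 1))))}"

text \<open>Ordered pairs of endpoints, so that every edge occurs exactly twice, however many cubes
  share it. The set is finite when \<open>D\<close> has finite measure.\<close>

definition grid_edges ::
    "(real ^ 'n) set \<Rightarrow> real \<Rightarrow> real ^ 'n \<Rightarrow> int \<Rightarrow> ((real ^ 'n) \<times> (real ^ 'n)) set"
  where "grid_edges D c\<^sub>1 x\<^sub>0 k =
    {(x, y). \<exists>Q \<in> grid_cubes D c\<^sub>1 x\<^sub>0 k. closed_segment x y edge_of Q}"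

end

theory Submission
  imports Defs
begin

text \<open>Let \<open>\<delta>\<close> be the smaller of \<open>1\<close> and the distance to the complement of \<open>D\<close>. A function in
  \<open>W\<^sup>1\<^sup>,\<^sup>2(D)\<close> is averaged at the variable scale \<open>\<eta> / (n + 7)\<close>, where \<open>\<eta>\<close> is a smooth function
  comparable to \<open>\<delta>\<close>; this gives smooth functions converging to it in \<open>W\<^sup>1\<^sup>,\<^sup>2(D)\<close> as in the
  Meyers--Serrin theorem. In addition, the squared gradient of such an average at \<open>x\<close> is at most a constant
  times the mean of one fixed integrable function over a ball around \<open>x\<close> with radius comparable
  to \<open>\<delta> x\<close>. Grid edges of length \<open>2\<^sup>-\<^sup>k\<close> stay at distance at least \<open>c\<^sub>1 2\<^sup>-\<^sup>k\<close> from the boundary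
  and these balls overlap boundedly, so the edges outside a large compact subset of \<open>D\<close> contribute at most
  a constant times the integral of that function near the boundary, which is small. On the compact set
  the gradient is uniformly continuous and the discrete energy is a Riemann sum; the factor 2
  counts the two orientations of an edge. Boundedness is achieved by \<open>v \<mapsto> M sin (v / M)\<close>, a
  countable dense subfamily exists because \<open>L\<^sup>2(D)\<close> is separable, and the functions
  \<open>sin (x\<^sub>i / N)\<close> are added to it to separate points.\<close>

section \<open>Calculus of smooth functions\<close>

text \<open>Property (iii) samples a function at single points, so density in \<open>W12\<close>
  alone says nothing about it: near the boundary a smooth function may oscillate at the scale of the
  grid. The bound \<open>energy_controlled\<close> excludes this. Its constant may depend on the
  function, since only the integral over a boundary layer has to become small. The price of a
  variable radius is that derivatives also fall on the radius. Integration by parts against the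
  kernels \<open>w $ j * \<rho> w\<close> makes all terms containing the function itself cancel;
  what remains carries the factor \<open>partial_deriv i \<eta> x / (real n + 7)\<close>, small
  because \<eta> has bounded gradient. The Riemann sum has the sharp constant because the mean value
  theorem and the normalisation turn an edge into the volume of one grid cell times one squared
  partial derivative, cells of edges with a common direction are disjoint, and the sum over the
  directions is the squared norm of the gradient.\<close>

lemma partial_deriv_eq:
  assumes "(f has_derivative f') (at x)"
  shows "partial_deriv i f x = f' (axis i 1)"
  using frechet_derivative_at[OF assms] by (simp add: partial_deriv_def)

lemma has_derivative_cong_open:
  assumes "open U" "x \<in> U" "\<And>y. y \<in> U \<Longrightarrow> f y = g y"
  shows "(f has_derivative h) (at x) \<longleftrightarrow> (g has_derivative h) (at x)"
proof
  show "(g has_derivative h) (at x)" if "(f has_derivative h) (at x)"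
    by (rule has_derivative_transform_within_open[OF that assms])
  show "(f has_derivative h) (at x)" if "(g has_derivative h) (at x)"
    by (rule has_derivative_transform_within_open[OF that assms(1,2)]) (simp add: assms(3))
qed

text \<open>Valid also where \<open>f\<close> is not differentiable:
  \<open>frechet_derivative\<close> is a choice among all derivatives, and \<open>f\<close> and
  \<open>g\<close> have the same derivatives at \<open>x\<close>.\<close>

lemma partial_deriv_cong_open:
  assumes "open U" "x \<in> U" "\<And>y. y \<in> U \<Longrightarrow> f y = g y"
  shows "partial_deriv i f x = partial_deriv i g x"
  unfolding partial_deriv_def frechet_derivative_def
  using has_derivative_cong_open[of U x f g] assms by simp

lemma Ck_on_cong:
  assumes "open D" "\<And>x. x \<in> D \<Longrightarrow> f x = g x"
  shows "Ck_on k D f \<longleftrightarrow> Ck_on k D g"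
  using assms(2)
proof (induction k arbitrary: f g)
  case 0
  then show ?case by (simp cong: continuous_on_cong)
next
  case (Suc k)
  have "f differentiable_on D \<longleftrightarrow> g differentiable_on D"
    unfolding differentiable_on_eq_differentiable_at[OF assms(1)] differentiable_def
    using has_derivative_cong_open[OF assms(1) _ Suc.prems] by simp
  moreover have "Ck_on k D (partial_deriv i f) \<longleftrightarrow> Ck_on k D (partial_deriv i g)" for i
    by (intro Suc.IH partial_deriv_cong_open[OF assms(1)] Suc.prems)
  ultimately show ?case by simp
qed

text \<open>The common pattern of most closure rules below: once the derivative is written in closed
  form, order \<open>Suc k\<close> for the function becomes order \<open>k\<close> for a formula
  built from functions already covered.\<close>

lemma Ck_on_SucI:
  assumes "open D" "\<And>x. x \<in> D \<Longrightarrow> (f has_derivative f' x) (at x)"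
    and "\<And>i. Ck_on k D (\<lambda>x. f' x (axis i 1))"
  shows "Ck_on (Suc k) D f"
proof -
  have "f differentiable_on D"
    unfolding differentiable_on_eq_differentiable_at[OF assms(1)] differentiable_def
    using assms(2) by blast
  moreover have "Ck_on k D (partial_deriv i f)" for i
    using Ck_on_cong[OF assms(1), of "partial_deriv i f" "\<lambda>x. f' x (axis i 1)" k]
      assms(2,3) partial_deriv_eq by blast
  ultimately show ?thesis by simp
qed

text \<open>Derivatives of products, inverses and sines contain the undifferentiated functions
  again, so those inductions also need the lower order.\<close>

lemma Ck_on_SucD:
  assumes "Ck_on (Suc k) D f" shows "Ck_on k D f"
  using assms
proof (induction k arbitrary: f)
  case 0
  then show ?case by (simp add: differentiable_imp_continuous_on)
next
  case (Suc k)
  then have "Ck_on k D (partial_deriv i f)" for i by simp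
  with Suc.prems show ?case by simp
qed

lemma Ck_on_has_derivative:
  assumes "open D" "Ck_on (Suc k) D f" "x \<in> D"
  shows "(f has_derivative frechet_derivative f (at x)) (at x)"
  using assms differentiable_on_eq_differentiable_at[OF assms(1)]
  by (auto simp: frechet_derivative_works[symmetric])

lemma Ck_on_subset:
  assumes "Ck_on k D f" "U \<subseteq> D" shows "Ck_on k U f"
  using assms(1)
proof (induction k arbitrary: f)
  case 0
  then show ?case using assms(2) continuous_on_subset by auto
next
  case (Suc k)
  then show ?case using assms(2) differentiable_on_subset by auto
qed

text \<open>Meant for the smooth scale \<open>\<eta>\<close>, a series that is given by one closed
  formula near each point, but by different formulas near different points.\<close>

lemma Ck_on_local:
  assumes "\<And>x. x \<in> D \<Longrightarrow> \<exists>U. open U \<and> x \<in> U \<and> Ck_on k U f" and "open D"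
  shows "Ck_on k D f"
  using assms(1)
proof (induction k arbitrary: f)
  case 0
  have "isCont f x" if x: "x \<in> D" for x
  proof -
    obtain U where "open U" "x \<in> U" "Ck_on 0 U f" using "0.prems"[OF x] by blast
    then show ?thesis by (simp add: continuous_on_eq_continuous_at)
  qed
  then show ?case by (simp add: continuous_at_imp_continuous_on)
next
  case (Suc k)
  have "f differentiable (at x)" if x: "x \<in> D" for x
  proof -
    obtain U where "open U" "x \<in> U" "Ck_on (Suc k) U f" using Suc.prems[OF x] by blast
    then show ?thesis by (simp add: differentiable_on_eq_differentiable_at)
  qed
  then have "f differentiable_on D" by (simp add: differentiable_at_imp_differentiable_on)
  moreover have "Ck_on k D (partial_deriv i f)" for i
  proof (rule Suc.IH)
    fix x assume "x \<in> D"
    then obtain U where "open U" "x \<in> U" "Ck_on (Suc k) U f" using Suc.prems by meson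
    then show "\<exists>U. open U \<and> x \<in> U \<and> Ck_on k U (partial_deriv i f)" by auto
  qed
  ultimately show ?case by simp
qed

lemma Ck_on_const [simp]: "Ck_on k (D :: (real ^ 'a) set) (\<lambda>x. c)"
proof (induction k arbitrary: c)
  case (Suc k)
  have "partial_deriv i (\<lambda>x. c) = (\<lambda>x. 0)" for i :: 'a and c :: real
    by (simp add: partial_deriv_def fun_eq_iff)
  then show ?case using Suc by simp
qed simp

lemma Ck_on_add:
  assumes "open D" "Ck_on k D f" "Ck_on k D g"
  shows "Ck_on k D (\<lambda>x. f x + g x)"
  using assms(2,3)
proof (induction k arbitrary: f g)
  case 0
  then show ?case by (simp add: continuous_on_add)
next
  case (Suc k)
  show ?case
  proof (rule Ck_on_SucI[OF assms(1)])
    show "((\<lambda>x. f x + g x) has_derivative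
       (\<lambda>v. frechet_derivative f (at x) v + frechet_derivative g (at x) v)) (at x)" if "x \<in> D" for x
      by (rule has_derivative_add[OF Ck_on_has_derivative[OF assms(1) Suc.prems(1) that]
            Ck_on_has_derivative[OF assms(1) Suc.prems(2) that]])
    show "Ck_on k D (\<lambda>x. frechet_derivative f (at x) (axis i 1) + frechet_derivative g (at x) (axis i 1))"
      for i
      using Suc.IH[of "partial_deriv i f" "partial_deriv i g"] Suc.prems
      by (simp add: partial_deriv_def[abs_def])
  qed
qed

lemma Ck_on_mult:
  assumes "open D" "Ck_on k D f" "Ck_on k D g"
  shows "Ck_on k D (\<lambda>x. f x * g x)"
  using assms(2,3)
proof (induction k arbitrary: f g)
  case 0
  then show ?case by (simp add: continuous_on_mult)
next
  case (Suc k)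
  show ?case
  proof (rule Ck_on_SucI[OF assms(1)])
    show "((\<lambda>x. f x * g x) has_derivative
       (\<lambda>v. f x * frechet_derivative g (at x) v + frechet_derivative f (at x) v * g x)) (at x)"
      if "x \<in> D" for x
      by (rule has_derivative_mult[OF Ck_on_has_derivative[OF assms(1) Suc.prems(1) that]
            Ck_on_has_derivative[OF assms(1) Suc.prems(2) that]])
    show "Ck_on k D (\<lambda>x. f x * frechet_derivative g (at x) (axis i 1)
        + frechet_derivative f (at x) (axis i 1) * g x)" for i
      using Suc.IH[of f "partial_deriv i g"] Suc.IH[of "partial_deriv i f" g] Suc.prems
        Ck_on_SucD[OF Suc.prems(1)] Ck_on_SucD[OF Suc.prems(2)] Ck_on_add[OF assms(1)]
      by (simp add: partial_deriv_def[abs_def])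
  qed
qed

lemma Ck_on_sum:
  assumes "open D" "\<And>i. i \<in> I \<Longrightarrow> Ck_on k D (f i)"
  shows "Ck_on k D (\<lambda>x. \<Sum>i\<in>I. f i x)"
  using assms(2)
  by (induction I rule: infinite_finite_induct) (auto intro!: Ck_on_add assms(1))

lemma Ck_on_inverse:
  assumes "open D" "Ck_on k D f" "\<And>x. x \<in> D \<Longrightarrow> f x \<noteq> 0"
  shows "Ck_on k D (\<lambda>x. inverse (f x))"
  using assms(2)
proof (induction k)
  case 0
  then show ?case using assms(3) by (auto intro: continuous_on_inverse)
next
  case (Suc k)
  show ?case
  proof (rule Ck_on_SucI[OF assms(1)])
    show "((\<lambda>x. inverse (f x)) has_derivative
       (\<lambda>v. - (inverse (f x) * frechet_derivative f (at x) v * inverse (f x)))) (at x)"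
      if "x \<in> D" for x
      by (rule Deriv.has_derivative_inverse[OF assms(3)[OF that]
            Ck_on_has_derivative[OF assms(1) Suc.prems that]])
    have "Ck_on k D (\<lambda>x. inverse (f x))" using Suc.IH Ck_on_SucD[OF Suc.prems] by blast
    moreover have "Ck_on k D (partial_deriv i f)" for i using Suc.prems by simp
    ultimately have "Ck_on k D (\<lambda>x. (-1) * (inverse (f x) * partial_deriv i f x * inverse (f x)))" for i
      by (intro Ck_on_mult Ck_on_const assms(1)) auto
    then show "Ck_on k D (\<lambda>x. - (inverse (f x) * frechet_derivative f (at x) (axis i 1) * inverse (f x)))"
      for i by (simp add: partial_deriv_def[abs_def])
  qed
qed

text \<open>A joint induction, because each of the two functions reappears in the derivative of the
  other.\<close>

lemma Ck_on_sin_cos: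
  assumes "open D" "Ck_on k D f"
  shows "Ck_on k D (\<lambda>x. sin (f x)) \<and> Ck_on k D (\<lambda>x. cos (f x))"
  using assms(2)
proof (induction k)
  case 0
  then show ?case by (auto intro!: continuous_intros)
next
  case (Suc k)
  have IH: "Ck_on k D (\<lambda>x. sin (f x))" "Ck_on k D (\<lambda>x. cos (f x))"
    using Suc.IH Ck_on_SucD[OF Suc.prems] by auto
  have pf: "Ck_on k D (\<lambda>x. frechet_derivative f (at x) (axis i 1))" for i
    using Suc.prems by (simp add: partial_deriv_def[abs_def])
  have d: "(f has_derivative frechet_derivative f (at x)) (at x)" if "x \<in> D" for x
    by (rule Ck_on_has_derivative[OF assms(1) Suc.prems that])
  have "Ck_on (Suc k) D (\<lambda>x. sin (f x))"
  proof (rule Ck_on_SucI[OF assms(1)])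
    show "((\<lambda>x. sin (f x)) has_derivative (\<lambda>v. frechet_derivative f (at x) v * cos (f x))) (at x)"
      if "x \<in> D" for x
      using d[OF that] by (auto intro!: derivative_eq_intros)
  qed (intro Ck_on_mult assms(1) pf IH)
  moreover have "Ck_on (Suc k) D (\<lambda>x. cos (f x))"
  proof (rule Ck_on_SucI[OF assms(1)])
    show "((\<lambda>x. cos (f x)) has_derivative
        (\<lambda>v. (-1) * (frechet_derivative f (at x) v * sin (f x)))) (at x)"
      if "x \<in> D" for x
      using d[OF that] by (auto intro!: derivative_eq_intros)
  qed (intro Ck_on_mult Ck_on_const assms(1) pf IH)
  ultimately show ?case ..
qed

lemma Ck_on_component: "open D \<Longrightarrow> Ck_on k D (\<lambda>x. x $ i)"
proof (induction k)
  case 0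
  then show ?case by (auto intro!: continuous_intros)
next
  case (Suc k)
  show ?case
    by (rule Ck_on_SucI[where f' = "\<lambda>x v. v $ i", OF Suc.prems])
      (auto intro!: bounded_linear_imp_has_derivative bounded_linear_vec_nth)
qed

lemma has_derivative_affine:
  fixes P :: "real ^ 'n \<Rightarrow> real"
  assumes "P differentiable_on UNIV"
  shows "((\<lambda>y. P (s *\<^sub>R (x - y))) has_derivative
    (\<lambda>v. frechet_derivative P (at (s *\<^sub>R (x - y))) (s *\<^sub>R (0 - v)))) (at y)"
proof (rule has_derivative_compose[where f = "\<lambda>y. s *\<^sub>R (x - y)" and g = P])
  show "(P has_derivative frechet_derivative P (at (s *\<^sub>R (x - y)))) (at (s *\<^sub>R (x - y)))"
    using assms by (simp add: differentiable_on_eq_differentiable_at frechet_derivative_works[symmetric])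
qed (intro derivative_intros)

text \<open>Differentiation is in the integration variable \<open>y\<close>, not in the centre
  \<open>x\<close>; the sign of the factor \<open>- s\<close> later cancels the sign of integration
  by parts.\<close>

lemma partial_deriv_affine:
  assumes "P differentiable_on UNIV"
  shows "partial_deriv i (\<lambda>y. P (s *\<^sub>R (x - y))) y = - s * partial_deriv i P (s *\<^sub>R (x - y))"
proof -
  let ?P' = "frechet_derivative P (at (s *\<^sub>R (x - y)))"
  have "(P has_derivative ?P') (at (s *\<^sub>R (x - y)))"
    using assms by (simp add: differentiable_on_eq_differentiable_at frechet_derivative_works[symmetric])
  from linear_scale[OF has_derivative_linear[OF this], of "-s"]
  show ?thesis
    using partial_deriv_eq[OF has_derivative_affine[OF assms], of i s x y]
    by (simp add: partial_deriv_def)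
qed

lemma Ck_on_affine:
  assumes "Ck_on k UNIV P"
  shows "Ck_on k UNIV (\<lambda>y. P (s *\<^sub>R (x - y)))"
  using assms
proof (induction k arbitrary: P)
  case 0
  then have "continuous_on UNIV P" by simp
  then have "continuous_on UNIV (P \<circ> (\<lambda>y. s *\<^sub>R (x - y)))"
    by (intro continuous_on_compose) (auto intro!: continuous_intros elim: continuous_on_subset)
  then show ?case by (simp add: o_def)
next
  case (Suc k)
  have "(\<lambda>y. P (s *\<^sub>R (x - y))) differentiable_on UNIV"
    using has_derivative_affine[of P] Suc.prems
    by (auto simp: differentiable_on_eq_differentiable_at differentiable_def)
  moreover have "Ck_on k UNIV (partial_deriv i (\<lambda>y. P (s *\<^sub>R (x - y))))" for i
  proof -
    have "Ck_on k UNIV (\<lambda>y. - s * partial_deriv i P (s *\<^sub>R (x - y)))"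
      using Suc by (intro Ck_on_mult Ck_on_const) auto
    moreover have "partial_deriv i (\<lambda>y. P (s *\<^sub>R (x - y))) = (\<lambda>y. - s * partial_deriv i P (s *\<^sub>R (x - y)))"
      using Suc.prems partial_deriv_affine[of P] by (simp add: fun_eq_iff)
    ultimately show ?thesis by simp
  qed
  ultimately show ?case by simp
qed

lemma Cinf_Ck: "f \<in> Cinf D \<Longrightarrow> Ck_on k D f"
  by (simp add: Cinf_def)

lemma CinfI: "(\<And>k. Ck_on k D f) \<Longrightarrow> f \<in> Cinf D"
  by (simp add: Cinf_def)

lemma Cinf_partial_deriv: "f \<in> Cinf D \<Longrightarrow> partial_deriv i f \<in> Cinf D"
proof (rule CinfI)
  show "Ck_on k D (partial_deriv i f)" if "f \<in> Cinf D" for k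
    using Cinf_Ck[OF that, of "Suc k"] by simp
qed

lemma Cinf_continuous: "f \<in> Cinf D \<Longrightarrow> continuous_on D f"
  using Cinf_Ck[of f D 0] by simp

lemma Cinf_differentiable: "f \<in> Cinf D \<Longrightarrow> f differentiable_on D"
  using Cinf_Ck[of f D "Suc 0"] by simp

lemma Cinf_has_derivative:
  assumes "open D" "f \<in> Cinf D" "x \<in> D"
  shows "(f has_derivative frechet_derivative f (at x)) (at x)"
  using Ck_on_has_derivative[OF assms(1) Cinf_Ck[OF assms(2)] assms(3)] .

lemma has_derivative_grad:
  assumes "(f has_derivative f') (at x)"
  shows "(f has_derivative (\<lambda>v. grad f x \<bullet> v)) (at x)"
proof -
  have "f' v = grad f x \<bullet> v" for v
  proof -
    have "f' v = f' (\<Sum>i\<in>UNIV. v $ i *\<^sub>R axis i 1)"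
      by (simp add: basis_expansion scalar_mult_eq_scaleR[symmetric])
    also have "\<dots> = (\<Sum>i\<in>UNIV. v $ i * partial_deriv i f x)"
      using has_derivative_linear[OF assms]
      by (simp add: linear_sum linear_scale partial_deriv_eq[OF assms])
    also have "\<dots> = grad f x \<bullet> v" by (simp add: grad_def inner_vec_def mult.commute)
    finally show ?thesis .
  qed
  then have "f' = (\<lambda>v. grad f x \<bullet> v)" by auto
  with assms show ?thesis by simp
qed

section \<open>Smooth kernels\<close>

text \<open>For \<open>p = 0\<close> this is the classical flat function exp(-1/s). The powers of
  \<open>inverse s\<close> make linear combinations of the family closed under differentiation, so
  smoothness follows by induction.\<close>

definition exp_bump :: "nat \<Rightarrow> real \<Rightarrow> real" where
  "exp_bump p s = (if s > 0 then inverse s ^ p * exp (- inverse s) else 0)"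

lemma exp_bump_tendsto_0: "(exp_bump p \<longlongrightarrow> 0) (at 0)"
proof (rule filterlim_split_at)
  have "((\<lambda>s. inverse s ^ p / exp (inverse s)) \<longlongrightarrow> 0) (at_right (0::real))"
    by (rule filterlim_compose[OF tendsto_power_div_exp_0 filterlim_inverse_at_top_right])
  then show "(exp_bump p \<longlongrightarrow> 0) (at_right 0)"
    by (rule Lim_transform_eventually)
      (auto simp: exp_bump_def exp_minus divide_inverse eventually_at_right_field intro!: exI[of _ 1])
  show "(exp_bump p \<longlongrightarrow> 0) (at_left 0)"
    by (rule tendsto_eventually)
      (auto simp: exp_bump_def eventually_at_left_field intro!: exI[of _ "-1"])
qed

lemma exp_bump_deriv:
  "(exp_bump p has_real_derivative exp_bump (p + 2) s - real p * exp_bump (p + 1) s) (at s)"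
proof (cases s "0 :: real" rule: linorder_cases)
  case less
  have "((\<lambda>s. 0) has_real_derivative 0) (at s)" by simp
  then have "(exp_bump p has_real_derivative 0) (at s)"
    by (rule has_field_derivative_transform_within_open[where S = "{..<0}"])
      (use less in \<open>auto simp: exp_bump_def\<close>)
  with less show ?thesis by (simp add: exp_bump_def)
next
  case equal
  \<comment> \<open>The difference quotient of \<open>exp_bump p\<close> at 0 is
    \<open>exp_bump (Suc p)\<close>, which tends to 0.\<close>
  have "((\<lambda>y. (exp_bump p y - exp_bump p 0) / (y - 0)) \<longlongrightarrow> 0) (at 0)"
    by (rule Lim_transform_eventually[OF exp_bump_tendsto_0[of "Suc p"]])
      (auto simp: exp_bump_def divide_inverse intro!: always_eventually)
  with equal show ?thesis by (simp add: has_field_derivative_iff exp_bump_def)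
next
  case greater
  have inv: "(inverse has_real_derivative - (inverse s ^ Suc (Suc 0))) (at s)"
    using greater by (intro DERIV_inverse) simp
  have exp: "((\<lambda>s. exp (- inverse s)) has_real_derivative exp (- inverse s) * inverse s ^ Suc (Suc 0)) (at s)"
    using DERIV_chain2[OF DERIV_exp DERIV_minus[OF inv]] by simp
  have "((\<lambda>s. inverse s ^ p * exp (- inverse s)) has_real_derivative
      exp_bump (p + 2) s - real p * exp_bump (p + 1) s) (at s)"
    using DERIV_mult[OF DERIV_power[OF inv, of p] exp] greater
    by (cases p) (simp_all add: exp_bump_def algebra_simps)
  then show ?thesis
    by (rule has_field_derivative_transform_within_open[where S = "{0<..}"])
      (use greater in \<open>auto simp: exp_bump_def\<close>)
qed

text \<open>The argument \<open>1 - x \<bullet> x\<close> is a polynomial, hence smooth at the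
  origin as well. Each derivative multiplies by a coordinate and raises the index, which is why
  \<open>p\<close> is generalised.\<close>

lemma Ck_on_exp_bump_inner: "Ck_on k (UNIV :: (real ^ 'n) set) (\<lambda>x. exp_bump p (1 - x \<bullet> x))"
proof (induction k arbitrary: p)
  case 0
  have "isCont (exp_bump p) s" for s
    using exp_bump_deriv by (rule DERIV_isCont)
  then have "continuous_on UNIV (exp_bump p)"
    by (simp add: continuous_at_imp_continuous_on)
  then show ?case
    by (auto intro!: continuous_intros continuous_on_compose2[of UNIV "exp_bump p"])
next
  case (Suc k)
  let ?h' = "\<lambda>s. exp_bump (p + 2) s - real p * exp_bump (p + 1) s"
  show ?case
  proof (rule Ck_on_SucI[where f' = "\<lambda>x v. ?h' (1 - x \<bullet> x) * (- (2 * (x \<bullet> v)))"])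
    show "((\<lambda>x. exp_bump p (1 - x \<bullet> x)) has_derivative (\<lambda>v. ?h' (1 - x \<bullet> x) * (- (2 * (x \<bullet> v))))) (at x)"
      for x :: "real ^ 'n"
    proof (rule has_derivative_compose[where f = "\<lambda>x. 1 - x \<bullet> x" and g = "exp_bump p"
          and f' = "\<lambda>v. - (2 * (x \<bullet> v))" and g' = "(*) (?h' (1 - x \<bullet> x))"])
      show "((\<lambda>x. 1 - x \<bullet> x) has_derivative (\<lambda>v. - (2 * (x \<bullet> v)))) (at x)"
        by (auto intro!: derivative_eq_intros simp: inner_commute)
      show "(exp_bump p has_derivative (*) (?h' (1 - x \<bullet> x))) (at (1 - x \<bullet> x))"
        using exp_bump_deriv[of p "1 - x \<bullet> x"] by (simp add: has_field_derivative_def)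
    qed
    have "Ck_on k (UNIV :: (real ^ 'n) set) (\<lambda>x. (exp_bump (p + 2) (1 - x \<bullet> x)
        + (- real p) * exp_bump (p + 1) (1 - x \<bullet> x)) * ((- 2) * x $ i))" for i
      by (intro Ck_on_mult Ck_on_add Ck_on_const Ck_on_component Suc.IH open_UNIV)
    then show "Ck_on k (UNIV :: (real ^ 'n) set)
        (\<lambda>x. ?h' (1 - x \<bullet> x) * (- (2 * (x \<bullet> axis i 1))))" for i
      by (simp add: inner_axis algebra_simps)
  qed simp
qed

text \<open>Kernels of arbitrary sign and mass: the class has to be closed under partial derivatives
  and under multiplication by a coordinate, both of which occur when an average with variable radius
  is differentiated.\<close>

definition unit_kernels :: "(real ^ 'n \<Rightarrow> real) set" where
  "unit_kernels = {P \<in> Cinf UNIV. \<forall>w. norm w > 1 \<longrightarrow> P w = 0}"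

lemma unit_kernels_zero: "P \<in> unit_kernels \<Longrightarrow> norm w > 1 \<Longrightarrow> P w = 0"
  by (simp add: unit_kernels_def)

lemma unit_kernels_Cinf: "P \<in> unit_kernels \<Longrightarrow> P \<in> Cinf UNIV"
  by (simp add: unit_kernels_def)

lemma unit_kernels_continuous: "P \<in> unit_kernels \<Longrightarrow> continuous_on UNIV P"
  by (simp add: unit_kernels_def Cinf_continuous)

lemma unit_kernels_measurable [measurable_dest]: "P \<in> unit_kernels \<Longrightarrow> P \<in> borel_measurable borel"
  by (simp add: unit_kernels_continuous borel_measurable_continuous_onI)

lemma unit_kernels_partial_deriv:
  assumes "P \<in> unit_kernels"
  shows "partial_deriv i P \<in> unit_kernels"
proof -
  have "partial_deriv i P w = 0" if "norm w > 1" for w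
  proof -
    have "open {w :: real ^ 'a. norm w > 1}"
      by (intro open_Collect_less continuous_intros)
    then have "partial_deriv i P w = partial_deriv i (\<lambda>_. 0) w"
      using unit_kernels_zero[OF assms] that
      by (intro partial_deriv_cong_open[of "{w. norm w > 1}"]) auto
    then show ?thesis by (simp add: partial_deriv_def)
  qed
  with Cinf_partial_deriv[OF unit_kernels_Cinf[OF assms]] show ?thesis
    by (simp add: unit_kernels_def)
qed

lemma unit_kernels_component:
  assumes "P \<in> unit_kernels"
  shows "(\<lambda>w. w $ i * P w) \<in> unit_kernels"
  using assms by (auto simp: unit_kernels_def Cinf_def intro!: Ck_on_mult Ck_on_component)

lemma unit_kernels_bounded:
  assumes "P \<in> unit_kernels"
  obtains B where "B > 0" "\<And>w. \<bar>P w\<bar> \<le> B"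
proof -
  have "compact (P ` cball 0 1)"
    using unit_kernels_continuous[OF assms] continuous_on_subset
    by (intro compact_continuous_image) auto
  then obtain B where B: "B > 0" "\<And>w. w \<in> cball 0 1 \<Longrightarrow> \<bar>P w\<bar> \<le> B"
    by (auto dest!: compact_imp_bounded simp: bounded_pos)
  have "\<bar>P w\<bar> \<le> B" for w
    using B(1) B(2)[of w] unit_kernels_zero[OF assms, of w] by (cases "norm w \<le> 1") auto
  with B(1) show thesis by (rule that)
qed

lemma norm_grad_le_sum: "norm (grad f x) \<le> (\<Sum>i\<in>UNIV. \<bar>partial_deriv i f x\<bar>)"
  using norm_le_l1_cart[of "grad f x"] by (simp add: grad_def)

lemma unit_kernels_lipschitz:
  assumes "P \<in> unit_kernels"
  obtains L where "L > 0" "\<And>v w. \<bar>P v - P w\<bar> \<le> L * norm (v - w)"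
proof -
  have "\<exists>B>0. \<forall>w. \<bar>partial_deriv i P w\<bar> \<le> B" for i
    using unit_kernels_bounded[OF unit_kernels_partial_deriv[OF assms]] by metis
  then obtain B where B: "\<And>i. B i > 0" "\<And>i w. \<bar>partial_deriv i P w\<bar> \<le> B i"
    by metis
  let ?L = "\<Sum>i\<in>UNIV. B i"
  have "norm (P v - P w) \<le> ?L * norm (v - w)" for v w
  proof (rule differentiable_bound[of UNIV P "\<lambda>x v. grad P x \<bullet> v"])
    fix x
    show "(P has_derivative (\<lambda>v. grad P x \<bullet> v)) (at x within UNIV)"
      using Cinf_has_derivative[OF open_UNIV unit_kernels_Cinf[OF assms]]
      by (intro has_derivative_grad) auto
    have "norm (grad P x) \<le> ?L"
      by (rule order_trans[OF norm_grad_le_sum]) (intro sum_mono B)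
    then have "\<bar>grad P x \<bullet> v\<bar> \<le> ?L * norm v" for v
      by (intro order_trans[OF Cauchy_Schwarz_ineq2] mult_right_mono) auto
    then show "onorm (\<lambda>v. grad P x \<bullet> v) \<le> ?L"
      by (intro onorm_le) simp
  qed auto
  moreover have "?L > 0" using B(1) by (intro sum_pos) auto
  ultimately show thesis using that by auto
qed

text \<open>Supplies the test functions that turn the definition of the weak gradient into a
  statement about averages. The scaled kernel lives on the ball of radius \<open>1 / s\<close>,
  hence the inclusion required of that ball.\<close>

lemma unit_kernels_test_function:
  assumes P: "P \<in> unit_kernels" and s: "s > 0" "cball x (1 / s) \<subseteq> D"
  shows "(\<lambda>y. P (s *\<^sub>R (x - y))) \<in> test_functions D"
proof -
  have sub: "{y. P (s *\<^sub>R (x - y)) \<noteq> 0} \<subseteq> cball x (1 / s)"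
  proof
    fix y assume "y \<in> {y. P (s *\<^sub>R (x - y)) \<noteq> 0}"
    then have "norm (s *\<^sub>R (x - y)) \<le> 1"
      using unit_kernels_zero[OF P] by (meson mem_Collect_eq not_le)
    then have "s * norm (x - y) \<le> 1" using s(1) by (simp only: norm_scaleR abs_of_pos)
    then show "y \<in> cball x (1 / s)"
      using s(1) by (simp add: dist_norm field_simps)
  qed
  then have "closure {y. P (s *\<^sub>R (x - y)) \<noteq> 0} \<subseteq> cball x (1 / s)"
    by (intro closure_minimal) auto
  moreover have "compact (closure {y. P (s *\<^sub>R (x - y)) \<noteq> 0})"
    using sub bounded_cball bounded_subset by (auto simp: compact_closure)
  moreover have "(\<lambda>y. P (s *\<^sub>R (x - y))) \<in> Cinf UNIV"
    using Cinf_Ck[OF unit_kernels_Cinf[OF P]] by (intro CinfI Ck_on_affine)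
  ultimately show ?thesis using s(2) by (auto simp: test_functions_def)
qed

lemma unit_kernels_integrable:
  assumes "P \<in> unit_kernels"
  shows "integrable lborel P"
proof -
  have "integrable lborel (\<lambda>x. indicator (cball 0 1) x *\<^sub>R P x)"
    using unit_kernels_continuous[OF assms] continuous_on_subset
    by (intro borel_integrable_compact) auto
  moreover have "(\<lambda>x. indicator (cball 0 1) x *\<^sub>R P x) = P"
    using unit_kernels_zero[OF assms] by (force simp: indicator_def fun_eq_iff)
  ultimately show ?thesis by simp
qed

lemma exists_mollifier:
  obtains \<rho> :: "real ^ 'n \<Rightarrow> real"
  where "\<rho> \<in> unit_kernels" "\<And>w. \<rho> w \<ge> 0" "(LINT w|lborel. \<rho> w) = 1"
proof -
  define u :: "real ^ 'n \<Rightarrow> real" where "u x = exp_bump 0 (1 - x \<bullet> x)" for x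
  have pos: "u x > 0" if "norm x < 1" for x
    using that by (simp add: u_def exp_bump_def dot_square_norm power_less_one_iff abs_square_less_1)
  have nonneg: "u x \<ge> 0" for x by (simp add: u_def exp_bump_def)
  have u: "u \<in> unit_kernels"
    using Ck_on_exp_bump_inner[where p = 0]
    by (auto simp: unit_kernels_def Cinf_def u_def[abs_def])
      (auto simp: exp_bump_def dot_square_norm abs_square_less_1)
  define I where "I = (LINT w|lborel. u w)"
  \<comment> \<open>A nonnegative bump of integral zero would vanish almost everywhere, but
    \<open>u\<close> is positive on the unit ball, which has positive volume.\<close>
  have "I \<noteq> 0"
  proof
    assume "I = 0"
    then have "AE w in lborel. u w = 0"
      using integral_nonneg_eq_0_iff_AE[OF unit_kernels_integrable[OF u]] nonneg
      by (simp add: I_def)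
    then have "AE w :: real ^ 'n in lborel. w \<notin> ball 0 1"
      by eventually_elim (use pos in force)
    then have "emeasure lborel (ball (0 :: real ^ 'n) 1) = 0"
      by (subst (asm) AE_iff_measurable[OF _ refl]) (auto simp: ball_def)
    then have "measure lborel (ball (0 :: real ^ 'n) 1) = 0" by (simp add: measure_def)
    moreover have "measure lborel (ball (0 :: real ^ 'n) 1) > 0"
      by (rule content_ball_pos) simp
    ultimately show False by simp
  qed
  then have "I > 0" using Bochner_Integration.integral_nonneg[of lborel u] nonneg by (simp add: I_def order_less_le)
  show thesis
  proof (rule that[of "\<lambda>w. inverse I * u w"])
    show "(\<lambda>w. inverse I * u w) \<in> unit_kernels"
      using u by (auto simp: unit_kernels_def Cinf_def intro!: Ck_on_mult)
    show "inverse I * u w \<ge> 0" for w using \<open>I > 0\<close> nonneg by simp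
    show "(LINT w|lborel. inverse I * u w) = 1" using \<open>I > 0\<close> by (simp flip: I_def)
  qed
qed

text \<open>Differentiation under the integral by dominated convergence. A Lipschitz constant at
  \<open>x0\<close> that is uniform in \<open>y\<close> bounds both the increments of
  \<open>K\<close> and the derivative \<open>K'\<close>, so \<open>2 * C * \<bar>f y\<bar>\<close>
  dominates the remainder quotients.\<close>

lemma has_derivative_integral_Lipschitz:
  fixes K :: "'a::euclidean_space \<Rightarrow> 'b \<Rightarrow> real" and f :: "'b \<Rightarrow> real"
  assumes f: "integrable M f"
    and K: "\<And>y. ((\<lambda>x. K x y) has_derivative K' y) (at x0)"
    and meas: "\<And>x. K x \<in> borel_measurable M"
    and Lip: "\<And>x y. \<bar>K x y - K x0 y\<bar> \<le> C * norm (x - x0)"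
    and int: "\<And>x. integrable M (\<lambda>y. f y * K x y)"
  shows "((\<lambda>x. LINT y|M. f y * K x y) has_derivative (\<lambda>v. LINT y|M. f y * K' y v)) (at x0)"
proof -
  note f_meas [measurable] = borel_measurable_integrable[OF f]
  note meas [measurable]
  \<comment> \<open>Nothing is assumed about \<open>K'\<close> as a function of \<open>y\<close>. As
    a limit of difference quotients it inherits measurability and the bound
    \<open>C * norm v\<close>.\<close>
  have quot: "(\<lambda>n. real (Suc n) * (K (x0 + inverse (real (Suc n)) *\<^sub>R v) y - K x0 y)) \<longlonglongrightarrow> K' y v" for y v
  proof -
    have "((\<lambda>t. K (x0 + t *\<^sub>R v) y) has_derivative (\<lambda>t. K' y (t *\<^sub>R v))) (at 0)"
      by (rule has_derivative_compose[where f = "\<lambda>t. x0 + t *\<^sub>R v" and g = "\<lambda>x. K x y"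
          and f' = "\<lambda>t. t *\<^sub>R v" and g' = "K' y"])
        (use K[of y] in \<open>auto intro!: derivative_eq_intros\<close>)
    then have "((\<lambda>t. K (x0 + t *\<^sub>R v) y) has_real_derivative K' y v) (at 0)"
      using linear_scale[OF has_derivative_linear[OF K[of y]]]
      by (simp add: has_field_derivative_def mult.commute[of _ "K' y v"] mult_commute_abs)
    then have "((\<lambda>t. (K (x0 + t *\<^sub>R v) y - K x0 y) / t) \<longlongrightarrow> K' y v) (at 0)"
      by (simp add: has_field_derivative_iff)
    moreover have "filterlim (\<lambda>n. inverse (real (Suc n))) (at 0) sequentially"
      unfolding filterlim_at using LIMSEQ_inverse_real_of_nat by auto
    ultimately have "(\<lambda>n. (K (x0 + inverse (real (Suc n)) *\<^sub>R v) y - K x0 y) / inverse (real (Suc n)))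
        \<longlonglongrightarrow> K' y v"
      by (rule filterlim_compose)
    then show ?thesis by (simp add: field_simps)
  qed
  have K'_meas [measurable]: "(\<lambda>y. K' y v) \<in> borel_measurable M" for v
    by (rule borel_measurable_LIMSEQ_real[OF quot]) simp
  have K'_bound: "\<bar>K' y v\<bar> \<le> C * norm v" for y v
  proof (rule LIMSEQ_le_const2)
    show "(\<lambda>n. \<bar>real (Suc n) * (K (x0 + inverse (real (Suc n)) *\<^sub>R v) y - K x0 y)\<bar>) \<longlonglongrightarrow> \<bar>K' y v\<bar>"
      by (intro tendsto_rabs quot)
    have "\<bar>real (Suc n) * (K (x0 + inverse (real (Suc n)) *\<^sub>R v) y - K x0 y)\<bar> \<le> C * norm v" for n
    proof -
      have "\<bar>real (Suc n) * (K (x0 + inverse (real (Suc n)) *\<^sub>R v) y - K x0 y)\<bar>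
          \<le> real (Suc n) * (C * norm (inverse (real (Suc n)) *\<^sub>R v))"
        unfolding abs_mult using Lip[of "x0 + inverse (real (Suc n)) *\<^sub>R v" y]
        by (intro mult_mono) auto
      also have "\<dots> = C * norm v" by simp
      finally show ?thesis .
    qed
    then show "\<exists>N. \<forall>n\<ge>N. \<bar>real (Suc n) * (K (x0 + inverse (real (Suc n)) *\<^sub>R v) y - K x0 y)\<bar> \<le> C * norm v"
      by blast
  qed
  have int': "integrable M (\<lambda>y. f y * K' y v)" for v
  proof (rule Bochner_Integration.integrable_bound)
    show "integrable M (\<lambda>y. (C * norm v) * f y)" using f by simp
    have "\<bar>f y * K' y v\<bar> \<le> \<bar>(C * norm v) * f y\<bar>" for y
    proof -
      have "\<bar>f y\<bar> * \<bar>K' y v\<bar> \<le> \<bar>f y\<bar> * (C * norm v)"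
        by (intro mult_left_mono K'_bound) simp
      also have "\<dots> = \<bar>(C * norm v) * f y\<bar>"
        using order_trans[OF abs_ge_zero K'_bound[of y v]] abs_mult[of "C * norm v" "f y"]
        by (simp only: abs_of_nonneg mult.commute)
      finally show ?thesis by (simp add: abs_mult)
    qed
    then show "AE y in M. norm (f y * K' y v) \<le> norm ((C * norm v) * f y)" by simp
  qed simp
  have lin: "K' y (a + b) = K' y a + K' y b" "K' y (c *\<^sub>R a) = c * K' y a" for y a b c
    using linear_add[OF has_derivative_linear[OF K[of y]]]
      linear_scale[OF has_derivative_linear[OF K[of y]]] by auto
  have bl: "bounded_linear (\<lambda>v. LINT y|M. f y * K' y v)"
  proof (intro linear_conv_bounded_linear[THEN iffD1] linearI)
    show "(LINT y|M. f y * K' y (a + b)) = (LINT y|M. f y * K' y a) + (LINT y|M. f y * K' y b)" for a b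
      using int' by (simp add: lin distrib_left)
    show "(LINT y|M. f y * K' y (c *\<^sub>R a)) = c *\<^sub>R (LINT y|M. f y * K' y a)" for c a
      by (simp add: lin mult.left_commute[of _ c])
  qed
  show ?thesis
    unfolding has_derivative_at2 tendsto_at_iff_sequentially
  proof (intro conjI bl allI impI)
    fix X :: "nat \<Rightarrow> 'a" assume X: "\<forall>i. X i \<in> UNIV - {x0}" "X \<longlonglongrightarrow> x0"
    define R where "R i y = (1 / norm (X i - x0)) * (f y * (K (X i) y - K x0 y - K' y (X i - x0)))" for i y
    have "(\<lambda>i. LINT y|M. R i y) \<longlonglongrightarrow> (LINT y|M. 0)"
    proof (rule integral_dominated_convergence[where w = "\<lambda>y. (2 * C) * \<bar>f y\<bar>"])
      show "AE y in M. (\<lambda>i. R i y) \<longlonglongrightarrow> 0"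
      proof (rule AE_I2)
        fix y
        have "((\<lambda>x. (1 / norm (x - x0)) *\<^sub>R (K x y - (K x0 y + K' y (x - x0)))) \<longlongrightarrow> 0) (at x0)"
          using K[of y] by (simp add: has_derivative_at2)
        then have "(\<lambda>i. (1 / norm (X i - x0)) *\<^sub>R (K (X i) y - (K x0 y + K' y (X i - x0)))) \<longlonglongrightarrow> 0"
          using X by (auto simp: tendsto_at_iff_sequentially o_def)
        from tendsto_mult_left[OF this, of "f y"] show "(\<lambda>i. R i y) \<longlonglongrightarrow> 0"
          by (simp add: R_def algebra_simps)
      qed
      have "\<bar>R i y\<bar> \<le> 2 * C * \<bar>f y\<bar>" for i y
      proof -
        have n: "norm (X i - x0) > 0" using X(1) by auto
        have "\<bar>K (X i) y - K x0 y - K' y (X i - x0)\<bar> \<le> 2 * C * norm (X i - x0)"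
          using Lip[of "X i" y] K'_bound[of y "X i - x0"] by linarith
        then have "\<bar>f y\<bar> * \<bar>K (X i) y - K x0 y - K' y (X i - x0)\<bar> \<le> \<bar>f y\<bar> * (2 * C * norm (X i - x0))"
          by (rule mult_left_mono) simp
        moreover have "\<bar>R i y\<bar> = \<bar>f y\<bar> * \<bar>K (X i) y - K x0 y - K' y (X i - x0)\<bar> / norm (X i - x0)"
          by (simp add: R_def abs_mult)
        ultimately show ?thesis using n by (simp add: pos_divide_le_eq mult_ac)
      qed
      then show "AE y in M. norm (R i y) \<le> 2 * C * \<bar>f y\<bar>" for i by simp
      show "R i \<in> borel_measurable M" for i unfolding R_def by measurable
    qed (use f in auto)
    moreover have "(LINT y|M. R i y) = (1 / norm (X i - x0)) *
        ((LINT y|M. f y * K (X i) y) - ((LINT y|M. f y * K x0 y) + (LINT y|M. f y * K' y (X i - x0))))" for i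
      using int int' by (simp add: R_def right_diff_distrib add_divide_distrib)
    ultimately show "((\<lambda>x. (1 / norm (x - x0)) *\<^sub>R ((LINT y|M. f y * K x y)
        - ((LINT y|M. f y * K x0 y) + (LINT y|M. f y * K' y (x - x0))))) \<circ> X) \<longlonglongrightarrow> 0"
      by (simp add: o_def)
  qed
qed

text \<open>The normalising power of \<open>\<sigma> x\<close> is left out, so that derivatives in
  \<open>x\<close> are again combinations of integrals of this form. \<open>\<sigma>\<close> is the
  reciprocal of the averaging radius.\<close>

definition kernel_int ::
    "(real ^ 'n \<Rightarrow> real) \<Rightarrow> (real ^ 'n \<Rightarrow> real) \<Rightarrow> (real ^ 'n \<Rightarrow> real) \<Rightarrow> real ^ 'n \<Rightarrow> real"
  where "kernel_int P \<sigma> f x = (LINT y|lborel. f y * P (\<sigma> x *\<^sub>R (x - y)))"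

lemma integrable_kernel_int:
  assumes P: "P \<in> unit_kernels" and f: "integrable lborel f"
  shows "integrable lborel (\<lambda>y. f y * P (s *\<^sub>R (x - y)))"
proof -
  obtain B where B: "B > 0" "\<And>w. \<bar>P w\<bar> \<le> B" using unit_kernels_bounded[OF P] by blast
  show ?thesis
  proof (rule Bochner_Integration.integrable_bound)
    show "integrable lborel (\<lambda>y. B * f y)" using f by simp
    show "(\<lambda>y. f y * P (s *\<^sub>R (x - y))) \<in> borel_measurable lborel"
      using unit_kernels_measurable[OF P] borel_measurable_integrable[OF f] by measurable
    show "AE y in lborel. norm (f y * P (s *\<^sub>R (x - y))) \<le> norm (B * f y)"
      using B by (auto simp: abs_mult mult.commute[of B] intro!: mult_left_mono always_eventually)
  qed
qed

text \<open>The bound must hold for all \<open>x\<close>, although \<sigma> is controlled only near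
  \<open>x0\<close>. For \<open>x\<close> near \<open>x0\<close> it follows from the Lipschitz bound
  of \<open>P\<close> if \<open>y\<close> is near, and both kernel values vanish if \<open>y\<close>
  is far. For \<open>x\<close> away from \<open>x0\<close> the boundedness of \<open>P\<close>
  suffices, since \<open>norm (x - x0)\<close> is then at least \<open>r\<close>.\<close>

lemma scaled_kernel_Lipschitz:
  assumes P: "P \<in> unit_kernels" and \<sigma>: "(\<sigma> has_derivative \<sigma>') (at x0)" and pos: "\<sigma> x0 > 0"
  obtains C where "\<And>x y. \<bar>P (\<sigma> x *\<^sub>R (x - y)) - P (\<sigma> x0 *\<^sub>R (x0 - y))\<bar> \<le> C * norm (x - x0)"
proof -
  obtain B where B: "B > 0" "\<And>w. \<bar>P w\<bar> \<le> B" using unit_kernels_bounded[OF P] by blast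
  obtain L where L: "L > 0" "\<And>v w. \<bar>P v - P w\<bar> \<le> L * norm (v - w)" using unit_kernels_lipschitz[OF P] by blast
  obtain A where A: "A > 0" "\<And>v. norm (\<sigma>' v) \<le> norm v * A"
    using bounded_linear.pos_bounded[OF has_derivative_bounded_linear[OF \<sigma>]] by blast
  obtain d where d: "d > 0" "\<And>x. norm (x - x0) < d \<Longrightarrow> norm (\<sigma> x - \<sigma> x0 - \<sigma>' (x - x0)) \<le> norm (x - x0)"
    using \<sigma> unfolding has_derivative_at_alt by (metis mult_1 zero_less_one)
  \<comment> \<open>The three bounds give the linear approximation of \<sigma>, a displacement of at
    most 1, and \<open>\<sigma> x \<ge> \<sigma> x0 / 2\<close>.\<close>
  define r where "r = min d (min 1 (\<sigma> x0 / (2 * (A + 1))))"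
  have r: "r > 0" "r \<le> d" "r \<le> 1" "r * (A + 1) \<le> \<sigma> x0 / 2"
  proof -
    show "r > 0" using d(1) pos A(1) by (simp add: r_def)
    show "r \<le> d" "r \<le> 1" by (simp_all add: r_def)
    have "r \<le> \<sigma> x0 / (2 * (A + 1))" by (simp add: r_def)
    moreover have "2 * (A + 1) > 0" using A(1) by simp
    ultimately have "r * (2 * (A + 1)) \<le> \<sigma> x0" by (simp only: pos_le_divide_eq)
    then show "r * (A + 1) \<le> \<sigma> x0 / 2" by (simp add: algebra_simps)
  qed
  have near: "\<bar>\<sigma> x - \<sigma> x0\<bar> \<le> (A + 1) * norm (x - x0)" if "norm (x - x0) < r" for x
    using d(2)[of x] A(2)[of "x - x0"] that r(2) by (simp add: algebra_simps)
  \<comment> \<open>If \<open>norm (x0 - y) \<ge> R\<close>, then \<open>y\<close> has distance at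
    least \<open>3 / \<sigma> x0\<close> from both centres. As both scales are at least
    \<open>\<sigma> x0 / 2\<close>, both arguments of \<open>P\<close> have norm at least 3/2,
    outside the support.\<close>
  define R where "R = 3 / \<sigma> x0 + 1"
  define C1 where "C1 = L * (\<sigma> x0 + (A + 1) + (A + 1) * R)"
  have C1: "\<bar>P (\<sigma> x *\<^sub>R (x - y)) - P (\<sigma> x0 *\<^sub>R (x0 - y))\<bar> \<le> C1 * norm (x - x0)"
    if x: "norm (x - x0) < r" for x y
  proof -
    have "(A + 1) * norm (x - x0) \<le> r * (A + 1)" using x A(1) by simp
    then have \<sigma>x: "\<sigma> x \<ge> \<sigma> x0 / 2" "\<bar>\<sigma> x\<bar> \<le> \<sigma> x0 + (A + 1) * norm (x - x0)"
      using near[OF x] r(4) pos by linarith+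
    show ?thesis
    proof (cases "norm (x0 - y) < R")
      case True
      have "norm (\<sigma> x *\<^sub>R (x - y) - \<sigma> x0 *\<^sub>R (x0 - y))
          = norm (\<sigma> x *\<^sub>R (x - x0) + (\<sigma> x - \<sigma> x0) *\<^sub>R (x0 - y))"
        by (simp add: algebra_simps)
      also have "\<dots> \<le> \<bar>\<sigma> x\<bar> * norm (x - x0) + \<bar>\<sigma> x - \<sigma> x0\<bar> * norm (x0 - y)"
        by (metis norm_scaleR norm_triangle_ineq)
      also have "\<dots> \<le> (\<sigma> x0 + (A + 1)) * norm (x - x0) + ((A + 1) * norm (x - x0)) * R"
      proof (intro add_mono mult_mono near[OF x])
        have "(A + 1) * norm (x - x0) \<le> (A + 1) * 1"
          using x r(3) A(1) by (intro mult_left_mono) auto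
        then show "\<bar>\<sigma> x\<bar> \<le> \<sigma> x0 + (A + 1)" using \<sigma>x(2) by simp
      qed (use True pos A(1) in auto)
      finally have "L * norm (\<sigma> x *\<^sub>R (x - y) - \<sigma> x0 *\<^sub>R (x0 - y))
          \<le> L * ((\<sigma> x0 + (A + 1)) * norm (x - x0) + ((A + 1) * norm (x - x0)) * R)"
        using L(1) by simp
      also have "\<dots> = C1 * norm (x - x0)" by (simp add: C1_def algebra_simps)
      finally show ?thesis using L(2) order_trans by blast
    next
      case False
      have "norm (x0 - y) \<ge> 3 / \<sigma> x0" "norm (x - y) \<ge> 3 / \<sigma> x0"
        using False x r(3) norm_triangle_ineq[of "x0 - x" "x - y"]
        by (auto simp: R_def norm_minus_commute)
      then have "\<sigma> x0 * norm (x0 - y) \<ge> \<sigma> x0 * (3 / \<sigma> x0)"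
        "\<sigma> x * norm (x - y) \<ge> (\<sigma> x0 / 2) * (3 / \<sigma> x0)"
        using pos \<sigma>x(1) by (intro mult_mono; simp)+
      then have "norm (\<sigma> x0 *\<^sub>R (x0 - y)) > 1" "norm (\<sigma> x *\<^sub>R (x - y)) > 1"
        using pos \<sigma>x(1) by auto
      then have "P (\<sigma> x0 *\<^sub>R (x0 - y)) = 0" "P (\<sigma> x *\<^sub>R (x - y)) = 0"
        using unit_kernels_zero[OF P] by blast+
      then show ?thesis using L(1) pos A(1) by (simp add: C1_def R_def)
    qed
  qed
  show thesis
  proof (rule that[of "C1 + 2 * B / r"])
    fix x y
    show "\<bar>P (\<sigma> x *\<^sub>R (x - y)) - P (\<sigma> x0 *\<^sub>R (x0 - y))\<bar> \<le> (C1 + 2 * B / r) * norm (x - x0)"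
    proof (cases "norm (x - x0) < r")
      case True
      have "C1 * norm (x - x0) \<le> (C1 + 2 * B / r) * norm (x - x0)"
        using B r(1) by (intro mult_right_mono) auto
      with C1[OF True, of y] show ?thesis by linarith
    next
      case False
      have "\<bar>P (\<sigma> x *\<^sub>R (x - y)) - P (\<sigma> x0 *\<^sub>R (x0 - y))\<bar> \<le> 2 * B"
        using B(2)[of "\<sigma> x *\<^sub>R (x - y)"] B(2)[of "\<sigma> x0 *\<^sub>R (x0 - y)"] by linarith
      also have "2 * B = 2 * B / r * r" using r(1) by simp
      also have "\<dots> \<le> (C1 + 2 * B / r) * norm (x - x0)"
      proof (rule mult_mono)
        show "2 * B / r \<le> C1 + 2 * B / r" using L(1) pos A(1) by (simp add: C1_def R_def)
        then show "0 \<le> C1 + 2 * B / r" using B(1) r(1) by (smt (verit) divide_pos_pos)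
      qed (use False r(1) in auto)
      finally show ?thesis .
    qed
  qed
qed

lemma has_derivative_kernel_int:
  assumes P: "P \<in> unit_kernels" and f: "integrable lborel f"
    and \<sigma>: "(\<sigma> has_derivative \<sigma>') (at x)" and pos: "\<sigma> x > 0"
  shows "(kernel_int P \<sigma> f has_derivative
    (\<lambda>v. LINT y|lborel. f y * (grad P (\<sigma> x *\<^sub>R (x - y)) \<bullet> (\<sigma> x *\<^sub>R v + \<sigma>' v *\<^sub>R (x - y))))) (at x)"
proof -
  obtain C where C: "\<And>z y. \<bar>P (\<sigma> z *\<^sub>R (z - y)) - P (\<sigma> x *\<^sub>R (x - y))\<bar> \<le> C * norm (z - x)"
    using scaled_kernel_Lipschitz[OF P \<sigma> pos] by blast
  show ?thesis
    unfolding kernel_int_def[abs_def]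
  proof (rule has_derivative_integral_Lipschitz[OF f, where C = C])
    fix y
    show "((\<lambda>z. P (\<sigma> z *\<^sub>R (z - y))) has_derivative
        (\<lambda>v. grad P (\<sigma> x *\<^sub>R (x - y)) \<bullet> (\<sigma> x *\<^sub>R v + \<sigma>' v *\<^sub>R (x - y)))) (at x)"
    proof (rule has_derivative_compose[where f = "\<lambda>z. \<sigma> z *\<^sub>R (z - y)" and g = P
          and f' = "\<lambda>v. \<sigma> x *\<^sub>R v + \<sigma>' v *\<^sub>R (x - y)" and g' = "\<lambda>u. grad P (\<sigma> x *\<^sub>R (x - y)) \<bullet> u"])
      show "((\<lambda>z. \<sigma> z *\<^sub>R (z - y)) has_derivative (\<lambda>v. \<sigma> x *\<^sub>R v + \<sigma>' v *\<^sub>R (x - y))) (at x)"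
        using \<sigma> by (auto intro!: derivative_eq_intros)
      show "(P has_derivative (\<lambda>u. grad P (\<sigma> x *\<^sub>R (x - y)) \<bullet> u)) (at (\<sigma> x *\<^sub>R (x - y)))"
        using Cinf_has_derivative[OF open_UNIV unit_kernels_Cinf[OF P] UNIV_I]
        by (rule has_derivative_grad)
    qed
  next
    show "(\<lambda>y. P (\<sigma> z *\<^sub>R (z - y))) \<in> borel_measurable lborel" for z
      using unit_kernels_measurable[OF P] by measurable
  qed (intro C integrable_kernel_int P f)+
qed

text \<open>The derivative of the scale produces the vector \<open>x - y\<close>, which is not a
  function of the kernel argument alone. Writing it as
  \<open>(\<sigma> x *\<^sub>R (x - y)) / \<sigma> x\<close> absorbs it into the kernels
  \<open>w $ j * partial_deriv j P w\<close>, which are unit kernels again.\<close>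

lemma kernel_int_partial_deriv:
  assumes P: "P \<in> unit_kernels" and f: "integrable lborel f"
    and \<sigma>: "(\<sigma> has_derivative \<sigma>') (at x)" and pos: "\<sigma> x > 0"
  shows "partial_deriv i (kernel_int P \<sigma> f) x =
    \<sigma> x * kernel_int (partial_deriv i P) \<sigma> f x
    + (\<sigma>' (axis i 1) / \<sigma> x) * (\<Sum>j\<in>UNIV. kernel_int (\<lambda>w. w $ j * partial_deriv j P w) \<sigma> f x)"
proof -
  have *: "grad P (\<sigma> x *\<^sub>R (x - y)) \<bullet> (\<sigma> x *\<^sub>R axis i 1 + \<sigma>' (axis i 1) *\<^sub>R (x - y))
    = \<sigma> x * partial_deriv i P (\<sigma> x *\<^sub>R (x - y)) + (\<sigma>' (axis i 1) / \<sigma> x) *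
      (\<Sum>j\<in>UNIV. (\<sigma> x *\<^sub>R (x - y)) $ j * partial_deriv j P (\<sigma> x *\<^sub>R (x - y)))" for y
  proof -
    let ?w = "\<sigma> x *\<^sub>R (x - y)"
    have "grad P ?w \<bullet> (x - y) = (\<Sum>j\<in>UNIV. ?w $ j * partial_deriv j P ?w) / \<sigma> x"
      using pos by (simp add: grad_def inner_vec_def sum_divide_distrib mult.commute)
    moreover have "grad P ?w \<bullet> axis i 1 = partial_deriv i P ?w"
      by (simp add: inner_axis grad_def)
    ultimately show ?thesis by (simp add: inner_add_right)
  qed
  have alg: "u * (s * a + c * (\<Sum>j\<in>UNIV. b j)) = s * (u * a) + c * (\<Sum>j\<in>UNIV. u * b j)"
    for u s a c :: real and b :: "'a \<Rightarrow> real"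
    by (simp add: sum_distrib_left[symmetric] algebra_simps)
  note PI = unit_kernels_partial_deriv[OF P] unit_kernels_component[OF unit_kernels_partial_deriv[OF P]]
  note int = integrable_kernel_int[OF PI(1) f] integrable_kernel_int[OF PI(2) f]
  have "partial_deriv i (kernel_int P \<sigma> f) x =
    (LINT y|lborel. \<sigma> x * (f y * partial_deriv i P (\<sigma> x *\<^sub>R (x - y))) + (\<sigma>' (axis i 1) / \<sigma> x) *
      (\<Sum>j\<in>UNIV. f y * ((\<sigma> x *\<^sub>R (x - y)) $ j * partial_deriv j P (\<sigma> x *\<^sub>R (x - y)))))"
    unfolding partial_deriv_eq[OF has_derivative_kernel_int[OF assms]] * alg ..
  also have "\<dots> = \<sigma> x * kernel_int (partial_deriv i P) \<sigma> f x
    + (\<sigma>' (axis i 1) / \<sigma> x) * (\<Sum>j\<in>UNIV. kernel_int (\<lambda>w. w $ j * partial_deriv j P w) \<sigma> f x)"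
    unfolding kernel_int_def using int
    by (subst Bochner_Integration.integral_add) (auto intro!: Bochner_Integration.integral_sum)
  finally show ?thesis .
qed

text \<open>The derivative formula expresses partial derivatives through integrals of other unit
  kernels and through \<open>\<sigma>\<close>; hence the induction on \<open>k\<close> runs over all
  \<open>P\<close> at once.\<close>

lemma Ck_on_kernel_int:
  assumes U: "open U" and \<sigma>: "\<sigma> \<in> Cinf U" "\<And>x. x \<in> U \<Longrightarrow> \<sigma> x > 0"
    and P: "P \<in> unit_kernels" and f: "integrable lborel f"
  shows "Ck_on k U (kernel_int P \<sigma> f)"
  using P
proof (induction k arbitrary: P)
  case 0
  have "(kernel_int P \<sigma> f has_derivative
    (\<lambda>v. LINT y|lborel. f y * (grad P (\<sigma> x *\<^sub>R (x - y)) \<bullet>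
      (\<sigma> x *\<^sub>R v + frechet_derivative \<sigma> (at x) v *\<^sub>R (x - y))))) (at x)" if "x \<in> U" for x
    by (rule has_derivative_kernel_int[OF 0 f Cinf_has_derivative[OF U \<sigma>(1) that] \<sigma>(2)[OF that]])
  then show ?case
    by (auto intro!: continuous_at_imp_continuous_on has_derivative_continuous)
next
  case (Suc k)
  have "kernel_int P \<sigma> f differentiable_on U"
    unfolding differentiable_on_eq_differentiable_at[OF U] differentiable_def
    using has_derivative_kernel_int[OF Suc.prems f Cinf_has_derivative[OF U \<sigma>(1)] \<sigma>(2)] by blast
  moreover have "Ck_on k U (partial_deriv i (kernel_int P \<sigma> f))" for i
  proof -
    have *: "Ck_on k U (\<lambda>x. \<sigma> x * kernel_int (partial_deriv i P) \<sigma> f x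
      + (partial_deriv i \<sigma> x * inverse (\<sigma> x)) *
        (\<Sum>j\<in>UNIV. kernel_int (\<lambda>w. w $ j * partial_deriv j P w) \<sigma> f x))"
      using \<sigma>(2)[THEN less_imp_neq] by (intro Ck_on_add Ck_on_mult Ck_on_sum Ck_on_inverse Suc.IH U Cinf_Ck \<sigma>(1)
        Cinf_partial_deriv unit_kernels_component unit_kernels_partial_deriv Suc.prems) fastforce
    have "partial_deriv i (kernel_int P \<sigma> f) x = \<sigma> x * kernel_int (partial_deriv i P) \<sigma> f x
      + (partial_deriv i \<sigma> x * inverse (\<sigma> x)) *
        (\<Sum>j\<in>UNIV. kernel_int (\<lambda>w. w $ j * partial_deriv j P w) \<sigma> f x)" if "x \<in> U" for x
      using kernel_int_partial_deriv[OF Suc.prems f Cinf_has_derivative[OF U \<sigma>(1) that] \<sigma>(2)[OF that]]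
      by (simp add: partial_deriv_def[of i \<sigma>] divide_inverse)
    with * show ?thesis by (subst Ck_on_cong[OF U])
  qed
  ultimately show ?case by simp
qed

section \<open>Normalisation of scaled kernels and averages of indicators\<close>

lemma lborel_integral_reflect_scale:
  fixes P :: "real ^ 'n \<Rightarrow> real"
  assumes "s > 0" and [measurable]: "P \<in> borel_measurable borel"
  shows "s ^ CARD('n) * (LINT y|lborel. P (s *\<^sub>R (x - y))) = (LINT w|lborel. P w)"
proof -
  have "lborel = density (distr lborel borel (\<lambda>y. s *\<^sub>R x + (- s) *\<^sub>R y)) (\<lambda>_. \<bar>- s\<bar> ^ DIM(real ^ 'n))"
    using assms(1) by (intro lborel_affine) simp
  then have "(LINT w|lborel. P w)
      = (LINT w|density (distr lborel borel (\<lambda>y. s *\<^sub>R x + (- s) *\<^sub>R y)) (\<lambda>_. \<bar>- s\<bar> ^ CARD('n)). P w)"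
    by simp
  also have "\<dots> = (LINT y|lborel. s ^ CARD('n) * P (s *\<^sub>R x + (- s) *\<^sub>R y))"
    using assms(1) by (subst integral_real_density) (auto simp: integral_distr)
  finally show ?thesis by (simp add: scaleR_diff_right)
qed

lemma unit_kernels_integrable_scaled:
  assumes "P \<in> unit_kernels" "s > 0"
  shows "integrable lborel (\<lambda>y. P (s *\<^sub>R (x - y)))"
proof -
  have "integrable (density (distr lborel borel (\<lambda>y. s *\<^sub>R x + (- s) *\<^sub>R y)) (\<lambda>_. \<bar>- s\<bar> ^ DIM(real ^ 'a))) P"
    using unit_kernels_integrable[OF assms(1)] assms(2) lborel_affine[of "-s" "s *\<^sub>R x"] by simp
  moreover note [measurable] = unit_kernels_measurable[OF assms(1)]
  ultimately show ?thesis
    using assms(2)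
    by (subst (asm) integrable_real_density) (auto simp: integrable_distr_eq scaleR_diff_right)
qed

lemma unit_kernels_abs_integral_scaled:
  fixes P :: "real ^ 'n \<Rightarrow> real"
  assumes "P \<in> unit_kernels" "s > 0"
  shows "s ^ CARD('n) * (LINT y|lborel. \<bar>P (s *\<^sub>R (x - y))\<bar>) = (LINT w|lborel. \<bar>P w\<bar>)"
  using unit_kernels_measurable[OF assms(1)]
  by (intro lborel_integral_reflect_scale assms(2)) measurable

text \<open>After normalisation the scale disappears. For the mollifier this gives the bound 1 for
  smoothed indicators, for its partial derivatives it bounds their gradients.\<close>

lemma kernel_int_indicator_bound:
  fixes P :: "real ^ 'n \<Rightarrow> real"
  assumes P: "P \<in> unit_kernels" and pos: "\<sigma> x > 0" and A: "A \<in> sets borel"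
  shows "\<bar>\<sigma> x ^ CARD('n) * kernel_int P \<sigma> (indicator A) x\<bar> \<le> (LINT w|lborel. \<bar>P w\<bar>)"
proof -
  note [measurable] = unit_kernels_measurable[OF P] A
  have "\<bar>kernel_int P \<sigma> (indicator A) x\<bar> \<le> (LINT y|lborel. \<bar>indicator A y * P (\<sigma> x *\<^sub>R (x - y))\<bar>)"
    unfolding kernel_int_def by (rule integral_abs_bound)
  also have "\<dots> \<le> (LINT y|lborel. \<bar>P (\<sigma> x *\<^sub>R (x - y))\<bar>)"
  proof (intro integral_mono integrable_abs)
    show int: "integrable lborel (\<lambda>y. P (\<sigma> x *\<^sub>R (x - y)))"
      by (rule unit_kernels_integrable_scaled[OF P pos])
    show "integrable lborel (\<lambda>y. indicator A y * P (\<sigma> x *\<^sub>R (x - y)))"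
      by (rule Bochner_Integration.integrable_bound[OF int]) (auto simp: indicator_def)
  qed (auto simp: indicator_def)
  finally have "\<sigma> x ^ CARD('n) * \<bar>kernel_int P \<sigma> (indicator A) x\<bar>
      \<le> \<sigma> x ^ CARD('n) * (LINT y|lborel. \<bar>P (\<sigma> x *\<^sub>R (x - y))\<bar>)"
    using pos by (intro mult_left_mono) auto
  with pos show ?thesis by (simp add: abs_mult unit_kernels_abs_integral_scaled[OF P])
qed

lemma kernel_support_dist:
  assumes "P \<in> unit_kernels" "s > 0" "P (s *\<^sub>R (x - y)) \<noteq> 0"
  shows "dist x y \<le> 1 / s"
proof -
  have "norm (s *\<^sub>R (x - y)) \<le> 1"
    using unit_kernels_zero[OF assms(1)] assms(3) by (meson not_le)
  then have "s * norm (x - y) \<le> 1" using assms(2) by (simp only: norm_scaleR abs_of_pos)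
  then show ?thesis using assms(2) by (simp add: dist_norm field_simps)
qed

text \<open>Where the kernel sees only points of \<open>A\<close>, the average equals the total mass
  of the kernel. With the next lemma this makes smoothed indicators exact away from the frontier of
  the set.\<close>

lemma kernel_int_indicator_inside:
  fixes \<rho> :: "real ^ 'n \<Rightarrow> real"
  assumes \<rho>: "\<rho> \<in> unit_kernels" "(LINT w|lborel. \<rho> w) = 1" and pos: "\<sigma> x > 0"
    and sub: "\<And>y. dist x y \<le> 1 / \<sigma> x \<Longrightarrow> y \<in> A"
  shows "\<sigma> x ^ CARD('n) * kernel_int \<rho> \<sigma> (indicator A) x = 1"
proof -
  have *: "indicator A y * \<rho> (\<sigma> x *\<^sub>R (x - y)) = \<rho> (\<sigma> x *\<^sub>R (x - y))" for y
    using kernel_support_dist[OF \<rho>(1) pos, of x y] sub[of y]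
    by (cases "\<rho> (\<sigma> x *\<^sub>R (x - y)) = 0") (auto simp: indicator_def)
  show ?thesis
    unfolding kernel_int_def *
    using lborel_integral_reflect_scale[OF pos unit_kernels_measurable[OF \<rho>(1)]] \<rho>(2) by simp
qed

lemma kernel_int_indicator_outside:
  assumes "\<rho> \<in> unit_kernels" "\<sigma> x > 0" "\<And>y. dist x y \<le> 1 / \<sigma> x \<Longrightarrow> y \<notin> A"
  shows "kernel_int \<rho> \<sigma> (indicator A) x = 0"
proof -
  have *: "indicator A y * \<rho> (\<sigma> x *\<^sub>R (x - y)) = 0" for y
    using kernel_support_dist[OF assms(1,2), of x y] assms(3)[of y]
    by (auto simp: indicator_def)
  show ?thesis unfolding kernel_int_def * by simp
qed

section \<open>A smooth function comparable to the distance to the boundary\<close>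

text \<open>The cap at 1 bounds all radii derived from \<open>depth\<close> and lets the dyadic
  layers below start at index 0.\<close>

definition depth :: "'a::metric_space set \<Rightarrow> 'a \<Rightarrow> real" where
  "depth D x = min 1 (infdist x (- D))"

lemma depth_le_1: "depth D x \<le> 1"
  by (simp add: depth_def)

lemma depth_nonneg: "depth D x \<ge> 0"
  by (simp add: depth_def infdist_nonneg)

lemma depth_Lipschitz: "depth D x \<le> depth D y + dist x y"
  using infdist_triangle[of x "- D" y] zero_le_dist[of x y]
  unfolding depth_def by linarith

lemma continuous_on_depth [continuous_intros]: "continuous_on S (depth D)"
  unfolding depth_def[abs_def] by (intro continuous_intros)

lemma depth_ball_subset:
  assumes "dist x y < depth D x" shows "y \<in> D"
  using assms infdist_le[of y "- D" x] by (force simp: depth_def)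

locale finite_domain =
  fixes D :: "(real ^ 'n) set"
  assumes open_D: "open D" and finite_D: "emeasure lborel D < \<infinity>"
begin

lemma D_borel [measurable]: "D \<in> sets borel"
  using open_D by simp

text \<open>\<open>infdist\<close> to the empty set is 0 by convention, so on the whole space
  \<open>depth\<close> would vanish everywhere. Finite measure rules this case out.\<close>

lemma Compl_nonempty: "- D \<noteq> {}"
  using finite_D emeasure_lborel_UNIV[where ?'a = "real ^ 'n"] by (metis Compl_UNIV_eq double_compl less_irrefl)

lemma depth_pos: "x \<in> D \<Longrightarrow> depth D x > 0"
  using in_closed_iff_infdist_zero[of "- D" x] open_D Compl_nonempty infdist_nonneg[of x "- D"]
  by (auto simp: depth_def closed_Compl order_less_le)

lemma depth_zero: "x \<notin> D \<Longrightarrow> depth D x = 0"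
  by (simp add: depth_def)

lemma depth_pos_iff: "depth D x > 0 \<longleftrightarrow> x \<in> D"
  using depth_pos depth_zero by fastforce

text \<open>\<eta> is the sum of \<open>(1/2) ^ n * \<theta> n\<close>, where
  \<open>\<theta> n\<close> smooths the indicator of the points deeper than \<open>(1/2) ^ n\<close>
  at a radius proportional to \<open>(1/2) ^ n\<close>. Around each point only one term varies, so
  smoothness and the gradient bound are those of a single term.\<close>

lemma exists_smooth_scale:
  obtains \<eta> C where "\<eta> \<in> Cinf D"
    "\<And>x. x \<in> D \<Longrightarrow> 4 / 5 * depth D x \<le> \<eta> x \<and> \<eta> x \<le> 16 / 5 * depth D x"
    "\<And>x i. x \<in> D \<Longrightarrow> \<bar>partial_deriv i \<eta> x\<bar> \<le> C"
proof -
  obtain \<rho> :: "real ^ 'n \<Rightarrow> real"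
    where \<rho>: "\<rho> \<in> unit_kernels" "\<And>w. \<rho> w \<ge> 0" "(LINT w|lborel. \<rho> w) = 1"
    using exists_mollifier by blast
  note [measurable] = unit_kernels_measurable[OF \<rho>(1)]
  define A where "A n = {x. depth D x > (1/2) ^ n}" for n :: nat
  \<comment> \<open>The kernel radius \<open>1 / s n\<close> is a quarter of the threshold of
    \<open>A n\<close>. As \<open>depth\<close> is 1-Lipschitz, \<open>\<theta> n\<close> can differ
    from 0 and 1 only where \<open>depth\<close> lies between 3/4 and 5/4 times
    \<open>(1/2) ^ n\<close>.\<close>
  define s :: "nat \<Rightarrow> real" where "s n = 4 * 2 ^ n" for n
  define \<theta> where "\<theta> n x = s n ^ CARD('n) * kernel_int \<rho> (\<lambda>_. s n) (indicator (A n)) x" for n x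
  have s_pos: "s n > 0" for n by (simp add: s_def)
  have inv_s: "1 / s n = (1/2) ^ n / 4" for n by (simp add: s_def power_one_over)
  have A_open: "open (A n)" for n
    unfolding A_def by (intro open_Collect_less continuous_intros)
  have A_borel: "A n \<in> sets borel" for n using A_open by simp
  have A_sub: "A n \<subseteq> D" for n
    unfolding A_def using depth_pos_iff by (force intro: less_trans[of 0 "(1/2)^n"])
  have A_int: "integrable lborel (indicator (A n) :: real ^ 'n \<Rightarrow> real)" for n
    using A_borel le_less_trans[OF emeasure_mono[OF A_sub[of n]] finite_D] by (simp add: integrable_indicator_iff)
  have \<theta>_Cinf: "\<theta> n \<in> Cinf UNIV" for n
    unfolding \<theta>_def[abs_def] using s_pos[of n] \<rho>(1) A_int[of n]
    by (intro CinfI Ck_on_mult Ck_on_const Ck_on_kernel_int) (auto intro!: CinfI)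
  have \<theta>_nonneg: "0 \<le> \<theta> n x" for n x
    unfolding \<theta>_def kernel_int_def using \<rho>(2) s_pos[of n]
    by (intro mult_nonneg_nonneg Bochner_Integration.integral_nonneg) auto
  have \<theta>_le1: "\<theta> n x \<le> 1" for n x
    using kernel_int_indicator_bound[OF \<rho>(1), of "\<lambda>_. s n" x "A n", OF s_pos A_borel] \<rho>(2,3)
    by (simp add: \<theta>_def)
  have \<theta>_one: "\<theta> n x = 1" if "depth D x > 5 / 4 * (1/2) ^ n" for n x
    unfolding \<theta>_def
  proof (rule kernel_int_indicator_inside[where \<sigma> = "\<lambda>_. s n", OF \<rho>(1,3) s_pos])
    fix y assume "dist x y \<le> 1 / s n"
    then show "y \<in> A n" using depth_Lipschitz[of D x y] that inv_s[of n] by (simp add: A_def)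
  qed
  have \<theta>_zero: "\<theta> n x = 0" if "depth D x < 3 / 4 * (1/2) ^ n" for n x
  proof -
    have "kernel_int \<rho> (\<lambda>_. s n) (indicator (A n)) x = 0"
    proof (rule kernel_int_indicator_outside[OF \<rho>(1)])
      fix y assume "dist x y \<le> 1 / s n"
      then show "y \<notin> A n" using depth_Lipschitz[of D y x] that inv_s[of n] by (simp add: A_def dist_commute)
    qed (rule s_pos)
    then show ?thesis by (simp add: \<theta>_def)
  qed
  define C where "C = 4 * (\<Sum>i\<in>UNIV. LINT w|lborel. \<bar>partial_deriv i \<rho> w\<bar>)"
  \<comment> \<open>Differentiation costs a factor \<open>s n\<close>, which the weight
    \<open>(1/2) ^ n\<close> of the series reduces to 4.\<close>
  have \<theta>_grad: "(1/2) ^ n * \<bar>partial_deriv i (\<theta> n) x\<bar> \<le> C" for n i x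
  proof -
    note P = unit_kernels_partial_deriv[OF \<rho>(1)]
    have K: "(kernel_int \<rho> (\<lambda>_. s n) (indicator (A n)) has_derivative
        frechet_derivative (kernel_int \<rho> (\<lambda>_. s n) (indicator (A n))) (at x)) (at x)"
      using has_derivative_kernel_int[OF \<rho>(1) A_int[of n], of "\<lambda>_. s n" "\<lambda>_. 0" x] s_pos[of n]
      by (auto simp: frechet_derivative_works[symmetric] differentiable_def)
    have "partial_deriv i (\<theta> n) x = s n ^ CARD('n) * partial_deriv i (kernel_int \<rho> (\<lambda>_. s n) (indicator (A n))) x"
      using partial_deriv_eq[OF has_derivative_mult_right[OF K]] by (simp add: \<theta>_def[abs_def] partial_deriv_def)
    also have "\<dots> = s n * (s n ^ CARD('n) * kernel_int (partial_deriv i \<rho>) (\<lambda>_. s n) (indicator (A n)) x)"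
      using kernel_int_partial_deriv[OF \<rho>(1) A_int[of n], of "\<lambda>_. s n" "\<lambda>_. 0" x i] s_pos[of n] by simp
    also have "\<bar>\<dots>\<bar> \<le> s n * (LINT w|lborel. \<bar>partial_deriv i \<rho> w\<bar>)"
      using kernel_int_indicator_bound[OF P[of i], of "\<lambda>_. s n" x "A n", OF s_pos A_borel] s_pos[of n]
      by (simp add: abs_mult)
    finally have "(1/2) ^ n * \<bar>partial_deriv i (\<theta> n) x\<bar> \<le> (1/2) ^ n * (s n * (LINT w|lborel. \<bar>partial_deriv i \<rho> w\<bar>))"
      by (intro mult_left_mono) auto
    also have "\<dots> = 4 * (LINT w|lborel. \<bar>partial_deriv i \<rho> w\<bar>)"
      by (simp add: s_def power_one_over)
    also have "\<dots> \<le> C"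
      unfolding C_def by (intro mult_left_mono member_le_sum) auto
    finally show ?thesis .
  qed
  define \<eta> where "\<eta> x = (\<Sum>n. (1/2) ^ n * \<theta> n x)" for x
  have summ: "summable (\<lambda>n. (1/2) ^ n * \<theta> n x)" for x
  proof (rule summable_comparison_test')
    show "summable (\<lambda>n. (1/2 :: real) ^ n)" by (simp add: summable_geometric)
    show "norm ((1/2) ^ n * \<theta> n x) \<le> (1/2) ^ n" if "n \<ge> 0" for n
      using \<theta>_nonneg[of n x] \<theta>_le1[of n x] by (simp add: abs_mult mult_left_le)
  qed
  \<comment> \<open>In this layer the terms before \<open>N\<close> vanish and those after
    \<open>N\<close> have \<open>\<theta> n x = 1\<close>; the latter add up to
    \<open>(1/2) ^ N\<close>.\<close>
  have loc: "\<eta> x = (1/2) ^ N * \<theta> N x + (1/2) ^ N"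
    if x: "5 / 4 * (1/2) ^ Suc N < depth D x" "depth D x < 3 / 2 * (1/2) ^ N" for N x
  proof -
    have "\<eta> x = (\<Sum>n. (1/2) ^ (n + Suc N) * \<theta> (n + Suc N) x) + (\<Sum>n<Suc N. (1/2) ^ n * \<theta> n x)"
      unfolding \<eta>_def by (rule suminf_split_initial_segment[OF summ])
    also have "(\<Sum>n<Suc N. (1/2) ^ n * \<theta> n x) = (\<Sum>n<N. (1/2) ^ n * \<theta> n x) + (1/2) ^ N * \<theta> N x" by simp
    also have "(\<Sum>n<N. (1/2) ^ n * \<theta> n x) = 0"
    proof (rule sum.neutral, rule ballI)
      fix n assume "n \<in> {..<N}"
      then have "(1/2 :: real) ^ N \<le> (1/2) ^ Suc n" by (intro power_decreasing) auto
      with x(2) have "depth D x < 3 / 4 * (1/2) ^ n" by simp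
      then show "(1/2) ^ n * \<theta> n x = 0" by (simp add: \<theta>_zero)
    qed
    also have "(\<lambda>n. (1/2) ^ (n + Suc N) * \<theta> (n + Suc N) x) = (\<lambda>n. (1/2) ^ Suc N * (1/2) ^ n)"
    proof
      fix n
      have "(1/2 :: real) ^ (n + Suc N) \<le> (1/2) ^ Suc N" by (intro power_decreasing) auto
      with x(1) have "\<theta> (n + Suc N) x = 1" by (intro \<theta>_one) linarith
      then show "(1/2) ^ (n + Suc N) * \<theta> (n + Suc N) x = (1/2) ^ Suc N * (1/2) ^ n"
        by (simp add: power_add)
    qed
    also have "(\<Sum>n. (1/2 :: real) ^ Suc N * (1/2) ^ n) = (1/2) ^ N"
      by (subst suminf_mult) (simp_all add: suminf_geometric summable_geometric)
    finally show ?thesis by simp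
  qed
  \<comment> \<open>The layers are open and overlap, which makes the local formula usable for
    derivatives. The sharper upper bound 5/4 gives the constant 4/5, since \<open>\<eta> x\<close>
    is at least \<open>(1/2) ^ N\<close>; the lower bound, 5/8 times \<open>(1/2) ^ N\<close>, gives
    16/5, since \<open>\<eta> x\<close> is at most twice \<open>(1/2) ^ N\<close>. The least index
    \<open>M\<close> is not 0 because \<open>depth\<close> is at most 1.\<close>
  have scale: "\<exists>N. 5 / 4 * (1/2) ^ Suc N < depth D x \<and> depth D x < 3 / 2 * (1/2) ^ N
      \<and> depth D x \<le> 5 / 4 * (1/2) ^ N" if xD: "x \<in> D" for x
  proof -
    obtain n0 where "(1/2 :: real) ^ n0 < 4 / 5 * depth D x"
      using real_arch_pow_inv[of "4 / 5 * depth D x" "1/2"] depth_pos[OF xD] by auto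
    then have ex: "\<exists>n. 5 / 4 * (1/2) ^ n < depth D x" by (intro exI[of _ n0]) simp
    define M where "M = (LEAST n. 5 / 4 * (1/2) ^ n < depth D x)"
    have M: "5 / 4 * (1/2) ^ M < depth D x" unfolding M_def by (rule LeastI_ex[OF ex])
    then have "M \<noteq> 0" using depth_le_1[of D x] by (cases M) auto
    then obtain N where N: "M = Suc N" by (cases M) auto
    then have "\<not> 5 / 4 * (1/2) ^ N < depth D x"
      unfolding M_def using not_less_Least lessI by metis
    moreover have "(1/2 :: real) ^ N > 0" by simp
    ultimately show ?thesis using M N by (intro exI[of _ N] conjI) (simp_all add: not_less)
  qed
  have region_open: "open {y. 5 / 4 * (1/2) ^ Suc N < depth D y \<and> depth D y < 3 / 2 * (1/2) ^ N}" for N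
    by (intro open_Collect_conj open_Collect_less continuous_intros)
  show thesis
  proof (rule that[of \<eta> C])
    show "\<eta> \<in> Cinf D"
    proof (intro CinfI Ck_on_local[OF _ open_D])
      fix k x assume "x \<in> D"
      then obtain N where N: "5 / 4 * (1/2) ^ Suc N < depth D x" "depth D x < 3 / 2 * (1/2) ^ N"
        using scale by blast
      let ?U = "{y. 5 / 4 * (1/2) ^ Suc N < depth D y \<and> depth D y < 3 / 2 * (1/2) ^ N}"
      have "Ck_on k ?U (\<lambda>y. (1/2) ^ N * \<theta> N y + (1/2) ^ N)"
        using \<theta>_Cinf[of N] by (intro Ck_on_add Ck_on_mult Ck_on_const region_open)
          (auto intro: Ck_on_subset[OF Cinf_Ck])
      then have "Ck_on k ?U \<eta>"
        using loc by (subst Ck_on_cong[OF region_open]) auto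
      then show "\<exists>U. open U \<and> x \<in> U \<and> Ck_on k U \<eta>"
        using region_open N by blast
    qed
  next
    fix x assume x: "x \<in> D"
    then obtain N where N: "5 / 4 * (1/2) ^ Suc N < depth D x" "depth D x < 3 / 2 * (1/2) ^ N"
        "depth D x \<le> 5 / 4 * (1/2) ^ N"
      using scale by blast
    have "0 \<le> (1/2) ^ N * \<theta> N x" "(1/2) ^ N * \<theta> N x \<le> (1/2) ^ N"
      using \<theta>_nonneg[of N x] \<theta>_le1[of N x] by (auto simp: mult_left_le)
    moreover have "(1/2 :: real) ^ Suc N = (1/2) ^ N / 2" by simp
    ultimately show "4 / 5 * depth D x \<le> \<eta> x \<and> \<eta> x \<le> 16 / 5 * depth D x"
      using N loc[OF N(1,2)] by linarith
    fix i
    have d: "(\<theta> N has_derivative frechet_derivative (\<theta> N) (at x)) (at x)"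
      using Cinf_has_derivative[OF open_UNIV \<theta>_Cinf] by blast
    have "partial_deriv i \<eta> x = partial_deriv i (\<lambda>y. (1/2) ^ N * \<theta> N y + (1/2) ^ N) x"
      using N loc by (intro partial_deriv_cong_open[OF region_open[of N]]) auto
    also have "\<dots> = (1/2) ^ N * partial_deriv i (\<theta> N) x"
      using partial_deriv_eq[OF has_derivative_add[OF has_derivative_mult_right[OF d] has_derivative_const]]
      by (simp add: partial_deriv_def)
    finally show "\<bar>partial_deriv i \<eta> x\<bar> \<le> C"
      using \<theta>_grad[where n = N and i = i and x = x] by (simp add: abs_mult)
  qed
qed

end

section \<open>Separability of \<open>L\<^sup>2(D)\<close>\<close>

text \<open>Borel functions on the whole space that vanish off \<open>D\<close>: estimates then use
  \<open>lborel\<close>, with its translations and Tonelli theorem, instead of a restricted complete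
  measure.\<close>

definition L2_supp :: "(real ^ 'n) set \<Rightarrow> (real ^ 'n \<Rightarrow> real) set" where
  "L2_supp D = {f \<in> borel_measurable borel. (\<forall>x. x \<notin> D \<longrightarrow> f x = 0) \<and> integrable lborel (\<lambda>x. (f x)\<^sup>2)}"

text \<open>The squared norm is used throughout; its triangle inequality costs a factor 2, which is
  harmless for convergence.\<close>

definition L2sq :: "(real ^ 'n \<Rightarrow> real) \<Rightarrow> real" where
  "L2sq f = (LINT x|lborel. (f x)\<^sup>2)"

lemma L2_supp_measurable [measurable_dest]: "f \<in> L2_supp D \<Longrightarrow> f \<in> borel_measurable borel"
  by (simp add: L2_supp_def)

lemma L2_supp_zero: "f \<in> L2_supp D \<Longrightarrow> x \<notin> D \<Longrightarrow> f x = 0"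
  by (simp add: L2_supp_def)

lemma L2_supp_sq_integrable: "f \<in> L2_supp D \<Longrightarrow> integrable lborel (\<lambda>x. (f x)\<^sup>2)"
  by (simp add: L2_supp_def)

lemma L2sq_nonneg: "0 \<le> L2sq f"
  by (simp add: L2sq_def)

lemma sum_sq_le: "(a + b)\<^sup>2 \<le> 2 * a\<^sup>2 + 2 * (b :: real)\<^sup>2"
  using zero_le_power2[of "a - b"] by (simp add: power2_sum power2_diff)

lemma L2_supp_dominated:
  assumes g: "g \<in> L2_supp D" and [measurable]: "f \<in> borel_measurable borel"
    and le: "\<And>x. \<bar>f x\<bar> \<le> \<bar>g x\<bar>"
  shows "f \<in> L2_supp D"
proof -
  have "integrable lborel (\<lambda>x. (f x)\<^sup>2)"
    by (rule Bochner_Integration.integrable_bound[OF L2_supp_sq_integrable[OF g]])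
      (auto intro!: always_eventually simp: abs_le_square_iff[symmetric] le)
  moreover have "f x = 0" if "x \<notin> D" for x
    using le[of x] L2_supp_zero[OF g that] by simp
  ultimately show ?thesis by (simp add: L2_supp_def)
qed

lemma L2_supp_add:
  assumes f: "f \<in> L2_supp D" and g: "g \<in> L2_supp D"
  shows "(\<lambda>x. f x + g x) \<in> L2_supp D"
proof -
  note [measurable] = L2_supp_measurable[OF f] L2_supp_measurable[OF g]
  have "integrable lborel (\<lambda>x. 2 * (f x)\<^sup>2 + 2 * (g x)\<^sup>2)"
    using L2_supp_sq_integrable[OF f] L2_supp_sq_integrable[OF g] by simp
  then have "integrable lborel (\<lambda>x. (f x + g x)\<^sup>2)"
    by (rule Bochner_Integration.integrable_bound) (auto intro!: always_eventually simp: sum_sq_le)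
  with f g show ?thesis by (simp add: L2_supp_def)
qed

lemma L2_supp_cmult: "f \<in> L2_supp D \<Longrightarrow> (\<lambda>x. c * f x) \<in> L2_supp D"
  by (auto simp: L2_supp_def power_mult_distrib intro: borel_measurable_times)

lemma L2_supp_diff: "f \<in> L2_supp D \<Longrightarrow> g \<in> L2_supp D \<Longrightarrow> (\<lambda>x. f x - g x) \<in> L2_supp D"
  using L2_supp_add[of f D "\<lambda>x. (-1) * g x"] L2_supp_cmult[of g D "-1"] by simp

lemma L2_supp_0: "(\<lambda>x. 0) \<in> L2_supp D"
  by (simp add: L2_supp_def)

lemma L2_supp_sum: "(\<And>i. i \<in> I \<Longrightarrow> f i \<in> L2_supp D) \<Longrightarrow> (\<lambda>x. \<Sum>i\<in>I. f i x) \<in> L2_supp D"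
  by (induction I rule: infinite_finite_induct) (auto intro: L2_supp_0 L2_supp_add)

lemma L2sq_add:
  assumes "f \<in> L2_supp D" "g \<in> L2_supp D"
  shows "L2sq (\<lambda>x. f x + g x) \<le> 2 * L2sq f + 2 * L2sq g"
proof -
  note I = L2_supp_sq_integrable[OF assms(1)] L2_supp_sq_integrable[OF assms(2)]
    L2_supp_sq_integrable[OF L2_supp_add[OF assms]]
  have "L2sq (\<lambda>x. f x + g x) \<le> (LINT x|lborel. 2 * (f x)\<^sup>2 + 2 * (g x)\<^sup>2)"
    unfolding L2sq_def using I by (intro integral_mono) (auto simp: sum_sq_le)
  then show ?thesis using I by (simp add: L2sq_def)
qed

lemma L2sq_cmult: "L2sq (\<lambda>x. c * f x) = c\<^sup>2 * L2sq f"
  by (simp add: L2sq_def power_mult_distrib)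

lemma L2sq_diff_commute: "L2sq (\<lambda>x. f x - g x) = L2sq (\<lambda>x. g x - f x)"
  by (simp add: L2sq_def power2_commute)

lemma L2sq_triangle:
  assumes "f \<in> L2_supp D" "g \<in> L2_supp D" "h \<in> L2_supp D"
  shows "L2sq (\<lambda>x. f x - h x) \<le> 2 * L2sq (\<lambda>x. f x - g x) + 2 * L2sq (\<lambda>x. g x - h x)"
  using L2sq_add[OF L2_supp_diff[OF assms(1,2)] L2_supp_diff[OF assms(2,3)]] by simp

lemma L2sq_dominated_tendsto:
  fixes f :: "nat \<Rightarrow> real ^ 'n \<Rightarrow> real"
  assumes f: "\<And>n. f n \<in> L2_supp D" and g: "g \<in> L2_supp D" and w: "w \<in> L2_supp D"
    and lim: "AE x in lborel. (\<lambda>n. f n x) \<longlonglongrightarrow> g x" and le: "\<And>n x. \<bar>f n x\<bar> \<le> \<bar>w x\<bar>"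
  shows "(\<lambda>n. L2sq (\<lambda>x. f n x - g x)) \<longlonglongrightarrow> 0"
proof -
  note [measurable] = L2_supp_measurable[OF f] L2_supp_measurable[OF g]
  have "(\<lambda>n. LINT x|lborel. (f n x - g x)\<^sup>2) \<longlonglongrightarrow> (LINT x|(lborel :: (real ^ 'n) measure). 0)"
  proof (rule integral_dominated_convergence)
    show "integrable lborel (\<lambda>x. 2 * (w x)\<^sup>2 + 2 * (g x)\<^sup>2)"
      using L2_supp_sq_integrable[OF w] L2_supp_sq_integrable[OF g] by simp
    show "AE x in lborel. (\<lambda>n. (f n x - g x)\<^sup>2) \<longlonglongrightarrow> 0"
      using lim
    proof eventually_elim
      case (elim x)
      from tendsto_power[OF tendsto_diff[OF elim tendsto_const], of "g x" 2] show ?case by simp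
    qed
    have "(f n x - g x)\<^sup>2 \<le> 2 * (w x)\<^sup>2 + 2 * (g x)\<^sup>2" for n x
      using sum_sq_le[of "f n x" "- g x"] le[of n x] abs_le_square_iff[of "f n x" "w x"] by simp
    then show "AE x in lborel. norm ((f n x - g x)\<^sup>2) \<le> 2 * (w x)\<^sup>2 + 2 * (g x)\<^sup>2" for n by simp
  qed measurable
  then show ?thesis by (simp add: L2sq_def)
qed

section \<open>Approximation by indicators of boxes, and separability\<close>

context finite_domain
begin

lemma indicator_L2_supp:
  assumes "A \<in> sets borel" "A \<subseteq> D"
  shows "indicator A \<in> L2_supp D"
proof -
  have "emeasure lborel A < \<infinity>"
    using emeasure_mono[OF assms(2)] finite_D by (metis D_borel le_less_trans sets_lborel)
  moreover have "(\<lambda>x. (indicator A x :: real)\<^sup>2) = indicator A" by (auto simp: indicator_def)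
  ultimately show ?thesis using assms
    by (auto simp: L2_supp_def integrable_indicator_iff indicator_def[of A])
qed

text \<open>On a set of finite measure square integrability gives integrability, by
  \<open>2 * \<bar>f x\<bar> \<le> 1 + (f x)\<^sup>2\<close>.\<close>

lemma L2_supp_integrable:
  assumes "f \<in> L2_supp D" shows "integrable lborel f"
proof (rule Bochner_Integration.integrable_bound)
  show "integrable lborel (\<lambda>x. (indicator D x :: real)\<^sup>2 + (f x)\<^sup>2)"
    using L2_supp_sq_integrable[OF assms] L2_supp_sq_integrable[OF indicator_L2_supp[of D]] by simp
  have "\<bar>f x\<bar> \<le> (indicator D x)\<^sup>2 + (f x)\<^sup>2" for x
  proof (cases "x \<in> D")
    case True
    have "2 * \<bar>f x\<bar> \<le> 1 + (f x)\<^sup>2"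
      using zero_le_power2[of "\<bar>f x\<bar> - 1"] by (simp add: power2_diff)
    with True show ?thesis using abs_ge_zero[of "f x"] by simp
  qed (simp add: L2_supp_zero[OF assms])
  then show "AE x in lborel. norm (f x) \<le> norm ((indicator D x)\<^sup>2 + (f x)\<^sup>2)" by simp
qed (use L2_supp_measurable[OF assms] in simp)

lemma L2_supp_bounded:
  assumes "f \<in> borel_measurable borel" "\<And>x. x \<notin> D \<Longrightarrow> f x = 0" "\<And>x. x \<in> D \<Longrightarrow> \<bar>f x\<bar> \<le> B"
  shows "f \<in> L2_supp D"
proof (rule L2_supp_dominated[OF L2_supp_cmult[OF indicator_L2_supp[of D], of B]])
  show "\<bar>f x\<bar> \<le> \<bar>B * indicator D x\<bar>" for x
    using assms(2,3)[of x] by (cases "x \<in> D") auto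
qed (use assms in auto)

text \<open>Boxes generate the Borel sets and are stable under intersection, so a Dynkin argument
  carries \<open>V\<close> from boxes to Borel sets; simple functions and \<open>lim\<close> do the
  rest. The rule serves both separability and the convergence of averages.\<close>

lemma L2_induct [consumes 1, case_names box add scale lim]:
  assumes f: "f \<in> L2_supp D"
    and box: "\<And>a b. V (indicator (box a b \<inter> D))"
    and add: "\<And>f g. f \<in> L2_supp D \<Longrightarrow> g \<in> L2_supp D \<Longrightarrow> V f \<Longrightarrow> V g \<Longrightarrow> V (\<lambda>x. f x + g x)"
    and scale: "\<And>c f. f \<in> L2_supp D \<Longrightarrow> V f \<Longrightarrow> V (\<lambda>x. c * f x)"
    and lim: "\<And>f g. f \<in> L2_supp D \<Longrightarrow> (\<And>n. g n \<in> L2_supp D) \<Longrightarrow> (\<And>n. V (g n)) \<Longrightarrow>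
      (\<lambda>n. L2sq (\<lambda>x. g n x - f x)) \<longlonglongrightarrow> 0 \<Longrightarrow> V f"
  shows "V f"
proof -
  have DL: "indicator D \<in> L2_supp D" by (rule indicator_L2_supp) auto
  have zero: "V (\<lambda>x. 0)"
    using scale[OF indicator_L2_supp[of "box 0 0 \<inter> D"] box[of 0 0], of 0] by simp
  have sum: "V (\<lambda>x. \<Sum>i\<in>I. h i x)"
    if "finite I" "\<And>i. i \<in> I \<Longrightarrow> h i \<in> L2_supp D \<and> V (h i)" for I :: "'i set" and h
    using that
  proof (induction I)
    case (insert i I)
    then have "V (\<lambda>x. h i x + (\<Sum>i\<in>I. h i x))" by (intro add L2_supp_sum) auto
    with insert show ?case by simp
  qed (simp add: zero)
  \<comment> \<open>Complements in the Dynkin argument are taken relative to \<open>D\<close>, whose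
    indicator is reached by exhausting the space with cubes.\<close>
  have whole: "V (indicator D)"
  proof (rule lim)
    let ?B = "\<lambda>n :: nat. box (\<chi> i. - real n) (\<chi> i. real n) \<inter> D"
    show B: "indicator (?B n) \<in> L2_supp D" for n by (rule indicator_L2_supp) auto
    show "(\<lambda>n. L2sq (\<lambda>x. indicator (?B n) x - indicator D x)) \<longlonglongrightarrow> 0"
    proof (rule L2sq_dominated_tendsto[OF B DL DL])
      have "(\<lambda>n. indicator (?B n) x :: real) \<longlonglongrightarrow> indicator D x" for x
      proof (rule tendsto_eventually)
        obtain n0 where n0: "norm x < real n0" using reals_Archimedean2 by blast
        have "x \<in> box (\<chi> i. - real n) (\<chi> i. real n)" if "n \<ge> n0" for n
        proof -
          have "\<bar>x $ i\<bar> < real n" for i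
            using component_le_norm_cart[of x i] n0 that by (meson le_less_trans less_le_trans of_nat_le_iff)
          then show ?thesis by (auto simp: mem_box_cart abs_less_iff minus_less_iff)
        qed
        then show "\<forall>\<^sub>F n in sequentially. indicator (?B n) x = (indicator D x :: real)"
          unfolding eventually_sequentially by (intro exI[of _ n0]) (auto simp: indicator_def)
      qed
      then show "AE x in lborel. (\<lambda>n. indicator (?B n) x :: real) \<longlonglongrightarrow> indicator D x" by simp
    qed (auto simp: indicator_def)
  qed (auto intro: DL box)
  have sets: "V (indicator (A \<inter> D))" if "A \<in> sets borel" for A
  proof -
    let ?G = "range (\<lambda>(a, b). box a b :: (real ^ 'n) set)"
    have G: "sigma_sets UNIV ?G = sets borel" by (simp add: borel_eq_box)
    have "Int_stable ?G"
      by (rule Int_stableI) (force simp: box_Int_box)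
    moreover have "?G \<subseteq> Pow UNIV" by simp
    moreover have "A \<in> sigma_sets UNIV ?G" using that G by simp
    ultimately show ?thesis
    proof (induction rule: sigma_sets_induct_disjoint)
      case (compl A)
      have "(indicator (- A \<inter> D) :: _ \<Rightarrow> real) = (\<lambda>x. indicator D x + (-1) * indicator (A \<inter> D) x)"
        by (auto simp: indicator_def)
      moreover have "V \<dots>"
        using compl G by (intro add scale whole indicator_L2_supp L2_supp_cmult) auto
      ultimately show ?case by (simp add: Compl_eq_Diff_UNIV)
    next
      case (union A)
      have Ai: "A i \<in> sets borel" for i using union(2) G by auto
      let ?h = "\<lambda>n x. \<Sum>i<n. indicator (A i \<inter> D) x :: real"
      have h: "?h n = indicator ((\<Union>i<n. A i) \<inter> D)" for n
      proof (induction n)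
        case (Suc n)
        have "(\<Union>i<n. A i) \<inter> A n = {}"
          using union(1) by (auto simp: disjoint_family_on_def) (metis IntI empty_iff less_irrefl)
        then have "indicator ((\<Union>i<n. A i) \<inter> D) x + indicator (A n \<inter> D) x
            = (indicator ((\<Union>i<Suc n. A i) \<inter> D) x :: real)" for x
          by (cases "x \<in> A n") (auto simp: indicator_def less_Suc_eq)
        then show ?case using Suc by (simp add: fun_eq_iff)
      qed (simp add: fun_eq_iff)
      have hL: "?h n \<in> L2_supp D" for n
        unfolding h using Ai by (intro indicator_L2_supp) auto
      have AL: "indicator ((\<Union>i. A i) \<inter> D) \<in> L2_supp D"
        using Ai by (intro indicator_L2_supp) auto
      show ?case
      proof (rule lim)
        show "V (?h n)" for n
          using union(3) Ai by (intro sum) (auto intro: indicator_L2_supp)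
        show "(\<lambda>n. L2sq (\<lambda>x. ?h n x - indicator ((\<Union>i. A i) \<inter> D) x)) \<longlonglongrightarrow> 0"
        proof (rule L2sq_dominated_tendsto[where w = "indicator D", OF hL])
          have "(\<lambda>n. ?h n x) \<longlonglongrightarrow> indicator ((\<Union>i. A i) \<inter> D) x" for x
          proof (cases "\<exists>i. x \<in> A i \<inter> D")
            case True
            then obtain i where "x \<in> A i \<inter> D" ..
            then have "?h n x = indicator ((\<Union>i. A i) \<inter> D) x" if "n \<ge> Suc i" for n
              using fun_cong[OF h[of n], of x] that by (auto simp: indicator_def)
            then show ?thesis
              by (intro tendsto_eventually) (auto simp: eventually_sequentially)
          next
            case False
            then have "?h n x = indicator ((\<Union>i. A i) \<inter> D) x" for n
              using fun_cong[OF h[of n], of x] by (auto simp: indicator_def)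
            then show ?thesis by simp
          qed
          then show "AE x in lborel. (\<lambda>n. ?h n x) \<longlonglongrightarrow> indicator ((\<Union>i. A i) \<inter> D) x" by simp
          show "\<bar>?h n x\<bar> \<le> \<bar>indicator D x\<bar>" for n x
            using fun_cong[OF h[of n], of x] by (auto simp: indicator_def)
        qed (intro AL DL)+
      qed (intro AL hL)+
    qed (auto simp: zero box)
  qed
  note [measurable] = L2_supp_measurable[OF f]
  have "f \<in> borel_measurable lborel" by simp
  \<comment> \<open>The bound by \<open>2 * \<bar>f x\<bar>\<close> makes the simple functions
    vanish off \<open>D\<close> and provides the majorant for convergence in the mean.\<close>
  from borel_measurable_implies_sequence_metric[OF this, of 0] obtain s where
    s: "\<And>i. simple_function lborel (s i)" "\<And>x. (\<lambda>i. s i x) \<longlonglongrightarrow> f x" "\<And>i x. \<bar>s i x\<bar> \<le> 2 * \<bar>f x\<bar>"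
    by (auto simp: dist_real_def)
  have s0: "s i x = 0" if "x \<notin> D" for i x
    using s(3)[of i x] L2_supp_zero[OF f that] by simp
  have s_meas: "s i \<in> borel_measurable borel" for i
    using borel_measurable_simple_function[OF s(1)] by simp
  have sL: "s i \<in> L2_supp D" for i
    by (rule L2_supp_dominated[OF L2_supp_cmult[OF f, of 2]]) (use s(3) s_meas in \<open>auto simp: abs_mult\<close>)
  show ?thesis
  proof (rule lim[OF f sL])
    show "V (s i)" for i
    proof -
      have fin: "finite (range (s i))" using s(1)[of i] by (simp add: simple_function_def)
      have lev: "s i -` {y} \<inter> D \<in> sets borel" for y
        using measurable_sets[OF s_meas[of i], of "{y}"] by simp
      define S where "S x = (\<Sum>y\<in>range (s i). y * indicator (s i -` {y} \<inter> D) x)" for x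
      have "S x = s i x" for x
      proof -
        have "(\<Sum>y\<in>range (s i). y * indicator (s i -` {y} \<inter> D) x)
            = (\<Sum>y\<in>range (s i). if y = s i x then y * indicator D x else 0)"
          by (intro sum.cong) (auto simp: indicator_def)
        also have "\<dots> = s i x" using fin s0[of x i] by (auto simp: indicator_def)
        finally show ?thesis by (simp add: S_def)
      qed
      then have "S = s i" by (rule ext)
      moreover have "V S"
        unfolding S_def[abs_def]
      proof (rule sum[OF fin])
        fix y
        have "s i -` {y} \<in> sets borel"
          using measurable_sets[OF s_meas[of i], of "{y}"] by simp
        then show "(\<lambda>x. y * indicator (s i -` {y} \<inter> D) x) \<in> L2_supp D
            \<and> V (\<lambda>x. y * indicator (s i -` {y} \<inter> D) x)"
          using lev by (auto intro!: L2_supp_cmult scale sets indicator_L2_supp)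
      qed
      ultimately show ?thesis by simp
    qed
    show "(\<lambda>i. L2sq (\<lambda>x. s i x - f x)) \<longlonglongrightarrow> 0"
      by (rule L2sq_dominated_tendsto[OF sL f L2_supp_cmult[OF f, of 2]])
        (use s(2,3) in \<open>auto simp: abs_mult\<close>)
  qed
qed

text \<open>\<open>Q\<close> consists of rational combinations of indicators of finite unions of
  basic open sets. Unions are taken before indicators because an open box is the increasing limit of
  such unions, while a sum of indicators would count overlaps several times.\<close>

lemma L2_separable:
  obtains Q where "countable Q" "Q \<subseteq> L2_supp D"
    "\<And>f e. f \<in> L2_supp D \<Longrightarrow> e > 0 \<Longrightarrow> \<exists>q\<in>Q. L2sq (\<lambda>x. q x - f x) < e"
proof -
  obtain B :: "(real ^ 'n) set set" where B: "countable B" "topological_basis B"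
    using ex_countable_basis by blast
  define F where "F = {A. finite A \<and> A \<subseteq> B}"
  define step where "step l x = (\<Sum>p\<leftarrow>l. of_rat (fst p) * indicator (\<Union>(snd p) \<inter> D) x :: real)" for l x
  define Q where "Q = step ` lists (UNIV \<times> F)"
  have "countable Q"
    unfolding Q_def F_def using countable_Collect_finite_subset[OF B(1)]
    by (intro countable_image countable_lists countable_SIGMA) auto
  have UB: "\<Union>A \<in> sets borel" if "A \<in> F" for A
    using that topological_basis_open[OF B(2)] by (auto simp: F_def intro!: borel_open open_Union)
  have step_L2: "step l \<in> L2_supp D" if "l \<in> lists (UNIV \<times> F)" for l
    using that
  proof (induction l)
    case (Cons p l)
    then have "(\<lambda>x. of_rat (fst p) * indicator (\<Union>(snd p) \<inter> D) x + step l x) \<in> L2_supp D"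
      using UB[of "snd p"] by (intro L2_supp_add L2_supp_cmult indicator_L2_supp) auto
    moreover have "step (p # l) = (\<lambda>x. of_rat (fst p) * indicator (\<Union>(snd p) \<inter> D) x + step l x)"
      by (simp add: step_def[abs_def])
    ultimately show ?case by simp
  qed (simp add: step_def[abs_def] L2_supp_0)
  then have QL: "Q \<subseteq> L2_supp D" by (auto simp: Q_def)
  have Q_add: "(\<lambda>x. q x + q' x) \<in> Q" if qq: "q \<in> Q" "q' \<in> Q" for q q'
  proof -
    obtain l l' where "l \<in> lists (UNIV \<times> F)" "l' \<in> lists (UNIV \<times> F)" "q = step l" "q' = step l'"
      using qq unfolding Q_def by blast
    then have "(\<lambda>x. q x + q' x) = step (l @ l')" "l @ l' \<in> lists (UNIV \<times> F)"
      by (auto simp: step_def)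
    then show ?thesis by (simp add: Q_def)
  qed
  have Q_scale: "(\<lambda>x. of_rat r * q x) \<in> Q" if q: "q \<in> Q" for r q
  proof -
    obtain l where l: "l \<in> lists (UNIV \<times> F)" "q = step l" using q unfolding Q_def by blast
    let ?l = "map (\<lambda>p. (r * fst p, snd p)) l"
    have "of_rat r * step l x = step ?l x" for x
      by (induction l) (simp_all add: step_def of_rat_mult algebra_simps)
    moreover have "?l \<in> lists (UNIV \<times> F)" using l(1) by (auto simp: in_lists_conv_set)
    ultimately show ?thesis using l(2) by (auto simp: Q_def)
  qed
  \<comment> \<open>Approximability by a sequence from \<open>Q\<close>, the property to which
    \<open>L2_induct\<close> is applied.\<close>
  define V where "V f \<longleftrightarrow> (\<exists>q. (\<forall>n. q n \<in> Q) \<and> (\<lambda>n. L2sq (\<lambda>x. q n x - f x)) \<longlonglongrightarrow> 0)" for f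
  have V: "V f" if "f \<in> L2_supp D" for f
    using that
  proof (induction rule: L2_induct)
    case (box a b)
    obtain B' where B': "B' \<subseteq> B" "\<Union>B' = box a b"
      using topological_basisE[OF B(2)] B(2) open_box by (metis topological_basis_def)
    then have "countable B'" using B(1) countable_subset by blast
    show ?case
    \<comment> \<open>\<open>from_nat_into\<close> enumerates only nonempty sets; an empty box is
      the empty combination \<open>step []\<close>.\<close>
    proof (cases "B' = {}")
      case True
      then have "step [] = indicator (box a b \<inter> D)" using B'(2) by (auto simp: step_def)
      moreover have "step [] \<in> Q" by (simp add: Q_def)
      ultimately show ?thesis unfolding V_def by (intro exI[of _ "\<lambda>_. step []"]) (simp add: L2sq_def)
    next
      case False
      let ?A = "\<lambda>n. from_nat_into B' ` {..<n :: nat}"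
      have range: "range (from_nat_into B') = B'"
        using False \<open>countable B'\<close> by (simp add: range_from_nat_into)
      have A: "?A n \<in> F" for n using B'(1) range by (auto simp: F_def)
      have eq: "step [(1, ?A n)] = indicator (\<Union>(?A n) \<inter> D)" for n
        by (auto simp: step_def fun_eq_iff)
      have q: "step [(1, ?A n)] \<in> Q" for n using A by (auto simp: Q_def)
      show ?thesis unfolding V_def
      proof (intro exI conjI allI)
        show "step [(1, ?A n)] \<in> Q" for n by (rule q)
        show "(\<lambda>n. L2sq (\<lambda>x. step [(1, ?A n)] x - indicator (box a b \<inter> D) x)) \<longlonglongrightarrow> 0"
        proof (rule L2sq_dominated_tendsto[where w = "indicator D"])
          show "step [(1, ?A n)] \<in> L2_supp D" for n using q QL by auto
          show "indicator (box a b \<inter> D) \<in> L2_supp D" "indicator D \<in> L2_supp D"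
            by (auto intro: indicator_L2_supp)
          have "(\<lambda>n. step [(1, ?A n)] x) \<longlonglongrightarrow> indicator (box a b \<inter> D) x" for x
          proof (rule tendsto_eventually)
            show "\<forall>\<^sub>F n in sequentially. step [(1, ?A n)] x = indicator (box a b \<inter> D) x"
            proof (cases "x \<in> box a b")
              case True
              then obtain k where "x \<in> from_nat_into B' k" using range unfolding B'(2)[symmetric] by blast
              then have "step [(1, ?A n)] x = indicator (box a b \<inter> D) x" if "n \<ge> Suc k" for n
                unfolding eq using that True by (auto simp: indicator_def)
              then show ?thesis by (auto simp: eventually_sequentially)
            next
              case False
              then have "x \<notin> \<Union>(?A n)" for n using range unfolding B'(2)[symmetric] by blast
              then show ?thesis unfolding eq using False by (auto simp: indicator_def)
            qed
          qed
          then show "AE x in lborel. (\<lambda>n. step [(1, ?A n)] x) \<longlonglongrightarrow> indicator (box a b \<inter> D) x" by simp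
          show "\<bar>step [(1, ?A n)] x\<bar> \<le> \<bar>indicator D x\<bar>" for n x
            unfolding eq by (auto simp: indicator_def)
        qed
      qed
    qed
  next
    case (add f g)
    then obtain q q' where q: "\<And>n. q n \<in> Q" "(\<lambda>n. L2sq (\<lambda>x. q n x - f x)) \<longlonglongrightarrow> 0"
      "\<And>n. q' n \<in> Q" "(\<lambda>n. L2sq (\<lambda>x. q' n x - g x)) \<longlonglongrightarrow> 0"
      unfolding V_def by blast
    have "(\<lambda>n. L2sq (\<lambda>x. (q n x + q' n x) - (f x + g x))) \<longlonglongrightarrow> 0"
    proof (rule tendsto_sandwich[OF always_eventually always_eventually tendsto_const])
      show "\<forall>n. L2sq (\<lambda>x. (q n x + q' n x) - (f x + g x))
          \<le> 2 * L2sq (\<lambda>x. q n x - f x) + 2 * L2sq (\<lambda>x. q' n x - g x)"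
      proof
        fix n
        have "q n \<in> L2_supp D" "q' n \<in> L2_supp D" using q QL by auto
        from L2sq_add[OF L2_supp_diff[OF this(1) add(1)] L2_supp_diff[OF this(2) add(2)]]
        show "L2sq (\<lambda>x. (q n x + q' n x) - (f x + g x))
          \<le> 2 * L2sq (\<lambda>x. q n x - f x) + 2 * L2sq (\<lambda>x. q' n x - g x)"
          by (simp add: algebra_simps)
      qed
      show "(\<lambda>n. 2 * L2sq (\<lambda>x. q n x - f x) + 2 * L2sq (\<lambda>x. q' n x - g x)) \<longlonglongrightarrow> 0"
        using tendsto_add[OF tendsto_mult_left[OF q(2), of 2] tendsto_mult_left[OF q(4), of 2]] by simp
    qed (simp add: L2sq_nonneg)
    then show ?case unfolding V_def
      using q Q_add by (intro exI[of _ "\<lambda>n x. q n x + q' n x"]) auto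
  next
    case (scale c f)
    then obtain q where q: "\<And>n. q n \<in> Q" "(\<lambda>n. L2sq (\<lambda>x. q n x - f x)) \<longlonglongrightarrow> 0"
      unfolding V_def by blast
    have "\<exists>r. \<bar>of_rat r - c\<bar> < inverse (real (Suc n))" for n
    proof -
      obtain r where "c < of_rat r" "of_rat r < c + inverse (real (Suc n))"
        using of_rat_dense[of c "c + inverse (real (Suc n))"] by auto
      then show ?thesis by (intro exI[of _ r]) auto
    qed
    then obtain r where r: "\<And>n. \<bar>of_rat (r n) - c\<bar> < inverse (real (Suc n))" by metis
    have rc: "(\<lambda>n. of_rat (r n)) \<longlonglongrightarrow> c"
    proof (rule LIM_zero_cancel, rule tendsto_rabs_zero_cancel)
      show "(\<lambda>n. \<bar>of_rat (r n) - c\<bar>) \<longlonglongrightarrow> 0"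
        by (rule tendsto_sandwich[OF always_eventually always_eventually tendsto_const LIMSEQ_inverse_real_of_nat])
          (use r less_imp_le in auto)
    qed
    have "(\<lambda>n. L2sq (\<lambda>x. of_rat (r n) * q n x - c * f x)) \<longlonglongrightarrow> 0"
    proof (rule tendsto_sandwich[OF always_eventually always_eventually tendsto_const])
      \<comment> \<open>A real factor is replaced by rationals tending to it; the error is
        \<open>r n\<close> times the error of \<open>q n\<close>, plus \<open>(r n - c)\<close>
        times \<open>f\<close>.\<close>
      show "\<forall>n. L2sq (\<lambda>x. of_rat (r n) * q n x - c * f x)
          \<le> 2 * ((of_rat (r n))\<^sup>2 * L2sq (\<lambda>x. q n x - f x)) + 2 * ((of_rat (r n) - c)\<^sup>2 * L2sq f)"
      proof
        fix n
        have "q n \<in> L2_supp D" using q QL by auto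
        from L2sq_add[OF L2_supp_cmult[OF L2_supp_diff[OF this scale(1)], of "of_rat (r n)"]
          L2_supp_cmult[OF scale(1), of "of_rat (r n) - c"]]
        show "L2sq (\<lambda>x. of_rat (r n) * q n x - c * f x)
          \<le> 2 * ((of_rat (r n))\<^sup>2 * L2sq (\<lambda>x. q n x - f x)) + 2 * ((of_rat (r n) - c)\<^sup>2 * L2sq f)"
          unfolding L2sq_cmult by (simp add: algebra_simps)
      qed
      have "(\<lambda>n. 2 * ((of_rat (r n))\<^sup>2 * L2sq (\<lambda>x. q n x - f x)) + 2 * ((of_rat (r n) - c)\<^sup>2 * L2sq f))
          \<longlonglongrightarrow> 2 * (c\<^sup>2 * 0) + 2 * ((c - c)\<^sup>2 * L2sq f)"
        by (intro tendsto_intros rc q)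
      then show "(\<lambda>n. 2 * ((of_rat (r n))\<^sup>2 * L2sq (\<lambda>x. q n x - f x)) + 2 * ((of_rat (r n) - c)\<^sup>2 * L2sq f))
          \<longlonglongrightarrow> 0" by simp
    qed (simp add: L2sq_nonneg)
    then show ?case unfolding V_def
      using q Q_scale by (intro exI[of _ "\<lambda>n x. of_rat (r n) * q n x"]) auto
  next
    case (lim f g)
    have "\<exists>q\<in>Q. L2sq (\<lambda>x. q x - g n x) < inverse (real (Suc n))" for n
    proof -
      obtain q where q: "\<And>k. q k \<in> Q" "(\<lambda>k. L2sq (\<lambda>x. q k x - g n x)) \<longlonglongrightarrow> 0"
        using lim.IH[of n] unfolding V_def by blast
      have "\<forall>\<^sub>F k in sequentially. L2sq (\<lambda>x. q k x - g n x) < inverse (real (Suc n))"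
        by (rule order_tendstoD[OF q(2)]) simp
      then obtain k where "L2sq (\<lambda>x. q k x - g n x) < inverse (real (Suc n))"
        unfolding eventually_sequentially by blast
      then show ?thesis using q(1) by blast
    qed
    then have "\<forall>n. \<exists>q. q \<in> Q \<and> L2sq (\<lambda>x. q x - g n x) < inverse (real (Suc n))"
      by blast
    from choice[OF this] obtain q
      where q: "\<And>n. q n \<in> Q" "\<And>n. L2sq (\<lambda>x. q n x - g n x) < inverse (real (Suc n))"
      by blast
    have "(\<lambda>n. L2sq (\<lambda>x. q n x - f x)) \<longlonglongrightarrow> 0"
    proof (rule tendsto_sandwich[OF always_eventually always_eventually tendsto_const])
      show "\<forall>n. L2sq (\<lambda>x. q n x - f x) \<le> 2 * inverse (real (Suc n)) + 2 * L2sq (\<lambda>x. g n x - f x)"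
      proof
        fix n
        have "q n \<in> L2_supp D" using q QL by auto
        from L2sq_triangle[OF this lim.hyps(2)[of n] lim.hyps(1)] q(2)[of n]
        show "L2sq (\<lambda>x. q n x - f x) \<le> 2 * inverse (real (Suc n)) + 2 * L2sq (\<lambda>x. g n x - f x)"
          by linarith
      qed
      have "(\<lambda>n. 2 * inverse (real (Suc n)) + 2 * L2sq (\<lambda>x. g n x - f x)) \<longlonglongrightarrow> 2 * 0 + 2 * 0"
        by (intro tendsto_intros LIMSEQ_inverse_real_of_nat lim.hyps)
      then show "(\<lambda>n. 2 * inverse (real (Suc n)) + 2 * L2sq (\<lambda>x. g n x - f x)) \<longlonglongrightarrow> 0" by simp
    qed (simp add: L2sq_nonneg)
    with q(1) show ?case unfolding V_def by (intro exI[of _ q]) simp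
  qed
  show thesis
  proof (rule that[OF \<open>countable Q\<close> QL])
    fix f and e :: real assume "f \<in> L2_supp D" "e > 0"
    then obtain q where q: "\<And>k. q k \<in> Q" "(\<lambda>k. L2sq (\<lambda>x. q k x - f x)) \<longlonglongrightarrow> 0"
      using V unfolding V_def by blast
    have "\<forall>\<^sub>F k in sequentially. L2sq (\<lambda>x. q k x - f x) < e"
      by (rule order_tendstoD(2)[OF q(2) \<open>e > 0\<close>])
    then obtain k where "L2sq (\<lambda>x. q k x - f x) < e"
      unfolding eventually_sequentially by blast
    then show "\<exists>q\<in>Q. L2sq (\<lambda>x. q x - f x) < e" using q(1) by blast
  qed
qed

end

section \<open>Averaging at a variable scale\<close>

text \<open>Cubes stand in for balls in volume estimates because their volume is explicit; the loss
  is a constant depending on the dimension.\<close>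

lemma emeasure_cube:
  fixes y :: "real ^ 'n"
  assumes "R \<ge> 0"
  shows "emeasure lborel (cbox (\<chi> i. y $ i - R) (\<chi> i. y $ i + R)) = ennreal ((2 * R) ^ CARD('n))"
proof -
  have "cbox (\<chi> i. y $ i - R) (\<chi> i. y $ i + R) \<noteq> {}"
    using assms by (auto simp: interval_ne_empty_cart)
  then have "measure lborel (cbox (\<chi> i. y $ i - R) (\<chi> i. y $ i + R)) = (2 * R) ^ CARD('n)"
    by (subst content_cbox_cart) auto
  moreover have "emeasure lborel (cbox (\<chi> i. y $ i - R) (\<chi> i. y $ i + R)) \<noteq> top"
    using emeasure_lborel_cbox_finite[of "\<chi> i. y $ i - R" "\<chi> i. y $ i + R"] by (simp add: less_top)
  ultimately show ?thesis by (simp add: emeasure_eq_ennreal_measure)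
qed

lemma cball_subset_cube: "cball y R \<subseteq> cbox (\<chi> i. y $ i - R) (\<chi> i. y $ i + R)"
proof
  fix x assume "x \<in> cball y R"
  then have "norm (x - y) \<le> R" by (simp add: dist_norm norm_minus_commute[of x])
  then have *: "\<bar>(x - y) $ i\<bar> \<le> R" for i
    using component_le_norm_cart[of "x - y" i] by linarith
  show "x \<in> cbox (\<chi> i. y $ i - R) (\<chi> i. y $ i + R)"
    unfolding mem_box_cart
  proof
    fix i
    from *[of i] show "(\<chi> i. y $ i - R) $ i \<le> x $ i \<and> x $ i \<le> (\<chi> i. y $ i + R) $ i"
      by (simp add: abs_le_iff)
  qed
qed

lemma emeasure_cball_le:
  fixes x :: "real ^ 'n"
  assumes "r \<ge> 0"
  shows "emeasure lborel (cball x r) \<le> ennreal ((2 * r) ^ CARD('n))"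
proof -
  have "emeasure lborel (cball x r) \<le> emeasure lborel (cbox (\<chi> i. x $ i - r) (\<chi> i. x $ i + r))"
    by (rule emeasure_mono[OF cball_subset_cube]) simp
  then show ?thesis by (simp only: emeasure_cube[OF assms])
qed

context finite_domain
begin

text \<open>\<open>depth\<close> is 1-Lipschitz and averaging radii are at most half the depth of
  the centre, so the depth varies by bounded factors within such a ball. These factors enter all
  overlap estimates.\<close>

lemma depth_comparable:
  assumes "dist x y \<le> depth D x / 2"
  shows "2 / 3 * depth D y \<le> depth D x" "depth D x \<le> 2 * depth D y"
  using depth_Lipschitz[of D x y] depth_Lipschitz[of D y x] assms dist_commute[of x y] by linarith+

text \<open>After exchanging the integrals, fix \<open>y\<close> of depth m. The centres whose ball
  contains \<open>y\<close> lie in a cube of edge \<open>4 * b * m\<close>, and there the weight is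
  at most \<open>(3 / (2 * a * m)) ^ CARD('n)\<close>; the product of volume and weight is the
  stated constant, free of m.\<close>

lemma average_bound:
  fixes h :: "real ^ 'n \<Rightarrow> ennreal"
  assumes cont: "continuous_on D rad"
    and rad: "\<And>x. x \<in> D \<Longrightarrow> a * depth D x \<le> rad x \<and> rad x \<le> b * depth D x"
    and ab: "0 < a" "b \<le> 1 / 2" and [measurable]: "h \<in> borel_measurable borel"
    and h0: "\<And>y. y \<notin> D \<Longrightarrow> h y = 0"
  shows "(\<integral>\<^sup>+x. indicator D x * (ennreal ((1 / rad x) ^ CARD('n)) *
      (\<integral>\<^sup>+y. indicator (cball x (rad x)) y * h y \<partial>lborel)) \<partial>lborel)
    \<le> ennreal ((6 * b / a) ^ CARD('n)) * (\<integral>\<^sup>+y. h y \<partial>lborel)"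
proof -
  \<comment> \<open>\<open>rad\<close> is continuous on \<open>D\<close> only; its extension by 0 is
    Borel, as joint measurability of the integrand requires.\<close>
  define r where "r x = indicator D x * rad x" for x
  have [measurable]: "r \<in> borel_measurable borel"
    using borel_measurable_continuous_on_indicator[OF _ cont] by (simp add: r_def[abs_def])
  have rD: "r x = rad x" if "x \<in> D" for x using that by (simp add: r_def)
  let ?k = "\<lambda>x y. indicator D x * ennreal ((1 / r x) ^ CARD('n)) * indicator {p. dist (fst p) (snd p) \<le> r (fst p)} (x, y)"
  have k_meas: "case_prod ?k \<in> borel_measurable (lborel \<Otimes>\<^sub>M lborel)"
    by measurable
  have "(\<integral>\<^sup>+x. indicator D x * (ennreal ((1 / rad x) ^ CARD('n)) *
      (\<integral>\<^sup>+y. indicator (cball x (rad x)) y * h y \<partial>lborel)) \<partial>lborel)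
    = (\<integral>\<^sup>+x. (\<integral>\<^sup>+y. ?k x y * h y \<partial>lborel) \<partial>lborel)"
  proof (intro nn_integral_cong)
    fix x
    show "indicator D x * (ennreal ((1 / rad x) ^ CARD('n)) * (\<integral>\<^sup>+y. indicator (cball x (rad x)) y * h y \<partial>lborel))
      = (\<integral>\<^sup>+y. ?k x y * h y \<partial>lborel)"
    proof (cases "x \<in> D")
      case True
      have [measurable]: "cball x (rad x) \<in> sets borel" by simp
      have "(\<integral>\<^sup>+y. ?k x y * h y \<partial>lborel)
          = (\<integral>\<^sup>+y. ennreal ((1 / rad x) ^ CARD('n)) * (indicator (cball x (rad x)) y * h y) \<partial>lborel)"
        using True by (intro nn_integral_cong) (auto simp: rD indicator_def)
      also have "\<dots> = ennreal ((1 / rad x) ^ CARD('n)) * (\<integral>\<^sup>+y. indicator (cball x (rad x)) y * h y \<partial>lborel)"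
        by (rule nn_integral_cmult) measurable
      finally show ?thesis using True by simp
    qed simp
  qed
  also have "\<dots> = (\<integral>\<^sup>+y. (\<integral>\<^sup>+x. ?k x y * h y \<partial>lborel) \<partial>lborel)"
    using k_meas by (intro lborel_pair.Fubini'[symmetric]) measurable
  also have "\<dots> \<le> (\<integral>\<^sup>+y. ennreal ((6 * b / a) ^ CARD('n)) * h y \<partial>lborel)"
  proof (intro nn_integral_mono)
    fix y
    show "(\<integral>\<^sup>+x. ?k x y * h y \<partial>lborel) \<le> ennreal ((6 * b / a) ^ CARD('n)) * h y"
    proof (cases "y \<in> D")
      case False
      then show ?thesis by (simp add: h0)
    next
      case True
      define m where "m = depth D y"
      have m: "m > 0" using depth_pos[OF True] by (simp add: m_def)
      have b: "b > 0"
        using rad[OF True] m ab(1) by (smt (verit) m_def mult_pos_pos mult_nonpos_nonneg)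
      let ?Q = "cbox (\<chi> i. y $ i - 2 * b * m) (\<chi> i. y $ i + 2 * b * m)"
      have cube: "emeasure lborel ?Q = ennreal ((2 * (2 * b * m)) ^ CARD('n))"
        by (rule emeasure_cube) (use b m in simp)
      have "?k x y \<le> ennreal ((3 / (2 * a * m)) ^ CARD('n)) * indicator ?Q x" for x
      proof (cases "x \<in> D \<and> dist x y \<le> r x")
        case True
        have mx: "depth D x > 0" using True depth_pos by blast
        have rx: "a * depth D x \<le> r x" "r x \<le> b * depth D x" using rad True rD by auto
        have "b * depth D x \<le> 1 / 2 * depth D x" using ab(2) mx by (intro mult_right_mono) auto
        then have "dist x y \<le> depth D x / 2" using True rx by simp
        note c = depth_comparable[OF this]
        have "a * (2 / 3 * m) \<le> a * depth D x" using c(1) ab(1) by (simp add: m_def)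
        then have "2 * a * m / 3 \<le> r x" using rx(1) by simp
        moreover have p: "0 < 2 * a * m / 3" using ab(1) m by simp
        ultimately have "0 < r x" by linarith
        have "1 / r x \<le> 1 / (2 * a * m / 3)"
          by (rule frac_le) (use p \<open>2 * a * m / 3 \<le> r x\<close> in simp_all)
        then have "1 / r x \<le> 3 / (2 * a * m)" by (simp only: divide_divide_eq_right mult_1)
        moreover note \<open>0 < r x\<close>
        ultimately have "(1 / r x) ^ CARD('n) \<le> (3 / (2 * a * m)) ^ CARD('n)"
          by (intro power_mono) auto
        moreover have "x \<in> ?Q"
        proof -
          have "b * depth D x \<le> b * (2 * m)" using c(2) b by (simp add: m_def)
          then have "x \<in> cball y (2 * b * m)" using True rx(2) dist_commute[of x y] by simp
          then show ?thesis using cball_subset_cube by blast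
        qed
        ultimately show ?thesis using True by (simp add: ennreal_leI)
      next
        case False
        then show ?thesis by (auto simp: indicator_def)
      qed
      then have "(\<integral>\<^sup>+x. ?k x y * h y \<partial>lborel)
          \<le> (\<integral>\<^sup>+x. ennreal ((3 / (2 * a * m)) ^ CARD('n)) * indicator ?Q x * h y \<partial>lborel)"
        by (intro nn_integral_mono mult_right_mono) auto
      also have "\<dots> = (ennreal ((3 / (2 * a * m)) ^ CARD('n)) * emeasure lborel ?Q) * h y"
        by (simp add: nn_integral_multc nn_integral_cmult)
      also have "ennreal ((3 / (2 * a * m)) ^ CARD('n)) * emeasure lborel ?Q
          = ennreal ((3 / (2 * a * m)) ^ CARD('n) * (2 * (2 * b * m)) ^ CARD('n))"
        unfolding cube by (rule ennreal_mult[symmetric]) (use b m ab(1) in simp_all)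
      also have "(3 / (2 * a * m)) ^ CARD('n) * (2 * (2 * b * m)) ^ CARD('n) = (6 * b / a) ^ CARD('n)"
      proof -
        have "3 / (2 * a * m) * (2 * (2 * b * m)) = 6 * b / a" using m ab(1) by (simp add: field_simps)
        then show ?thesis by (simp only: power_mult_distrib[symmetric])
      qed
      finally show ?thesis .
    qed
  qed
  also have "\<dots> = ennreal ((6 * b / a) ^ CARD('n)) * (\<integral>\<^sup>+y. h y \<partial>lborel)"
    by (rule nn_integral_cmult) measurable
  finally show ?thesis .
qed

end

text \<open>Cauchy-Schwarz separates \<open>g\<close> on the ball from the kernel, whose square
  integrates to at most \<open_volume>.\<close>

lemma kernel_int_sq_bound:
  fixes Q :: "real ^ 'n \<Rightarrow> real"
  assumes Q: "Q \<in> unit_kernels" "\<And>w. \<bar>Q w\<bar> \<le> B" and g: "integrable lborel g" and pos: "\<sigma> x > 0"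
  shows "ennreal ((\<sigma> x ^ CARD('n) * kernel_int Q \<sigma> g x)\<^sup>2)
    \<le> ennreal (2 ^ CARD('n) * B\<^sup>2) * (ennreal (\<sigma> x ^ CARD('n)) *
      (\<integral>\<^sup>+y. indicator (cball x (1 / \<sigma> x)) y * ennreal ((g y)\<^sup>2) \<partial>lborel))"
proof -
  note [measurable] = unit_kernels_measurable[OF Q(1)] borel_measurable_integrable[OF g]
  let ?s = "\<sigma> x" and ?C = "cball x (1 / \<sigma> x)" and ?d = "CARD('n)"
  have [measurable]: "?C \<in> sets borel" by simp
  define G where "G = (\<integral>\<^sup>+y. indicator ?C y * ennreal ((g y)\<^sup>2) \<partial>lborel)"
  have Qz: "Q (?s *\<^sub>R (x - y)) = 0" if "y \<notin> ?C" for y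
    using kernel_support_dist[OF Q(1) pos, of x y] that by auto
  have "ennreal \<bar>kernel_int Q \<sigma> g x\<bar> \<le> (\<integral>\<^sup>+y. ennreal \<bar>g y * Q (?s *\<^sub>R (x - y))\<bar> \<partial>lborel)"
    unfolding kernel_int_def
    using integral_norm_bound_ennreal[OF integrable_kernel_int[OF Q(1) g, of ?s x]] by simp
  also have "\<dots> = (\<integral>\<^sup>+y. (indicator ?C y * ennreal \<bar>g y\<bar>) * ennreal \<bar>Q (?s *\<^sub>R (x - y))\<bar> \<partial>lborel)"
    by (intro nn_integral_cong) (auto simp: abs_mult ennreal_mult' indicator_def Qz)
  finally have "(ennreal \<bar>kernel_int Q \<sigma> g x\<bar>)\<^sup>2
      \<le> (\<integral>\<^sup>+y. (indicator ?C y * ennreal \<bar>g y\<bar>) * ennreal \<bar>Q (?s *\<^sub>R (x - y))\<bar> \<partial>lborel)\<^sup>2"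
    by (rule power_mono) simp
  also have "\<dots> \<le> (\<integral>\<^sup>+y. (indicator ?C y * ennreal \<bar>g y\<bar>)\<^sup>2 \<partial>lborel)
      * (\<integral>\<^sup>+y. (ennreal \<bar>Q (?s *\<^sub>R (x - y))\<bar>)\<^sup>2 \<partial>lborel)"
    by (rule Cauchy_Schwarz_nn_integral) measurable
  also have "(\<integral>\<^sup>+y. (indicator ?C y * ennreal \<bar>g y\<bar>)\<^sup>2 \<partial>lborel) = G"
    unfolding G_def by (intro nn_integral_cong) (auto simp: indicator_def ennreal_power)
  also have "(\<integral>\<^sup>+y. (ennreal \<bar>Q (?s *\<^sub>R (x - y))\<bar>)\<^sup>2 \<partial>lborel) \<le> (\<integral>\<^sup>+y. ennreal (B\<^sup>2) * indicator ?C y \<partial>lborel)"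
  proof (intro nn_integral_mono)
    fix y
    have "(Q (?s *\<^sub>R (x - y)))\<^sup>2 \<le> B\<^sup>2"
      using power_mono[OF Q(2)[of "?s *\<^sub>R (x - y)"], of 2] by simp
    then show "(ennreal \<bar>Q (?s *\<^sub>R (x - y))\<bar>)\<^sup>2 \<le> ennreal (B\<^sup>2) * indicator ?C y"
      using Qz[of y] by (cases "y \<in> ?C") (auto simp: ennreal_power ennreal_leI)
  qed
  also have "\<dots> \<le> ennreal (B\<^sup>2 * (2 / ?s) ^ ?d)"
    using emeasure_cball_le[of "1 / ?s" x] pos
    by (simp add: nn_integral_cmult ennreal_mult' mult_left_mono)
  finally have "(ennreal \<bar>kernel_int Q \<sigma> g x\<bar>)\<^sup>2 \<le> G * ennreal (B\<^sup>2 * (2 / ?s) ^ ?d)"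
    by (simp add: mult_left_mono)
  then have *: "ennreal ((kernel_int Q \<sigma> g x)\<^sup>2) \<le> G * ennreal (B\<^sup>2 * (2 / ?s) ^ ?d)"
    by (simp add: ennreal_power)
  have "ennreal ((?s ^ ?d * kernel_int Q \<sigma> g x)\<^sup>2) = ennreal ((?s ^ ?d)\<^sup>2) * ennreal ((kernel_int Q \<sigma> g x)\<^sup>2)"
    by (simp add: power_mult_distrib ennreal_mult')
  also have "\<dots> \<le> ennreal ((?s ^ ?d)\<^sup>2) * (G * ennreal (B\<^sup>2 * (2 / ?s) ^ ?d))"
    using * by (rule mult_left_mono) simp
  also have "\<dots> = ennreal ((?s ^ ?d)\<^sup>2 * (B\<^sup>2 * (2 / ?s) ^ ?d)) * G"
    by (subst ennreal_mult) (use pos in \<open>auto simp: mult_ac\<close>)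
  also have "(?s ^ ?d)\<^sup>2 * (B\<^sup>2 * (2 / ?s) ^ ?d) = 2 ^ ?d * B\<^sup>2 * ?s ^ ?d"
    using pos by (simp add: power_divide power2_eq_square)
  also have "ennreal (2 ^ ?d * B\<^sup>2 * ?s ^ ?d) * G = ennreal (2 ^ ?d * B\<^sup>2) * (ennreal (?s ^ ?d) * G)"
    using pos by (subst ennreal_mult) (auto simp: mult_ac)
  finally show ?thesis unfolding G_def .
qed

section \<open>The averaging operators and their convergence\<close>

locale mollification = finite_domain D for D :: "(real ^ 'n) set" +
  fixes \<rho> \<eta> :: "real ^ 'n \<Rightarrow> real" and C :: real
  assumes \<rho>: "\<rho> \<in> unit_kernels" "\<And>w. \<rho> w \<ge> 0" "(LINT w|lborel. \<rho> w) = 1"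
    and \<eta>_Cinf: "\<eta> \<in> Cinf D"
    and \<eta>: "\<And>x. x \<in> D \<Longrightarrow> 4 / 5 * depth D x \<le> \<eta> x \<and> \<eta> x \<le> 16 / 5 * depth D x"
    and \<eta>_grad: "\<And>x i. x \<in> D \<Longrightarrow> \<bar>partial_deriv i \<eta> x\<bar> \<le> C"
begin

lemma \<eta>_pos: "x \<in> D \<Longrightarrow> \<eta> x > 0"
  using \<eta>[of x] depth_pos[of x] by linarith

text \<open>The reciprocal of the radius at which functions are averaged around \<open>x\<close>; the constant 7
  keeps that radius below half the distance to the complement of \<open>D\<close>.\<close>

definition inv_rad :: "nat \<Rightarrow> real ^ 'n \<Rightarrow> real" where
  "inv_rad n x = (real n + 7) * inverse (\<eta> x)"

lemma inv_rad_pos: "x \<in> D \<Longrightarrow> inv_rad n x > 0"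
  using \<eta>_pos[of x] by (simp add: inv_rad_def)

lemma inv_rad_Cinf: "inv_rad n \<in> Cinf D"
  unfolding inv_rad_def[abs_def] using \<eta>_pos
  by (intro CinfI Ck_on_mult Ck_on_const Ck_on_inverse open_D Cinf_Ck[OF \<eta>_Cinf]) fastforce

lemma rad_bounds:
  assumes "x \<in> D"
  shows "4 / (5 * (real n + 7)) * depth D x \<le> 1 / inv_rad n x"
    "1 / inv_rad n x \<le> 16 / (5 * (real n + 7)) * depth D x"
proof -
  have eq: "1 / inv_rad n x = \<eta> x / (real n + 7)"
    using \<eta>_pos[OF assms] by (simp add: inv_rad_def field_simps)
  have "(4 / 5 * depth D x) / (real n + 7) \<le> \<eta> x / (real n + 7)"
    using \<eta>[OF assms] by (intro divide_right_mono) auto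
  then show "4 / (5 * (real n + 7)) * depth D x \<le> 1 / inv_rad n x" unfolding eq by simp
  have "\<eta> x / (real n + 7) \<le> (16 / 5 * depth D x) / (real n + 7)"
    using \<eta>[OF assms] by (intro divide_right_mono) auto
  then show "1 / inv_rad n x \<le> 16 / (5 * (real n + 7)) * depth D x" unfolding eq by simp
qed

text \<open>With the upper bound 16/5 for \<open>\<eta>\<close> relative to \<open>depth\<close>, 7
  is the least integer divisor that achieves this for \<open>n = 0\<close>.\<close>

lemma rad_le_half: "16 / (5 * (real n + 7)) \<le> 1 / 2"
  by (simp add: field_simps)

lemma rad_le_half_depth:
  assumes "x \<in> D" shows "1 / inv_rad n x \<le> depth D x / 2"
  using rad_bounds(2)[OF assms, of n] mult_right_mono[OF rad_le_half[of n] depth_nonneg[of D x]] by simp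

lemma rad_cball_subset:
  assumes "x \<in> D" shows "cball x (1 / inv_rad n x) \<subseteq> D"
proof
  fix y assume "y \<in> cball x (1 / inv_rad n x)"
  then have "dist x y < depth D x"
    using rad_le_half_depth[OF assms, of n] depth_pos[OF assms] by simp
  then show "y \<in> D" by (rule depth_ball_subset)
qed

text \<open>The kernel is a parameter because gradients of averages with the mollifier involve
  averages with the kernels \<open>\<rho>w j\<close>, which have no sign and no unit mass.\<close>

definition moll :: "(real ^ 'n \<Rightarrow> real) \<Rightarrow> nat \<Rightarrow> (real ^ 'n \<Rightarrow> real) \<Rightarrow> real ^ 'n \<Rightarrow> real" where
  "moll Q n g x = (if x \<in> D then inv_rad n x ^ CARD('n) * kernel_int Q (inv_rad n) g x else 0)"

lemma Ck_on_power: "open U \<Longrightarrow> Ck_on k U f \<Longrightarrow> Ck_on k U (\<lambda>x. f x ^ p)"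
  by (induction p) (simp_all add: Ck_on_mult)

lemma moll_Cinf:
  assumes "Q \<in> unit_kernels" "g \<in> L2_supp D"
  shows "moll Q n g \<in> Cinf D"
proof (rule CinfI)
  fix k
  have "Ck_on k D (\<lambda>x. inv_rad n x ^ CARD('n) * kernel_int Q (inv_rad n) g x)"
    by (intro Ck_on_mult Ck_on_power Ck_on_kernel_int open_D Cinf_Ck[OF inv_rad_Cinf] inv_rad_Cinf
        inv_rad_pos assms(1) L2_supp_integrable[OF assms(2)])
  then show "Ck_on k D (moll Q n g)"
    by (subst Ck_on_cong[OF open_D]) (auto simp: moll_def)
qed

lemma continuous_imp_borel_on_D:
  fixes f :: "real ^ 'n \<Rightarrow> real"
  assumes "continuous_on D f" "\<And>x. x \<notin> D \<Longrightarrow> f x = 0"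
  shows "f \<in> borel_measurable borel"
proof -
  have "(\<lambda>x. indicator D x *\<^sub>R f x) = f"
    using assms(2) by (auto simp: indicator_def fun_eq_iff)
  then show ?thesis
    using borel_measurable_continuous_on_indicator[OF D_borel assms(1)] by simp
qed

lemma moll_measurable:
  assumes "Q \<in> unit_kernels" "g \<in> L2_supp D"
  shows "moll Q n g \<in> borel_measurable borel"
  by (rule continuous_imp_borel_on_D[OF Cinf_continuous[OF moll_Cinf[OF assms]]]) (simp add: moll_def)

text \<open>Uniformity in \<open>n\<close> is the point: the constants in
  \<open>average_bound\<close> both shrink like \<open>1 / (real n + 7)\<close>, their ratio stays
  4, and \<open>6 * 4 = 24\<close>.\<close>

lemma moll_L2_bound:
  assumes Q: "Q \<in> unit_kernels"
  obtains K where "K \<ge> 0" "\<And>n g. g \<in> L2_supp D \<Longrightarrow> moll Q n g \<in> L2_supp D"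
    "\<And>n g. g \<in> L2_supp D \<Longrightarrow> L2sq (moll Q n g) \<le> K * L2sq g"
proof -
  obtain B where B: "B > 0" "\<And>w. \<bar>Q w\<bar> \<le> B" using unit_kernels_bounded[OF Q] by blast
  define K where "K = 2 ^ CARD('n) * B\<^sup>2 * 24 ^ CARD('n)"
  have K: "K \<ge> 0" by (simp add: K_def)
  have le: "(\<integral>\<^sup>+x. ennreal ((moll Q n g x)\<^sup>2) \<partial>lborel) \<le> ennreal (K * L2sq g)" if g: "g \<in> L2_supp D" for n g
  proof -
    note [measurable] = L2_supp_measurable[OF g]
    have "(\<integral>\<^sup>+x. ennreal ((moll Q n g x)\<^sup>2) \<partial>lborel) \<le>
      (\<integral>\<^sup>+x. ennreal (2 ^ CARD('n) * B\<^sup>2) * (indicator D x * (ennreal ((1 / (1 / inv_rad n x)) ^ CARD('n)) *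
        (\<integral>\<^sup>+y. indicator (cball x (1 / inv_rad n x)) y * ennreal ((g y)\<^sup>2) \<partial>lborel))) \<partial>lborel)"
    proof (intro nn_integral_mono)
      fix x
      show "ennreal ((moll Q n g x)\<^sup>2) \<le> ennreal (2 ^ CARD('n) * B\<^sup>2) *
        (indicator D x * (ennreal ((1 / (1 / inv_rad n x)) ^ CARD('n)) *
        (\<integral>\<^sup>+y. indicator (cball x (1 / inv_rad n x)) y * ennreal ((g y)\<^sup>2) \<partial>lborel)))"
        using kernel_int_sq_bound[where \<sigma> = "inv_rad n" and x = x, OF Q B(2) L2_supp_integrable[OF g] inv_rad_pos]
        by (cases "x \<in> D") (simp_all add: moll_def)
    qed
    also have "\<dots> = ennreal (2 ^ CARD('n) * B\<^sup>2) * (\<integral>\<^sup>+x. indicator D x * (ennreal ((1 / (1 / inv_rad n x)) ^ CARD('n)) *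
        (\<integral>\<^sup>+y. indicator (cball x (1 / inv_rad n x)) y * ennreal ((g y)\<^sup>2) \<partial>lborel)) \<partial>lborel)"
    proof (rule nn_integral_cmult)
      \<comment> \<open>The ball in the inner integral depends on \<open>x\<close>; rewriting it as
        a section of a jointly Borel set makes the integral measurable in \<open>x\<close>.\<close>
      define r where "r x = indicator D x * inv_rad n x" for x
      have [measurable]: "r \<in> borel_measurable borel"
        using borel_measurable_continuous_on_indicator[OF D_borel Cinf_continuous[OF inv_rad_Cinf[of n]]]
        by (simp add: r_def[abs_def])
      have "(\<lambda>x. indicator D x * (ennreal ((1 / (1 / inv_rad n x)) ^ CARD('n)) *
        (\<integral>\<^sup>+y. indicator (cball x (1 / inv_rad n x)) y * ennreal ((g y)\<^sup>2) \<partial>lborel)))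
        = (\<lambda>x. indicator D x * (ennreal (r x ^ CARD('n)) *
        (\<integral>\<^sup>+y. indicator {p. dist (fst p) (snd p) \<le> 1 / r (fst p)} (x, y) * ennreal ((g y)\<^sup>2) \<partial>lborel)))"
      proof
        fix x
        show "indicator D x * (ennreal ((1 / (1 / inv_rad n x)) ^ CARD('n)) *
        (\<integral>\<^sup>+y. indicator (cball x (1 / inv_rad n x)) y * ennreal ((g y)\<^sup>2) \<partial>lborel))
        = indicator D x * (ennreal (r x ^ CARD('n)) *
        (\<integral>\<^sup>+y. indicator {p. dist (fst p) (snd p) \<le> 1 / r (fst p)} (x, y) * ennreal ((g y)\<^sup>2) \<partial>lborel))"
          by (cases "x \<in> D") (auto simp: r_def indicator_def intro!: arg_cong2[where f = "(*)"] nn_integral_cong)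
      qed
      then show "(\<lambda>x. indicator D x * (ennreal ((1 / (1 / inv_rad n x)) ^ CARD('n)) *
        (\<integral>\<^sup>+y. indicator (cball x (1 / inv_rad n x)) y * ennreal ((g y)\<^sup>2) \<partial>lborel))) \<in> borel_measurable lborel"
        by simp
    qed
    also have "\<dots> \<le> ennreal (2 ^ CARD('n) * B\<^sup>2) *
      (ennreal ((6 * (16 / (5 * (real n + 7))) / (4 / (5 * (real n + 7)))) ^ CARD('n)) * (\<integral>\<^sup>+y. ennreal ((g y)\<^sup>2) \<partial>lborel))"
    proof (intro mult_left_mono average_bound rad_le_half)
      have "continuous_on D (inv_rad n)" by (rule Cinf_continuous[OF inv_rad_Cinf])
      then show "continuous_on D (\<lambda>x. 1 / inv_rad n x)"
        using inv_rad_pos[THEN less_imp_neq, of _ n] by (intro continuous_intros) auto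
    qed (use rad_bounds L2_supp_zero[OF g] in auto)
    also have "6 * (16 / (5 * (real n + 7))) / (4 / (5 * (real n + 7))) = 24"
      by (simp add: field_simps)
    also have "(\<integral>\<^sup>+y. ennreal ((g y)\<^sup>2) \<partial>lborel) = ennreal (L2sq g)"
      unfolding L2sq_def by (rule nn_integral_eq_integral[OF L2_supp_sq_integrable[OF g]]) simp
    finally show ?thesis
      using L2sq_nonneg[of g] by (simp add: K_def ennreal_mult' mult_ac)
  qed
  have mem: "moll Q n g \<in> L2_supp D" if g: "g \<in> L2_supp D" for n g
  proof -
    have "integrable lborel (\<lambda>x. (moll Q n g x)\<^sup>2)"
      using moll_measurable[OF Q g] le[OF g, of n]
      by (intro integrableI_bounded) (auto simp: le_less_trans[OF _ ennreal_less_top])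
    then show ?thesis using moll_measurable[OF Q g] by (simp add: L2_supp_def moll_def)
  qed
  show thesis
  proof (rule that[OF K mem])
    fix n g assume g: "g \<in> L2_supp D"
    have "ennreal (L2sq (moll Q n g)) \<le> ennreal (K * L2sq g)"
      using le[OF g, of n] nn_integral_eq_integral[OF L2_supp_sq_integrable[OF mem[OF g, of n]]]
      by (simp add: L2sq_def)
    then show "L2sq (moll Q n g) \<le> K * L2sq g"
      using K L2sq_nonneg[of g] by (simp add: ennreal_le_iff)
  qed
qed

lemma moll_add:
  assumes "Q \<in> unit_kernels" "f \<in> L2_supp D" "g \<in> L2_supp D"
  shows "moll Q n (\<lambda>x. f x + g x) = (\<lambda>x. moll Q n f x + moll Q n g x)"
proof (rule ext)
  fix x
  have "kernel_int Q (inv_rad n) (\<lambda>x. f x + g x) x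
      = kernel_int Q (inv_rad n) f x + kernel_int Q (inv_rad n) g x"
    unfolding kernel_int_def distrib_right
    by (intro Bochner_Integration.integral_add integrable_kernel_int assms(1)
        L2_supp_integrable[OF assms(2)] L2_supp_integrable[OF assms(3)])
  then show "moll Q n (\<lambda>x. f x + g x) x = moll Q n f x + moll Q n g x"
    by (simp add: moll_def distrib_left)
qed

lemma moll_cmult: "moll Q n (\<lambda>x. c * f x) = (\<lambda>x. c * moll Q n f x)"
proof (rule ext)
  fix x
  have "kernel_int Q (inv_rad n) (\<lambda>x. c * f x) x = c * kernel_int Q (inv_rad n) f x"
    unfolding kernel_int_def mult.assoc by (rule integral_mult_right_zero)
  then show "moll Q n (\<lambda>x. c * f x) x = c * moll Q n f x"
    by (simp add: moll_def)
qed

lemma moll_diff: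
  assumes "Q \<in> unit_kernels" "f \<in> L2_supp D" "g \<in> L2_supp D"
  shows "moll Q n (\<lambda>x. f x - g x) = (\<lambda>x. moll Q n f x - moll Q n g x)"
  using moll_add[OF assms(1,2) L2_supp_cmult[OF assms(3), of "-1"], of n] moll_cmult[of Q n "-1" g] by simp

lemma rad_tendsto_0:
  assumes "x \<in> D" shows "(\<lambda>n. 1 / inv_rad n x) \<longlonglongrightarrow> 0"
proof -
  have "(\<lambda>n. \<eta> x * inverse (real (n + 7))) \<longlonglongrightarrow> \<eta> x * 0"
    using LIMSEQ_ignore_initial_segment[OF lim_inverse_n, of 7] by (intro tendsto_mult_left) simp
  then show ?thesis using \<eta>_pos[OF assms] by (simp add: inv_rad_def divide_inverse mult.commute add_ac)
qed

text \<open>Convergence is checked on boxes, is preserved by linear operations, and passes to limits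
  because the averages are bounded on L2 uniformly in \<open>n\<close>.\<close>

lemma moll_tendsto:
  assumes "g \<in> L2_supp D"
  shows "(\<lambda>n. L2sq (\<lambda>x. moll \<rho> n g x - g x)) \<longlonglongrightarrow> 0"
  using assms
proof (induction rule: L2_induct)
  case (box a b)
  let ?A = "box a b \<inter> D"
  have A: "indicator ?A \<in> L2_supp D" and DL: "indicator D \<in> L2_supp D"
    by (auto intro: indicator_L2_supp)
  obtain K where K: "\<And>n g. g \<in> L2_supp D \<Longrightarrow> moll \<rho> n g \<in> L2_supp D"
    using moll_L2_bound[OF \<rho>(1)] by blast
  show ?case
  proof (rule L2sq_dominated_tendsto[OF K[OF A] A DL])
    \<comment> \<open>Off the frontier of the box the averaging ball eventually lies on one side,
      where the average is exactly 1 or 0; the frontier is a null set.\<close>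
    have "(\<lambda>n. moll \<rho> n (indicator ?A) x) \<longlonglongrightarrow> indicator ?A x" if x: "x \<notin> frontier (box a b)" for x
    proof (cases "x \<in> D")
      case True
      obtain e where e: "e > 0" "cball x e \<subseteq> box a b \<or> cball x e \<inter> box a b = {}"
      proof (cases "x \<in> box a b")
        case True
        then show thesis using open_contains_cball[of "box a b"] that by (auto simp: open_box)
      next
        case False
        with x have "x \<in> - closure (box a b)" by (auto simp: frontier_def interior_open[OF open_box])
        moreover have "open (- closure (box a b))" by (intro open_Compl closed_closure)
        ultimately obtain e where e: "e > 0" "cball x e \<subseteq> - closure (box a b)"
          unfolding open_contains_cball by blast
        then have "cball x e \<inter> box a b = {}" using closure_subset[of "box a b"] by blast
        with e(1) show thesis using that by blast
      qed
      have "\<forall>\<^sub>F n in sequentially. 1 / inv_rad n x < e"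
        using order_tendstoD(2)[OF rad_tendsto_0[OF True] e(1)] .
      then have "\<forall>\<^sub>F n in sequentially. moll \<rho> n (indicator ?A) x = indicator ?A x"
      proof eventually_elim
        case (elim n)
        have near: "y \<in> D \<and> (y \<in> box a b \<longleftrightarrow> x \<in> box a b)" if "dist x y \<le> 1 / inv_rad n x" for y
        proof -
          have "y \<in> cball x (1 / inv_rad n x)" using that by simp
          then have "y \<in> D" using rad_cball_subset[OF True] by blast
          moreover have "y \<in> cball x e" "x \<in> cball x e" using that elim e(1) by auto
          ultimately show ?thesis using e(2) by blast
        qed
        show ?case
        proof (cases "x \<in> box a b")
          case b: True
          have "inv_rad n x ^ CARD('n) * kernel_int \<rho> (inv_rad n) (indicator ?A) x = 1"
            by (rule kernel_int_indicator_inside[where \<sigma> = "inv_rad n" and x = x, OF \<rho>(1,3) inv_rad_pos[OF True]]) (use near b in blast)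
          then show ?thesis using True b by (simp add: moll_def)
        next
          case b: False
          have "kernel_int \<rho> (inv_rad n) (indicator ?A) x = 0"
            by (rule kernel_int_indicator_outside[where \<sigma> = "inv_rad n" and x = x, OF \<rho>(1) inv_rad_pos[OF True]]) (use near b in blast)
          then show ?thesis using b by (simp add: moll_def)
        qed
      qed
      then show ?thesis by (rule tendsto_eventually)
    qed (simp add: moll_def)
    moreover have "AE x in lborel. x \<notin> frontier (box a b)"
    proof -
      have "frontier (box a b) \<subseteq> cbox a b - box a b"
        by (auto simp: frontier_def interior_open[OF open_box]) (metis closed_cbox box_subset_cbox closure_minimal subsetD)
      moreover have "cbox a b - box a b \<in> null_sets lborel"
        using negligible_frontier_interval[of a b] by (simp add: negligible_iff_null_sets null_sets_completion_iff)
      ultimately show ?thesis by (auto intro: AE_I' )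
    qed
    ultimately show "AE x in lborel. (\<lambda>n. moll \<rho> n (indicator ?A) x) \<longlonglongrightarrow> indicator ?A x"
      by (auto elim: eventually_mono)
    show "\<bar>moll \<rho> n (indicator ?A) x\<bar> \<le> \<bar>indicator D x\<bar>" for n x
      using kernel_int_indicator_bound[where \<sigma> = "inv_rad n" and x = x and A = ?A, OF \<rho>(1) inv_rad_pos] \<rho>(2,3) by (simp add: moll_def)
  qed
next
  case (add f g)
  obtain K where K: "\<And>n g. g \<in> L2_supp D \<Longrightarrow> moll \<rho> n g \<in> L2_supp D"
    using moll_L2_bound[OF \<rho>(1)] by blast
  show ?case
  proof (rule tendsto_sandwich[OF always_eventually always_eventually tendsto_const])
    show "\<forall>n. L2sq (\<lambda>x. moll \<rho> n (\<lambda>x. f x + g x) x - (f x + g x))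
        \<le> 2 * L2sq (\<lambda>x. moll \<rho> n f x - f x) + 2 * L2sq (\<lambda>x. moll \<rho> n g x - g x)"
    proof
      fix n
      show "L2sq (\<lambda>x. moll \<rho> n (\<lambda>x. f x + g x) x - (f x + g x))
        \<le> 2 * L2sq (\<lambda>x. moll \<rho> n f x - f x) + 2 * L2sq (\<lambda>x. moll \<rho> n g x - g x)"
        using L2sq_add[OF L2_supp_diff[OF K[of f n] add.hyps(1)] L2_supp_diff[OF K[of g n] add.hyps(2)]] add.hyps
        by (simp add: moll_add[OF \<rho>(1)] algebra_simps)
    qed
    show "(\<lambda>n. 2 * L2sq (\<lambda>x. moll \<rho> n f x - f x) + 2 * L2sq (\<lambda>x. moll \<rho> n g x - g x)) \<longlonglongrightarrow> 0"
      using tendsto_add[OF tendsto_mult_left[OF add.IH(1), of 2] tendsto_mult_left[OF add.IH(2), of 2]] by simp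
  qed (simp add: L2sq_nonneg)
next
  case (scale c f)
  have "(\<lambda>n. L2sq (\<lambda>x. moll \<rho> n (\<lambda>x. c * f x) x - c * f x)) = (\<lambda>n. c\<^sup>2 * L2sq (\<lambda>x. moll \<rho> n f x - f x))"
    unfolding moll_cmult L2sq_cmult[symmetric] by (simp add: algebra_simps)
  then show ?case using tendsto_mult_left[OF scale.IH, of "c\<^sup>2"] by simp
next
  case (lim f g)
  obtain K where K: "K \<ge> 0" "\<And>n g. g \<in> L2_supp D \<Longrightarrow> moll \<rho> n g \<in> L2_supp D"
    "\<And>n g. g \<in> L2_supp D \<Longrightarrow> L2sq (moll \<rho> n g) \<le> K * L2sq g"
    using moll_L2_bound[OF \<rho>(1)] by blast
  \<comment> \<open>Two uses of the squared triangle inequality; \<open>K\<close> bounds the average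
    of \<open>f - g k\<close>, so \<open>k\<close> can be chosen before \<open>n\<close>.\<close>
  have bound: "L2sq (\<lambda>x. moll \<rho> n f x - f x)
      \<le> (2 * K + 4) * L2sq (\<lambda>x. g k x - f x) + 4 * L2sq (\<lambda>x. moll \<rho> n (g k) x - g k x)" for n k
  proof -
    have "L2sq (\<lambda>x. moll \<rho> n f x - moll \<rho> n (g k) x) \<le> K * L2sq (\<lambda>x. g k x - f x)"
      using K(3)[OF L2_supp_diff[OF lim.hyps(1) lim.hyps(2)], of n k] lim.hyps
      by (simp add: moll_diff[OF \<rho>(1)] L2sq_diff_commute[of f])
    moreover have "L2sq (\<lambda>x. moll \<rho> n f x - f x) \<le> 2 * L2sq (\<lambda>x. moll \<rho> n f x - moll \<rho> n (g k) x)
        + 2 * L2sq (\<lambda>x. moll \<rho> n (g k) x - f x)"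
      by (rule L2sq_triangle[OF K(2)[OF lim.hyps(1)] K(2)[OF lim.hyps(2)] lim.hyps(1)])
    moreover have "L2sq (\<lambda>x. moll \<rho> n (g k) x - f x) \<le> 2 * L2sq (\<lambda>x. moll \<rho> n (g k) x - g k x)
        + 2 * L2sq (\<lambda>x. g k x - f x)"
      by (rule L2sq_triangle[OF K(2)[OF lim.hyps(2)] lim.hyps(2,1)])
    ultimately show ?thesis by (simp add: algebra_simps)
  qed
  show ?case
  proof (rule LIMSEQ_I)
    fix e :: real assume "e > 0"
    then have "e / (2 * (2 * K + 4)) > 0" using K(1) by simp
    then obtain k where k: "L2sq (\<lambda>x. g k x - f x) < e / (2 * (2 * K + 4))"
      using order_tendstoD(2)[OF lim.hyps(3)] unfolding eventually_sequentially by blast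
    have "e / 8 > 0" using \<open>e > 0\<close> by simp
    then obtain N where N: "\<And>n. n \<ge> N \<Longrightarrow> L2sq (\<lambda>x. moll \<rho> n (g k) x - g k x) < e / 8"
      using order_tendstoD(2)[OF lim.IH[of k]] unfolding eventually_sequentially by blast
    have "L2sq (\<lambda>x. moll \<rho> n f x - f x) < e" if "n \<ge> N" for n
    proof -
      have "(2 * K + 4) * L2sq (\<lambda>x. g k x - f x) < e / 2"
        using k K(1) by (simp add: field_simps)
      then show ?thesis using bound[of n k] N[OF that] by linarith
    qed
    then show "\<exists>N. \<forall>n\<ge>N. norm (L2sq (\<lambda>x. moll \<rho> n f x - f x) - 0) < e"
      by (intro exI[of _ N]) (simp add: abs_of_nonneg[OF L2sq_nonneg])
  qed
qed

end

section \<open>Weak gradients\<close>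

lemma test_functionD:
  assumes "\<psi> \<in> test_functions D"
  shows "\<psi> \<in> Cinf UNIV" "compact (closure {x. \<psi> x \<noteq> 0})" "closure {x. \<psi> x \<noteq> 0} \<subseteq> D"
  using assms by (auto simp: test_functions_def)

lemma compact_support_bounded:
  fixes f :: "real ^ 'n \<Rightarrow> real"
  assumes "compact S" "continuous_on S f" "\<And>x. x \<notin> S \<Longrightarrow> f x = 0"
  obtains B where "\<And>x. \<bar>f x\<bar> \<le> B"
proof -
  obtain B where B: "B > 0" "\<And>x. x \<in> S \<Longrightarrow> \<bar>f x\<bar> \<le> B"
    using compact_imp_bounded[OF compact_continuous_image[OF assms(2,1)]] by (auto simp: bounded_pos)
  have "\<bar>f x\<bar> \<le> B" for x
    using B assms(3)[of x] by (cases "x \<in> S") auto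
  then show thesis by (rule that)
qed

lemma test_function_partial_deriv_zero:
  assumes "x \<notin> closure {x. \<psi> x \<noteq> 0}"
  shows "\<psi> x = 0" "partial_deriv i \<psi> x = 0"
proof -
  have z: "\<psi> y = 0" if "y \<in> - closure {x. \<psi> x \<noteq> 0}" for y
    using that closure_subset[of "{x. \<psi> x \<noteq> 0}"] by blast
  then show "\<psi> x = 0" using assms by blast
  have "partial_deriv i \<psi> x = partial_deriv i (\<lambda>_. 0) x"
    by (rule partial_deriv_cong_open[OF open_Compl[OF closed_closure] iffD2[OF Compl_iff assms] z])
  then show "partial_deriv i \<psi> x = 0" by (simp add: partial_deriv_def)
qed

lemma test_function_bounded:
  assumes "\<psi> \<in> test_functions D"
  obtains B where "\<And>x. \<bar>\<psi> x\<bar> \<le> B" "\<And>x i. \<bar>partial_deriv i \<psi> x\<bar> \<le> B"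
proof -
  note \<psi> = test_functionD[OF assms]
  let ?S = "closure {x. \<psi> x \<noteq> 0}"
  have c: "continuous_on ?S f" if "f \<in> Cinf UNIV" for f
    by (rule continuous_on_subset[OF Cinf_continuous[OF that]]) simp
  obtain B0 where B0: "\<And>x. \<bar>\<psi> x\<bar> \<le> B0"
    using compact_support_bounded[OF \<psi>(2) c[OF \<psi>(1)] test_function_partial_deriv_zero(1)[of _ \<psi>]] by blast
  have "\<exists>B. \<forall>x. \<bar>partial_deriv i \<psi> x\<bar> \<le> B" for i
    using compact_support_bounded[OF \<psi>(2) c[OF Cinf_partial_deriv[OF \<psi>(1)]]
        test_function_partial_deriv_zero(2)[of _ \<psi>], of i] by blast
  then have "\<forall>i. \<exists>B. \<forall>x. \<bar>partial_deriv i \<psi> x\<bar> \<le> B" by blast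
  from choice[OF this] obtain B1 where B1: "\<And>i x. \<bar>partial_deriv i \<psi> x\<bar> \<le> B1 i" by blast
  have nn: "0 \<le> B0" "0 \<le> B1 i" for i
    using order_trans[OF abs_ge_zero B0] order_trans[OF abs_ge_zero B1] by auto
  show thesis
  proof (rule that[of "B0 + (\<Sum>i\<in>UNIV. B1 i)"])
    show "\<bar>\<psi> x\<bar> \<le> B0 + (\<Sum>i\<in>UNIV. B1 i)" for x
      using B0[of x] nn by (simp add: add_increasing2 sum_nonneg)
    show "\<bar>partial_deriv i \<psi> x\<bar> \<le> B0 + (\<Sum>i\<in>UNIV. B1 i)" for x i
    proof -
      have "B1 i \<le> (\<Sum>i\<in>UNIV. B1 i)" using nn(2) by (intro member_le_sum) auto
      with B1[of i x] nn(1) show ?thesis by linarith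
    qed
  qed
qed

lemma test_function_measurable:
  assumes "\<psi> \<in> test_functions D"
  shows "\<psi> \<in> borel_measurable borel" "partial_deriv i \<psi> \<in> borel_measurable borel"
  by (rule borel_measurable_continuous_onI[OF Cinf_continuous[OF test_functionD(1)[OF assms]]])
    (rule borel_measurable_continuous_onI[OF Cinf_continuous[OF Cinf_partial_deriv[OF test_functionD(1)[OF assms]]]])

text \<open>By translation invariance every difference quotient of \<open>u\<close> has integral 0,
  and dominated convergence passes to the derivative. No iterated integral along the axis is
  taken.\<close>

lemma integral_partial_deriv_zero:
  fixes u :: "real ^ 'n \<Rightarrow> real"
  assumes u: "\<And>x. (u has_derivative u' x) (at x)" and S: "compact S" "\<And>x. x \<notin> S \<Longrightarrow> u x = 0"
    and B: "\<And>x. \<bar>u' x (axis i 1)\<bar> \<le> B"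
  shows "(LINT x|lborel. u' x (axis i 1)) = 0"
proof -
  let ?e = "axis i (1 :: real) :: real ^ 'n"
  define t where "t n = inverse (real (Suc n))" for n
  have t: "t n > 0" "t n \<le> 1" for n by (auto simp: t_def inverse_le_1_iff)
  have cont: "continuous_on UNIV u"
    using u by (auto intro!: continuous_at_imp_continuous_on has_derivative_continuous)
  then have meas [measurable]: "u \<in> borel_measurable borel" by (rule borel_measurable_continuous_onI)
  have int: "integrable lborel u"
  proof -
    have "integrable lborel (\<lambda>x. indicator S x *\<^sub>R u x)"
      using cont continuous_on_subset S(1) by (intro borel_integrable_compact) auto
    moreover have "(\<lambda>x. indicator S x *\<^sub>R u x) = u"
      using S(2) by (auto simp: fun_eq_iff indicator_def)
    ultimately show ?thesis by simp
  qed
  have line: "((\<lambda>s. u (x + s *\<^sub>R ?e)) has_real_derivative u' (x + s *\<^sub>R ?e) ?e) (at s)" for x s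
  proof -
    have "((\<lambda>s. u (x + s *\<^sub>R ?e)) has_derivative (\<lambda>r. u' (x + s *\<^sub>R ?e) (r *\<^sub>R ?e))) (at s)"
      by (rule has_derivative_compose[where f = "\<lambda>s. x + s *\<^sub>R ?e" and g = u and f' = "\<lambda>r. r *\<^sub>R ?e"
            and g' = "u' (x + s *\<^sub>R ?e)", OF _ u]) (auto intro!: derivative_eq_intros)
    then show ?thesis
      using linear_scale[OF has_derivative_linear[OF u]]
      by (simp add: has_field_derivative_def mult_commute_abs)
  qed
  have shift: "(LINT x|lborel. u (x + c)) = (LINT x|lborel. u x) \<and> integrable lborel (\<lambda>x. u (x + c))" for c
  proof -
    have "(LINT x|distr lborel borel ((+) c). u x) = (LINT x|lborel. u (c + x))"
      "integrable (distr lborel borel ((+) c)) u \<longleftrightarrow> integrable lborel (\<lambda>x. u (c + x))"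
      by (simp_all add: integral_distr integrable_distr_eq)
    then show ?thesis using int by (simp add: lborel_distr_plus add.commute)
  qed
  obtain b where b: "b > 0" "S \<subseteq> cball 0 b"
    using compact_imp_bounded[OF S(1)] by (fastforce simp: bounded_pos)
  define R where "R n x = (u (x + t n *\<^sub>R ?e) - u x) / t n" for n x
  have R0: "(LINT x|lborel. R n x) = 0" for n
    using shift[of "t n *\<^sub>R ?e"] int by (simp add: R_def)
  have Rlim: "(\<lambda>n. R n x) \<longlonglongrightarrow> u' x ?e" for x
  proof -
    have "((\<lambda>s. (u (x + s *\<^sub>R ?e) - u x) / s) \<longlongrightarrow> u' x ?e) (at 0)"
      using line[of x 0] by (simp add: has_field_derivative_iff)
    moreover have "filterlim t (at 0) sequentially"
      unfolding filterlim_at t_def using LIMSEQ_inverse_real_of_nat by auto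
    ultimately show ?thesis unfolding R_def by (rule filterlim_compose)
  qed
  have meas': "(\<lambda>x. u' x ?e) \<in> borel_measurable borel"
    by (rule borel_measurable_LIMSEQ_real[OF Rlim]) (simp add: R_def)
  have "(\<lambda>n. LINT x|lborel. R n x) \<longlonglongrightarrow> (LINT x|lborel. u' x ?e)"
  \<comment> \<open>The steps \<open>t n\<close> are at most 1, so all quotients vanish outside the
    ball enlarged by 1.\<close>
  proof (rule integral_dominated_convergence[where w = "\<lambda>x. B * indicator (cball 0 (b + 1)) x"])
    show "integrable lborel (\<lambda>x. B * indicator (cball 0 (b + 1)) (x :: real ^ 'n))"
      using emeasure_lborel_cball_finite by (auto simp: integrable_indicator_iff)
    show "AE x in lborel. norm (R n x) \<le> B * indicator (cball 0 (b + 1)) x" for n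
    proof (rule AE_I2)
      fix x
      show "norm (R n x) \<le> B * indicator (cball 0 (b + 1)) x"
      proof (cases "x \<in> cball 0 (b + 1)")
        case True
        have "norm (u (x + t n *\<^sub>R ?e) - u (x + 0 *\<^sub>R ?e)) \<le> B * norm (t n - 0)"
          by (rule field_differentiable_bound[where S = UNIV and f' = "\<lambda>s. u' (x + s *\<^sub>R ?e) ?e"])
            (use line B in auto)
        then have "\<bar>u (x + t n *\<^sub>R ?e) - u x\<bar> \<le> B * t n" using t(1)[of n] by simp
        then show ?thesis using True t(1)[of n] by (simp add: R_def pos_divide_le_eq)
      next
        case False
        have "norm x \<le> norm (x + t n *\<^sub>R ?e) + norm (t n *\<^sub>R ?e)"
          using norm_triangle_ineq4[of "x + t n *\<^sub>R ?e" "t n *\<^sub>R ?e"] by simp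
        then have "x + t n *\<^sub>R ?e \<notin> S" "x \<notin> S"
          using False b t[of n] by (auto simp: subset_iff)
        then show ?thesis using False by (simp add: R_def S(2))
      qed
    qed
  qed (use meas' Rlim in \<open>auto simp: R_def\<close>)
  then show ?thesis by (simp add: R0 LIMSEQ_const_iff)
qed

definition zero_ext :: "(real ^ 'n) set \<Rightarrow> (real ^ 'n \<Rightarrow> real) \<Rightarrow> real ^ 'n \<Rightarrow> real" where
  "zero_ext D u x = (if x \<in> D then u x else 0)"

text \<open>Borel representatives, vanishing outside \<open>D\<close>, of a function and of its distributional gradient.\<close>

definition weak_grad_rep ::
    "(real ^ 'n) set \<Rightarrow> (real ^ 'n \<Rightarrow> real) \<Rightarrow> ('n \<Rightarrow> real ^ 'n \<Rightarrow> real) \<Rightarrow> bool" where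
  "weak_grad_rep D u G \<longleftrightarrow> u \<in> L2_supp D \<and> (\<forall>i. G i \<in> L2_supp D) \<and>
    (\<forall>\<psi>\<in>test_functions D. \<forall>i.
      (LINT x|lborel. u x * partial_deriv i \<psi> x) = - (LINT x|lborel. G i x * \<psi> x))"

section \<open>Borel representatives of Sobolev functions\<close>

context finite_domain
begin

lemma D_lebesgue: "D \<in> sets lebesgue"
  by (rule sets_completionI_sets) simp

text \<open>The bridge between the definitions, stated with Lebesgue measure restricted to
  \<open>D\<close>, and the estimates for Borel functions vanishing off \<open>D\<close>.
  Restriction becomes multiplication by the indicator, and completion does not change integrals of
  Borel functions.\<close>

lemma
  fixes h h0 :: "real ^ 'n \<Rightarrow> real"
  assumes h: "h \<in> borel_measurable (lebesgue_on D)" and h0: "h0 \<in> borel_measurable borel"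
    and zero: "\<And>x. x \<notin> D \<Longrightarrow> h0 x = 0" and eq: "AE x in lborel. x \<in> D \<longrightarrow> h x = h0 x"
  shows integral_lebesgue_on_rep: "(LINT x|lebesgue_on D. h x) = (LINT x|lborel. h0 x)"
    and integrable_lebesgue_on_rep: "integrable (lebesgue_on D) h \<longleftrightarrow> integrable lborel h0"
proof -
  have D: "D \<inter> space lebesgue \<in> sets lebesgue" using D_lebesgue by simp
  define h1 where "h1 x = (if x \<in> D then h x else 0)" for x
  have h1: "h1 \<in> borel_measurable lebesgue"
    unfolding h1_def[abs_def] by (rule borel_measurable_if_I[OF h D_lebesgue])
  have h0': "h0 \<in> borel_measurable lborel" using h0 by simp
  have h0L: "h0 \<in> borel_measurable lebesgue" by (rule measurable_completion[OF h0'])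
  have h1_eq: "(\<lambda>x. indicator D x *\<^sub>R h x) = h1" by (auto simp: h1_def indicator_def fun_eq_iff)
  have "AE x in lborel. h1 x = h0 x"
    using eq by eventually_elim (simp add: h1_def zero)
  then have AE: "AE x in lebesgue. h1 x = h0 x" by (rule AE_completion)
  have "(LINT x|lebesgue_on D. h x) = (LINT x|lebesgue. h1 x)"
    unfolding integral_restrict_space[OF D] h1_eq ..
  also have "\<dots> = (LINT x|lebesgue. h0 x)" by (rule integral_cong_AE[OF h1 h0L AE])
  also have "\<dots> = (LINT x|lborel. h0 x)" by (rule integral_completion[OF h0'])
  finally show "(LINT x|lebesgue_on D. h x) = (LINT x|lborel. h0 x)" .
  have "integrable (lebesgue_on D) h \<longleftrightarrow> integrable lebesgue h1"
    unfolding integrable_restrict_space[OF D] h1_eq ..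
  also have "\<dots> \<longleftrightarrow> integrable lebesgue h0" by (rule integrable_cong_AE[OF h1 h0L AE])
  also have "\<dots> \<longleftrightarrow> integrable lborel h0" by (rule integrable_completion[OF h0'])
  finally show "integrable (lebesgue_on D) h \<longleftrightarrow> integrable lborel h0" .
qed

lemma borel_representative:
  fixes h :: "real ^ 'n \<Rightarrow> real"
  assumes h: "h \<in> borel_measurable (lebesgue_on D)"
  obtains h0 where "h0 \<in> borel_measurable borel" "\<And>x. x \<notin> D \<Longrightarrow> h0 x = 0"
    "AE x in lborel. x \<in> D \<longrightarrow> h x = h0 x"
proof -
  obtain g where g: "g \<in> borel_measurable lborel"
    "AE x in lborel. (if x \<in> D then h x else 0) = g x"
    using completion_ex_borel_measurable_real[OF borel_measurable_if_I[OF h D_lebesgue]] by blast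
  have [measurable]: "g \<in> borel_measurable borel" using g(1) by simp
  show thesis
  proof (rule that[of "\<lambda>x. indicator D x * g x"])
    show "AE x in lborel. x \<in> D \<longrightarrow> h x = indicator D x * g x"
      using g(2) by eventually_elim auto
  qed auto
qed

lemma L2_representative:
  fixes h :: "real ^ 'n \<Rightarrow> real"
  assumes h: "h \<in> borel_measurable (lebesgue_on D)" and int: "integrable (lebesgue_on D) (\<lambda>x. (h x)\<^sup>2)"
  obtains h0 where "h0 \<in> L2_supp D" "AE x in lborel. x \<in> D \<longrightarrow> h x = h0 x"
proof -
  obtain h0 where h0: "h0 \<in> borel_measurable borel" "\<And>x. x \<notin> D \<Longrightarrow> h0 x = 0"
    "AE x in lborel. x \<in> D \<longrightarrow> h x = h0 x"
    using borel_representative[OF h] by blast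
  have "integrable lborel (\<lambda>x. (h0 x)\<^sup>2)"
  proof (rule iffD1[OF integrable_lebesgue_on_rep int])
    show "(\<lambda>x. (h x)\<^sup>2) \<in> borel_measurable (lebesgue_on D)" using h by simp
    show "(\<lambda>x. (h0 x)\<^sup>2) \<in> borel_measurable borel" using h0(1) by simp
    show "AE x in lborel. x \<in> D \<longrightarrow> (h x)\<^sup>2 = (h0 x)\<^sup>2" using h0(3) by eventually_elim auto
  qed (simp add: h0(2))
  then have "h0 \<in> L2_supp D" using h0(1,2) by (simp add: L2_supp_def)
  then show thesis using h0(3) by (rule that)
qed

lemma lebesgue_on_measurable:
  "f \<in> borel_measurable borel \<Longrightarrow> f \<in> borel_measurable (lebesgue_on D)"
  by (intro measurable_restrict_space1 measurable_completion) simp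

lemma L2_on_component_representative:
  fixes H :: "real ^ 'n \<Rightarrow> real ^ 'n"
  assumes "H \<in> L2_on D"
  obtains h where "h \<in> L2_supp D" "AE x in lborel. x \<in> D \<longrightarrow> H x $ i = h x"
proof -
  have H: "H \<in> borel_measurable (lebesgue_on D)" "integrable (lebesgue_on D) (\<lambda>x. (norm (H x))\<^sup>2)"
    using assms by (auto simp: L2_on_def)
  have Hi: "(\<lambda>x. H x $ i) \<in> borel_measurable (lebesgue_on D)"
    using borel_measurable_inner[OF H(1) borel_measurable_const, of "axis i 1"] by (simp add: inner_axis)
  have "integrable (lebesgue_on D) (\<lambda>x. (H x $ i)\<^sup>2)"
  proof (rule Bochner_Integration.integrable_bound[OF H(2)])
    have "(H x $ i)\<^sup>2 \<le> (norm (H x))\<^sup>2" for x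
      using power_mono[OF component_le_norm_cart[of "H x" i] abs_ge_zero, of 2] by simp
    then show "AE x in lebesgue_on D. norm ((H x $ i)\<^sup>2) \<le> norm ((norm (H x))\<^sup>2)" by simp
  qed (use Hi in simp)
  then show thesis using L2_representative[OF Hi] that by blast
qed

text \<open>Allows every statement about \<open>W12\<close> to be proved for representatives;
  \<open>weak_grad_rep_imp_W12\<close> leads back.\<close>

lemma weak_grad_rep_exists:
  assumes f: "f \<in> L2_on D" and H: "has_L2_weak_grad D f H"
  obtains u G where "weak_grad_rep D u G" "AE x in lborel. x \<in> D \<longrightarrow> f x = u x"
    "\<And>i. AE x in lborel. x \<in> D \<longrightarrow> H x $ i = G i x"
proof -
  have f': "f \<in> borel_measurable (lebesgue_on D)" "integrable (lebesgue_on D) (\<lambda>x. (f x)\<^sup>2)"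
    using f by (auto simp: L2_on_def)
  obtain u where u: "u \<in> L2_supp D" "AE x in lborel. x \<in> D \<longrightarrow> f x = u x"
    using L2_representative[OF f'] by blast
  have HL: "H \<in> L2_on D" using H by (simp add: has_L2_weak_grad_def)
  have "\<exists>h. h \<in> L2_supp D \<and> (AE x in lborel. x \<in> D \<longrightarrow> H x $ i = h x)" for i
    using L2_on_component_representative[OF HL, of i] by blast
  then obtain G where G: "\<And>i. G i \<in> L2_supp D" "\<And>i. AE x in lborel. x \<in> D \<longrightarrow> H x $ i = G i x"
    by metis
  have "weak_grad_rep D u G"
    unfolding weak_grad_rep_def
  proof (intro conjI allI ballI)
    fix \<psi> i assume \<psi>: "\<psi> \<in> test_functions D"
    note [measurable] = test_function_measurable[OF \<psi>] L2_supp_measurable[OF u(1)] L2_supp_measurable[OF G(1)]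
    have Hi: "(\<lambda>x. H x $ i) \<in> borel_measurable (lebesgue_on D)"
      using borel_measurable_inner[OF _ borel_measurable_const, of H "lebesgue_on D" "axis i 1"] HL
      by (simp add: inner_axis L2_on_def)
    have "(LINT x|lebesgue_on D. f x * partial_deriv i \<psi> x) = (LINT x|lborel. u x * partial_deriv i \<psi> x)"
    proof (rule integral_lebesgue_on_rep)
      show "(\<lambda>x. f x * partial_deriv i \<psi> x) \<in> borel_measurable (lebesgue_on D)"
        using f'(1) lebesgue_on_measurable[OF test_function_measurable(2)[OF \<psi>]] by simp
      show "AE x in lborel. x \<in> D \<longrightarrow> f x * partial_deriv i \<psi> x = u x * partial_deriv i \<psi> x"
        using u(2) by eventually_elim auto
    qed (auto simp: L2_supp_zero[OF u(1)])
    moreover have "(LINT x|lebesgue_on D. H x $ i * \<psi> x) = (LINT x|lborel. G i x * \<psi> x)"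
    proof (rule integral_lebesgue_on_rep)
      show "(\<lambda>x. H x $ i * \<psi> x) \<in> borel_measurable (lebesgue_on D)"
        using Hi lebesgue_on_measurable[OF test_function_measurable(1)[OF \<psi>]] by simp
      show "AE x in lborel. x \<in> D \<longrightarrow> H x $ i * \<psi> x = G i x * \<psi> x"
        using G(2)[of i] by eventually_elim auto
    qed (auto simp: L2_supp_zero[OF G(1)])
    ultimately show "(LINT x|lborel. u x * partial_deriv i \<psi> x) = - (LINT x|lborel. G i x * \<psi> x)"
      using H \<psi> by (simp add: has_L2_weak_grad_def)
  qed (use u G in auto)
  then show thesis using u(2) G(2) by (rule that)
qed

lemma weak_grad_rep_imp_W12:
  assumes rep: "weak_grad_rep D u G" and f: "f \<in> borel_measurable (lebesgue_on D)"
    and eq: "AE x in lborel. x \<in> D \<longrightarrow> f x = u x"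
  shows "f \<in> L2_on D" "has_L2_weak_grad D f (\<lambda>x. \<chi> i. G i x)"
proof -
  have u: "u \<in> L2_supp D" and G: "\<And>i. G i \<in> L2_supp D" using rep by (auto simp: weak_grad_rep_def)
  have "integrable (lebesgue_on D) (\<lambda>x. (f x)\<^sup>2)"
  proof (rule iffD2[OF integrable_lebesgue_on_rep L2_supp_sq_integrable[OF u]])
    show "(\<lambda>x. (f x)\<^sup>2) \<in> borel_measurable (lebesgue_on D)" using f by simp
    show "(\<lambda>x. (u x)\<^sup>2) \<in> borel_measurable borel" using L2_supp_measurable[OF u] by simp
    show "AE x in lborel. x \<in> D \<longrightarrow> (f x)\<^sup>2 = (u x)\<^sup>2" using eq by eventually_elim auto
  qed (simp add: L2_supp_zero[OF u])
  then show "f \<in> L2_on D" using f by (simp add: L2_on_def)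
  let ?H = "\<lambda>x. \<chi> i. G i x"
  have Hm: "?H \<in> borel_measurable borel"
  proof (subst borel_measurable_euclidean_space, rule ballI)
    fix b :: "real ^ 'n" assume "b \<in> Basis"
    then obtain i where "b = axis i 1" by (auto simp: Basis_vec_def)
    then show "(\<lambda>x. ?H x \<bullet> b) \<in> borel_measurable borel"
      using L2_supp_measurable[OF G, of i] by (simp add: inner_axis)
  qed
  have nrm: "(norm (?H x))\<^sup>2 = (\<Sum>i\<in>UNIV. (G i x)\<^sup>2)" for x
    by (simp add: norm_vec_def L2_set_def real_sqrt_pow2 sum_nonneg)
  have "integrable (lebesgue_on D) (\<lambda>x. (norm (?H x))\<^sup>2)"
  proof (subst integrable_lebesgue_on_rep[where ?h0.0 = "\<lambda>x. (norm (?H x))\<^sup>2"])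
    show "integrable lborel (\<lambda>x. (norm (?H x))\<^sup>2)"
      unfolding nrm using L2_supp_sq_integrable[OF G] by simp
    show "(norm (?H x))\<^sup>2 = 0" if "x \<notin> D" for x unfolding nrm using L2_supp_zero[OF G that] by simp
    show "(\<lambda>x. (norm (?H x))\<^sup>2) \<in> borel_measurable (lebesgue_on D)"
      by (rule lebesgue_on_measurable) (use Hm in simp)
  qed (use Hm in auto)
  then have HL: "?H \<in> L2_on D" using lebesgue_on_measurable[OF Hm] Hm
    by (auto simp: L2_on_def intro!: measurable_restrict_space1 measurable_completion)
  show "has_L2_weak_grad D f ?H"
    unfolding has_L2_weak_grad_def
  proof (intro conjI HL ballI allI)
    fix \<psi> i assume \<psi>: "\<psi> \<in> test_functions D"
    note [measurable] = test_function_measurable[OF \<psi>] L2_supp_measurable[OF u] L2_supp_measurable[OF G]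
    have "(LINT x|lebesgue_on D. f x * partial_deriv i \<psi> x) = (LINT x|lborel. u x * partial_deriv i \<psi> x)"
    proof (rule integral_lebesgue_on_rep)
      show "(\<lambda>x. f x * partial_deriv i \<psi> x) \<in> borel_measurable (lebesgue_on D)"
        using f lebesgue_on_measurable[OF test_function_measurable(2)[OF \<psi>]] by simp
      show "AE x in lborel. x \<in> D \<longrightarrow> f x * partial_deriv i \<psi> x = u x * partial_deriv i \<psi> x"
        using eq by eventually_elim auto
    qed (auto simp: L2_supp_zero[OF u])
    moreover have "(LINT x|lebesgue_on D. ?H x $ i * \<psi> x) = (LINT x|lborel. G i x * \<psi> x)"
    proof (rule integral_lebesgue_on_rep)
      show "(\<lambda>x. ?H x $ i * \<psi> x) \<in> borel_measurable (lebesgue_on D)"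
        by (rule lebesgue_on_measurable) simp
    qed (auto simp: L2_supp_zero[OF G])
    ultimately show "(LINT x|lebesgue_on D. f x * partial_deriv i \<psi> x)
        = - (LINT x|lebesgue_on D. ?H x $ i * \<psi> x)"
      using rep \<psi> by (simp add: weak_grad_rep_def)
  qed
qed

lemma integrable_L2_test:
  assumes "g \<in> L2_supp D" "\<psi> \<in> test_functions D"
  shows "integrable lborel (\<lambda>x. g x * \<psi> x)" "integrable lborel (\<lambda>x. g x * partial_deriv i \<psi> x)"
proof -
  obtain B where B: "\<And>x. \<bar>\<psi> x\<bar> \<le> B" "\<And>x i. \<bar>partial_deriv i \<psi> x\<bar> \<le> B"
    using test_function_bounded[OF assms(2)] by blast
  have B0: "0 \<le> B" using order_trans[OF abs_ge_zero B(1)] by blast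
  note [measurable] = test_function_measurable[OF assms(2)] L2_supp_measurable[OF assms(1)]
  have int: "integrable lborel (\<lambda>x. B * g x)" using L2_supp_integrable[OF assms(1)] by simp
  have le: "\<bar>g x * c\<bar> \<le> \<bar>B * g x\<bar>" if "\<bar>c\<bar> \<le> B" for x c
    using mult_right_mono[OF that abs_ge_zero[of "g x"]] B0 by (simp add: abs_mult mult.commute[of "\<bar>g x\<bar>"])
  show "integrable lborel (\<lambda>x. g x * \<psi> x)"
    by (rule Bochner_Integration.integrable_bound[OF int]) (auto intro!: AE_I2 le B)
  show "integrable lborel (\<lambda>x. g x * partial_deriv i \<psi> x)"
    by (rule Bochner_Integration.integrable_bound[OF int]) (auto intro!: AE_I2 le B)
qed

lemma weak_grad_rep_diff:
  assumes "weak_grad_rep D u G" "weak_grad_rep D v H"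
  shows "weak_grad_rep D (\<lambda>x. u x - v x) (\<lambda>i x. G i x - H i x)"
proof -
  have m: "u \<in> L2_supp D" "v \<in> L2_supp D" "\<And>i. G i \<in> L2_supp D" "\<And>i. H i \<in> L2_supp D"
    using assms by (auto simp: weak_grad_rep_def)
  show ?thesis
    unfolding weak_grad_rep_def
  proof (intro conjI allI ballI L2_supp_diff m)
    fix \<psi> i assume \<psi>: "\<psi> \<in> test_functions D"
    have "(LINT x|lborel. (u x - v x) * partial_deriv i \<psi> x)
        = (LINT x|lborel. u x * partial_deriv i \<psi> x) - (LINT x|lborel. v x * partial_deriv i \<psi> x)"
      unfolding left_diff_distrib
      by (rule Bochner_Integration.integral_diff[OF integrable_L2_test(2)[OF m(1) \<psi>] integrable_L2_test(2)[OF m(2) \<psi>]])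
    moreover have "(LINT x|lborel. (G i x - H i x) * \<psi> x) = (LINT x|lborel. G i x * \<psi> x) - (LINT x|lborel. H i x * \<psi> x)"
      unfolding left_diff_distrib
      by (rule Bochner_Integration.integral_diff[OF integrable_L2_test(1)[OF m(3) \<psi>] integrable_L2_test(1)[OF m(4) \<psi>]])
    ultimately show "(LINT x|lborel. (u x - v x) * partial_deriv i \<psi> x) = - (LINT x|lborel. (G i x - H i x) * \<psi> x)"
      using assms \<psi> by (simp add: weak_grad_rep_def)
  qed
qed

text \<open>The product of \<open>\<phi>\<close> and a test function, extended by 0, is
  differentiable everywhere, since the support of the test function is compact in \<open>D\<close>.
  Its partial derivative has integral 0, which is the integration by parts formula.\<close>

lemma smooth_weak_grad_rep:
  assumes \<phi>: "\<phi> \<in> Cinf D" and L2: "zero_ext D \<phi> \<in> L2_supp D"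
    "\<And>i. zero_ext D (partial_deriv i \<phi>) \<in> L2_supp D"
  shows "weak_grad_rep D (zero_ext D \<phi>) (\<lambda>i. zero_ext D (partial_deriv i \<phi>))"
  unfolding weak_grad_rep_def
proof (intro conjI allI ballI L2)
  fix \<psi> i assume \<psi>: "\<psi> \<in> test_functions D"
  let ?S = "closure {x. \<psi> x \<noteq> 0}"
  note \<psi>D = test_functionD[OF \<psi>]
  define u where "u x = zero_ext D \<phi> x * \<psi> x" for x
  define u' where "u' x v = (if x \<in> D then \<phi> x * frechet_derivative \<psi> (at x) v
      + frechet_derivative \<phi> (at x) v * \<psi> x else 0)" for x v
  have u_zero: "u x = 0" if "x \<notin> ?S" for x
    unfolding u_def test_function_partial_deriv_zero(1)[OF that] by (rule mult_zero_right)
  have der: "(u has_derivative u' x) (at x)" for x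
  proof (cases "x \<in> D")
    case True
    have "((\<lambda>x. \<phi> x * \<psi> x) has_derivative u' x) (at x)"
      using has_derivative_mult[OF Cinf_has_derivative[OF open_D \<phi> True]
          Cinf_has_derivative[OF open_UNIV \<psi>D(1) UNIV_I]] True
      by (simp add: u'_def[abs_def])
    then show ?thesis
      by (rule has_derivative_transform_within_open[OF _ open_D True]) (simp add: u_def zero_ext_def)
  next
    case False
    then have x: "x \<in> - ?S" using \<psi>D(3) by blast
    have "((\<lambda>_. 0) has_derivative u' x) (at x)" using False by (simp add: u'_def[abs_def])
    then show ?thesis
      by (rule has_derivative_transform_within_open[OF _ open_Compl[OF closed_closure] x])
        (use u_zero in auto)
  qed
  have u'_eq: "u' x (axis i 1) = zero_ext D \<phi> x * partial_deriv i \<psi> x + zero_ext D (partial_deriv i \<phi>) x * \<psi> x" for x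
    by (simp add: u'_def zero_ext_def partial_deriv_def)
  have u'_zero: "u' x (axis i 1) = 0" if "x \<notin> ?S" for x
    unfolding u'_eq using test_function_partial_deriv_zero[OF that] by simp
  have "continuous_on D (\<lambda>x. \<phi> x * partial_deriv i \<psi> x + partial_deriv i \<phi> x * \<psi> x)"
    by (intro continuous_on_add continuous_on_mult Cinf_continuous[OF \<phi>]
        Cinf_continuous[OF Cinf_partial_deriv[OF \<phi>]]
        continuous_on_subset[OF Cinf_continuous[OF \<psi>D(1)] subset_UNIV]
        continuous_on_subset[OF Cinf_continuous[OF Cinf_partial_deriv[OF \<psi>D(1)]] subset_UNIV])
  moreover have "continuous_on D (\<lambda>x. u' x (axis i 1))
      \<longleftrightarrow> continuous_on D (\<lambda>x. \<phi> x * partial_deriv i \<psi> x + partial_deriv i \<phi> x * \<psi> x)"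
    by (rule continuous_on_cong) (simp_all add: u'_eq zero_ext_def)
  ultimately have "continuous_on D (\<lambda>x. u' x (axis i 1))" by simp
  then have "continuous_on ?S (\<lambda>x. u' x (axis i 1))" using \<psi>D(3) continuous_on_subset by blast
  then obtain B where B: "\<And>x. \<bar>u' x (axis i 1)\<bar> \<le> B"
    using compact_support_bounded[OF \<psi>D(2), of "\<lambda>x. u' x (axis i 1)"] u'_zero by blast
  from integral_partial_deriv_zero[OF der \<psi>D(2) u_zero B]
  have "(LINT x|lborel. zero_ext D \<phi> x * partial_deriv i \<psi> x + zero_ext D (partial_deriv i \<phi>) x * \<psi> x) = 0"
    by (simp add: u'_eq)
  then show "(LINT x|lborel. zero_ext D \<phi> x * partial_deriv i \<psi> x)
      = - (LINT x|lborel. zero_ext D (partial_deriv i \<phi>) x * \<psi> x)"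
    using Bochner_Integration.integral_add[OF integrable_L2_test(2)[OF L2(1) \<psi>] integrable_L2_test(1)[OF L2(2) \<psi>], of i i]
    by simp
qed

end

section \<open>Smooth approximation with controlled gradients\<close>

lemma L2sq_mono:
  assumes "f \<in> L2_supp D" "g \<in> L2_supp D" "\<And>x. \<bar>f x\<bar> \<le> \<bar>g x\<bar>"
  shows "L2sq f \<le> L2sq g"
  unfolding L2sq_def
  by (rule integral_mono[OF L2_supp_sq_integrable[OF assms(1)] L2_supp_sq_integrable[OF assms(2)]])
    (simp add: abs_le_square_iff[symmetric] assms(3))

lemma L2sq_sum:
  assumes f: "\<And>j :: 'n :: finite. f j \<in> L2_supp D"
  shows "L2sq (\<lambda>x. \<Sum>j\<in>UNIV. f j x) \<le> CARD('n) * (\<Sum>j\<in>UNIV. L2sq (f j))"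
proof -
  have "L2sq (\<lambda>x. \<Sum>j\<in>UNIV. f j x) \<le> (LINT x|lborel. (\<Sum>j\<in>UNIV. (f j x)\<^sup>2) * CARD('n))"
    unfolding L2sq_def
  proof (rule integral_mono)
    show "integrable lborel (\<lambda>x. (\<Sum>j\<in>UNIV. f j x)\<^sup>2)"
      by (rule L2_supp_sq_integrable[OF L2_supp_sum[OF f]])
    show "integrable lborel (\<lambda>x. (\<Sum>j\<in>UNIV. (f j x)\<^sup>2) * CARD('n))"
      using L2_supp_sq_integrable[OF f] by simp
    show "(\<Sum>j\<in>UNIV. f j x)\<^sup>2 \<le> (\<Sum>j\<in>UNIV. (f j x)\<^sup>2) * CARD('n)" for x
      by (rule sum_squared_le_sum_of_squares)
  qed
  also have "\<dots> = CARD('n) * (\<Sum>j\<in>UNIV. L2sq (f j))"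
    using L2_supp_sq_integrable[OF f] by (simp add: L2sq_def)
  finally show ?thesis .
qed

lemma norm_grad_sq: "(norm (grad f x))\<^sup>2 = (\<Sum>i\<in>UNIV. (partial_deriv i f x)\<^sup>2)"
  by (simp add: grad_def norm_vec_def L2_set_def real_sqrt_pow2 sum_nonneg)

text \<open>The gradient is dominated by local averages of one integrable function. This is what
  controls the discrete energy close to the boundary, where \<open>\<phi>\<close> has no modulus of continuity.\<close>

definition energy_controlled :: "(real ^ 'n) set \<Rightarrow> (real ^ 'n \<Rightarrow> real) \<Rightarrow> bool" where
  "energy_controlled D \<phi> \<longleftrightarrow> (\<exists>h \<in> borel_measurable borel.
    (\<forall>y. y \<notin> D \<longrightarrow> h y = 0) \<and> (\<integral>\<^sup>+y. h y \<partial>lborel) < \<infinity> \<and>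
    (\<forall>x\<in>D. ennreal ((norm (grad \<phi> x))\<^sup>2) \<le> ennreal ((1 / depth D x) ^ CARD('n)) *
      (\<integral>\<^sup>+y. indicator (cball x (depth D x / 2)) y * h y \<partial>lborel)))"

text \<open>The class from which the sequence is chosen. Square integrability is not listed: it
  follows from boundedness on a set of finite measure for the function, and from
  \<open>energy_controlled\<close> for its gradient.\<close>

definition approximants :: "(real ^ 'n) set \<Rightarrow> (real ^ 'n \<Rightarrow> real) set" where
  "approximants D = {\<phi> \<in> Cinf D. bounded (\<phi> ` D) \<and> energy_controlled D \<phi>}"

text \<open>Lets the control survive the composition with a bounded sine, which does not increase
  the norm of the gradient.\<close>

lemma energy_controlled_mono:
  assumes "energy_controlled D \<phi>" "\<And>x. x \<in> D \<Longrightarrow> norm (grad \<psi> x) \<le> norm (grad \<phi> x)"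
  shows "energy_controlled D \<psi>"
proof -
  obtain h where h: "h \<in> borel_measurable borel" "\<forall>y. y \<notin> D \<longrightarrow> h y = 0" "(\<integral>\<^sup>+y. h y \<partial>lborel) < \<infinity>"
    "\<And>x. x \<in> D \<Longrightarrow> ennreal ((norm (grad \<phi> x))\<^sup>2) \<le> ennreal ((1 / depth D x) ^ CARD('a)) *
      (\<integral>\<^sup>+y. indicator (cball x (depth D x / 2)) y * h y \<partial>lborel)"
    using assms(1) unfolding energy_controlled_def by blast
  have "ennreal ((norm (grad \<psi> x))\<^sup>2) \<le> ennreal ((norm (grad \<phi> x))\<^sup>2)" if "x \<in> D" for x
    by (intro ennreal_leI power_mono assms(2) that) simp
  then have "\<forall>x\<in>D. ennreal ((norm (grad \<psi> x))\<^sup>2) \<le> ennreal ((1 / depth D x) ^ CARD('a)) *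
      (\<integral>\<^sup>+y. indicator (cball x (depth D x / 2)) y * h y \<partial>lborel)"
    using h(4) order_trans by blast
  with h(1-3) show ?thesis unfolding energy_controlled_def by blast
qed

section \<open>Functions in the approximating class\<close>

context finite_domain
begin

lemma continuous_imp_borel_zero_ext:
  assumes "continuous_on D u" shows "zero_ext D u \<in> borel_measurable borel"
proof -
  have "(\<lambda>x. indicator D x *\<^sub>R u x) = zero_ext D u" by (auto simp: zero_ext_def indicator_def fun_eq_iff)
  then show ?thesis using borel_measurable_continuous_on_indicator[OF D_borel assms] by simp
qed

text \<open>An instance of \<open>average_bound\<close> with radius exactly half the depth, so
  \<open>a = b = 1/2\<close>; replacing \<open>1 / depth\<close> by \<open>1 / (depth / 2)\<close>
  only enlarges the weight.\<close>

lemma energy_controlled_L2: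
  assumes \<phi>: "\<phi> \<in> Cinf D" and e: "energy_controlled D \<phi>"
  shows "zero_ext D (partial_deriv i \<phi>) \<in> L2_supp D"
proof -
  obtain h where h: "h \<in> borel_measurable borel" "\<And>y. y \<notin> D \<Longrightarrow> h y = 0" "(\<integral>\<^sup>+y. h y \<partial>lborel) < \<infinity>"
    "\<And>x. x \<in> D \<Longrightarrow> ennreal ((norm (grad \<phi> x))\<^sup>2) \<le> ennreal ((1 / depth D x) ^ CARD('n)) *
      (\<integral>\<^sup>+y. indicator (cball x (depth D x / 2)) y * h y \<partial>lborel)"
    using e unfolding energy_controlled_def by blast
  let ?p = "zero_ext D (partial_deriv i \<phi>)"
  have meas: "?p \<in> borel_measurable borel"
    by (rule continuous_imp_borel_zero_ext[OF Cinf_continuous[OF Cinf_partial_deriv[OF \<phi>]]])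
  have "(\<integral>\<^sup>+x. ennreal ((?p x)\<^sup>2) \<partial>lborel) \<le>
    (\<integral>\<^sup>+x. indicator D x * (ennreal ((1 / (depth D x / 2)) ^ CARD('n)) *
      (\<integral>\<^sup>+y. indicator (cball x (depth D x / 2)) y * h y \<partial>lborel)) \<partial>lborel)"
  proof (rule nn_integral_mono)
    fix x
    show "ennreal ((?p x)\<^sup>2) \<le> indicator D x * (ennreal ((1 / (depth D x / 2)) ^ CARD('n)) *
      (\<integral>\<^sup>+y. indicator (cball x (depth D x / 2)) y * h y \<partial>lborel))"
    proof (cases "x \<in> D")
      case True
      have "(partial_deriv i \<phi> x)\<^sup>2 \<le> (norm (grad \<phi> x))\<^sup>2"
        unfolding norm_grad_sq by (rule member_le_sum) auto
      then have "ennreal ((?p x)\<^sup>2) \<le> ennreal ((norm (grad \<phi> x))\<^sup>2)"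
        using True by (intro ennreal_leI) (simp add: zero_ext_def)
      also have "\<dots> \<le> ennreal ((1 / depth D x) ^ CARD('n)) *
        (\<integral>\<^sup>+y. indicator (cball x (depth D x / 2)) y * h y \<partial>lborel)" by (rule h(4)[OF True])
      also have "\<dots> \<le> ennreal ((1 / (depth D x / 2)) ^ CARD('n)) *
        (\<integral>\<^sup>+y. indicator (cball x (depth D x / 2)) y * h y \<partial>lborel)"
        using depth_pos[OF True] by (intro mult_right_mono ennreal_leI power_mono) (auto simp: divide_right_mono)
      finally show ?thesis using True by simp
    qed (simp add: zero_ext_def)
  qed
  also have "\<dots> \<le> ennreal ((6 * (1/2) / (1/2)) ^ CARD('n)) * (\<integral>\<^sup>+y. h y \<partial>lborel)"
    by (rule average_bound) (auto intro!: continuous_intros h)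
  also have "\<dots> < \<infinity>" using h(3) by (simp add: ennreal_mult_less_top)
  finally have "(\<integral>\<^sup>+x. ennreal ((?p x)\<^sup>2) \<partial>lborel) < \<infinity>" .
  then have "integrable lborel (\<lambda>x. (?p x)\<^sup>2)"
    using meas by (intro integrableI_bounded) auto
  then show ?thesis using meas by (simp add: L2_supp_def zero_ext_def)
qed

lemma bounded_zero_ext_L2:
  assumes \<phi>: "\<phi> \<in> Cinf D" and b: "bounded (\<phi> ` D)"
  shows "zero_ext D \<phi> \<in> L2_supp D"
proof -
  obtain B where "\<And>x. x \<in> D \<Longrightarrow> \<bar>\<phi> x\<bar> \<le> B" using b by (auto simp: bounded_iff)
  then show ?thesis
    using continuous_imp_borel_zero_ext[OF Cinf_continuous[OF \<phi>]]
    by (intro L2_supp_bounded[where B = B]) (auto simp: zero_ext_def)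
qed

lemma approximants_weak_grad_rep:
  assumes "\<phi> \<in> approximants D"
  shows "weak_grad_rep D (zero_ext D \<phi>) (\<lambda>i. zero_ext D (partial_deriv i \<phi>))"
  using assms by (intro smooth_weak_grad_rep bounded_zero_ext_L2 energy_controlled_L2)
    (auto simp: approximants_def)

lemma sin_component_approximant:
  assumes "0 \<le> c" "c \<le> 1"
  shows "(\<lambda>x. sin (x $ i * c)) \<in> approximants D"
proof -
  let ?\<phi> = "\<lambda>x :: real ^ 'n. sin (x $ i * c)" and ?d = "CARD('n)"
  have Cinf: "?\<phi> \<in> Cinf D"
    by (intro CinfI conjunct1[OF Ck_on_sin_cos] Ck_on_mult Ck_on_component Ck_on_const open_D)
  have bdd: "bounded (?\<phi> ` D)" by (rule boundedI[of _ 1]) auto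
  have grad_le: "norm (grad ?\<phi> x) \<le> 1" for x
  proof -
    have "(?\<phi> has_derivative (\<lambda>v. cos (x $ i * c) * (v $ i * c))) (at x)"
      by (auto intro!: derivative_eq_intros bounded_linear_imp_has_derivative bounded_linear_vec_nth)
    then have p: "partial_deriv j ?\<phi> x = cos (x $ i * c) * (axis j 1 $ i * c)" for j
      by (rule partial_deriv_eq)
    have "(\<Sum>j\<in>UNIV. \<bar>partial_deriv j ?\<phi> x\<bar>) = (\<Sum>j\<in>UNIV. if j = i then \<bar>cos (x $ i * c) * c\<bar> else 0)"
      unfolding p by (intro sum.cong) (auto simp: axis_def)
    also have "\<dots> = \<bar>cos (x $ i * c)\<bar> * c" using assms by (simp add: abs_mult)
    also have "\<dots> \<le> 1 * 1" using assms by (intro mult_mono) auto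
    finally show ?thesis using norm_grad_le_sum[of ?\<phi> x] by simp
  qed
  \<comment> \<open>The gradient is at most 1, so a constant on \<open>D\<close> suffices. The ball
    of radius \<open>m / 2\<close> contains a cube of edge \<open>m / real ?d\<close>, and the
    factor \<open>real ?d ^ ?d\<close> brings its volume up to \<open>m ^ ?d\<close>.\<close>
  define h where "h y = ennreal (real ?d ^ ?d) * indicator D y" for y
  have "energy_controlled D ?\<phi>"
    unfolding energy_controlled_def
  proof (intro bexI[of _ h] conjI allI impI ballI)
    show "h \<in> borel_measurable borel" unfolding h_def[abs_def] by measurable
    show "(\<integral>\<^sup>+y. h y \<partial>lborel) < \<infinity>"
      unfolding h_def[abs_def] using finite_D by (subst nn_integral_cmult_indicator) (auto simp: ennreal_mult_less_top)
    fix x assume x: "x \<in> D"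
    define m where "m = depth D x"
    have m: "m > 0" using depth_pos[OF x] by (simp add: m_def)
    define R where "R = m / (2 * real ?d)"
    have R: "R > 0" using m by (simp add: R_def)
    let ?Q = "cbox (\<chi> i. x $ i - R) (\<chi> i. x $ i + R)"
    have sub: "?Q \<subseteq> cball x (m / 2)"
    proof
      fix y assume "y \<in> ?Q"
      then have "\<bar>(y - x) $ j\<bar> \<le> R" for j
        by (auto simp: mem_box_cart abs_le_iff) (smt (verit))+
      then have "(\<Sum>j\<in>UNIV. \<bar>(y - x) $ j\<bar>) \<le> (\<Sum>j\<in>(UNIV :: 'n set). R)" by (intro sum_mono)
      then have "norm (y - x) \<le> real ?d * R" using norm_le_l1_cart[of "y - x"] by simp
      also have "real ?d * R = m / 2" by (simp add: R_def)
      finally show "y \<in> cball x (m / 2)" by (simp add: dist_norm norm_minus_commute[of x])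
    qed
    have subD: "cball x (m / 2) \<subseteq> D"
      using depth_ball_subset[of x _ D] m by (auto simp: m_def)
    have "ennreal ((norm (grad ?\<phi> x))\<^sup>2) \<le> 1"
      using power_mono[OF grad_le[of x], of 2] by simp
    also have "1 = ennreal ((1 / m) ^ ?d * (real ?d ^ ?d * (2 * R) ^ ?d))"
    proof -
      have "1 / m * (real ?d * (2 * R)) = 1" using m by (simp add: R_def)
      then have "(1 / m) ^ ?d * (real ?d ^ ?d * (2 * R) ^ ?d) = 1"
        by (simp only: power_mult_distrib[symmetric] power_one)
      then show ?thesis by simp
    qed
    also have "\<dots> = ennreal ((1 / m) ^ ?d) * (ennreal (real ?d ^ ?d) * emeasure lborel ?Q)"
      unfolding emeasure_cube[OF less_imp_le[OF R]] using m R
      by (simp only: ennreal_mult'' ennreal_mult zero_le_power less_imp_le of_nat_0_le_iff mult_nonneg_nonneg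
          divide_nonneg_nonneg zero_le_one zero_le_numeral)
    also have "ennreal (real ?d ^ ?d) * emeasure lborel ?Q = (\<integral>\<^sup>+y. ennreal (real ?d ^ ?d) * indicator ?Q y \<partial>lborel)"
      by (rule nn_integral_cmult_indicator[symmetric]) simp
    also have "\<dots> \<le> (\<integral>\<^sup>+y. indicator (cball x (m / 2)) y * h y \<partial>lborel)"
      using sub subD by (intro nn_integral_mono) (auto simp: h_def indicator_def)
    finally show "ennreal ((norm (grad ?\<phi> x))\<^sup>2) \<le> ennreal ((1 / depth D x) ^ ?d) *
        (\<integral>\<^sup>+y. indicator (cball x (depth D x / 2)) y * h y \<partial>lborel)"
      by (simp add: m_def mult_left_mono)
  qed (simp add: h_def)
  with Cinf bdd show ?thesis by (simp add: approximants_def)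
qed

end

section \<open>Gradients of averages and density\<close>

context mollification
begin

text \<open>Integration by parts with the reflected scaled kernel as test function, which is
  admissible because the averaging ball lies in \<open>D\<close>.\<close>

lemma kernel_int_weak_grad:
  assumes rep: "weak_grad_rep D f G" and Q: "Q \<in> unit_kernels" and x: "x \<in> D"
  shows "inv_rad n x * kernel_int (partial_deriv j Q) (inv_rad n) f x = kernel_int Q (inv_rad n) (G j) x"
proof -
  let ?s = "inv_rad n x"
  have test: "(\<lambda>y. Q (?s *\<^sub>R (x - y))) \<in> test_functions D"
    by (rule unit_kernels_test_function[OF Q inv_rad_pos[OF x] rad_cball_subset[OF x]])
  have "(LINT y|lborel. f y * partial_deriv j (\<lambda>y. Q (?s *\<^sub>R (x - y))) y)
      = - (LINT y|lborel. G j y * Q (?s *\<^sub>R (x - y)))"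
    using rep test unfolding weak_grad_rep_def by blast
  moreover have "f y * partial_deriv j (\<lambda>y. Q (?s *\<^sub>R (x - y))) y
      = (- ?s) * (f y * partial_deriv j Q (?s *\<^sub>R (x - y)))" for y
    unfolding partial_deriv_affine[OF Cinf_differentiable[OF unit_kernels_Cinf[OF Q]]] by (simp add: mult_ac)
  ultimately have "(LINT y|lborel. (- ?s) * (f y * partial_deriv j Q (?s *\<^sub>R (x - y))))
      = - (LINT y|lborel. G j y * Q (?s *\<^sub>R (x - y)))" by simp
  then show ?thesis unfolding kernel_int_def by simp
qed

abbreviation \<rho>w :: "'n \<Rightarrow> real ^ 'n \<Rightarrow> real" where "\<rho>w j \<equiv> (\<lambda>w. w $ j * \<rho> w)"

text \<open>With the radius r = \<open>1 / inv_rad n x\<close>, the average is the integral of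
  \<open>\<rho> w\<close> times f(x - r w). Formal differentiation gives the average of the
  \<open>i\<close>-th derivative minus the derivative of r times the averages of the
  \<open>j\<close>-th derivatives with weights \<open>w $ j\<close>. The proof obtains this for weak
  derivatives by differentiating the kernel.\<close>

lemma moll_partial_deriv:
  assumes rep: "weak_grad_rep D f G" and x: "x \<in> D"
  shows "partial_deriv i (moll \<rho> n f) x = moll \<rho> n (G i) x
    - partial_deriv i \<eta> x / (real n + 7) * (\<Sum>j\<in>UNIV. moll (\<rho>w j) n (G j) x)"
proof -
  have f: "f \<in> L2_supp D" using rep by (simp add: weak_grad_rep_def)
  note fi = L2_supp_integrable[OF f]
  define s where "s = inv_rad n x"
  define K where "K P g = kernel_int P (inv_rad n) g x" for P g
  define ds where "ds = partial_deriv i (inv_rad n) x"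
  have s: "s > 0" using inv_rad_pos[OF x] by (simp add: s_def)
  note d\<sigma> = Cinf_has_derivative[OF open_D inv_rad_Cinf[of n] x]
  \<comment> \<open>The product rule rewrites the kernel as
    \<open>partial_deriv j (\<rho>w j)\<close> minus \<open>\<rho>\<close>, so that the first part
    can be integrated by parts.\<close>
  have Kj: "K (\<lambda>w. w $ j * partial_deriv j \<rho> w) f = K (\<rho>w j) (G j) / s - K \<rho> f" for j
  proof -
    have d: "(\<rho>w j has_derivative (\<lambda>v. w $ j * frechet_derivative \<rho> (at w) v + v $ j * \<rho> w)) (at w)" for w
      by (rule has_derivative_mult[OF bounded_linear_imp_has_derivative[OF bounded_linear_vec_nth]
            Cinf_has_derivative[OF open_UNIV unit_kernels_Cinf[OF \<rho>(1)] UNIV_I]])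
    have "partial_deriv j (\<rho>w j) w = w $ j * partial_deriv j \<rho> w + \<rho> w" for w
      using partial_deriv_eq[OF d] by (simp add: partial_deriv_def)
    then have "partial_deriv j (\<rho>w j) = (\<lambda>w. w $ j * partial_deriv j \<rho> w + \<rho> w)" by (rule ext)
    then have "K (partial_deriv j (\<rho>w j)) f = K (\<lambda>w. w $ j * partial_deriv j \<rho> w) f + K \<rho> f"
      unfolding K_def kernel_int_def
      using Bochner_Integration.integral_add[OF integrable_kernel_int[OF unit_kernels_component[OF
        unit_kernels_partial_deriv[OF \<rho>(1)]] fi] integrable_kernel_int[OF \<rho>(1) fi]]
      by (simp add: distrib_left)
    moreover have "s * K (partial_deriv j (\<rho>w j)) f = K (\<rho>w j) (G j)"
      unfolding s_def K_def by (rule kernel_int_weak_grad[OF rep unit_kernels_component[OF \<rho>(1)] x])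
    ultimately show ?thesis using s by (simp add: field_simps)
  qed
  have Ki: "s * K (partial_deriv i \<rho>) f = K \<rho> (G i)"
    unfolding s_def K_def by (rule kernel_int_weak_grad[OF rep \<rho>(1) x])
  define S where "S = (\<Sum>j\<in>UNIV. K (\<rho>w j) (G j))"
  have dK: "partial_deriv i (kernel_int \<rho> (inv_rad n) f) x = K \<rho> (G i) + ds / s * (S / s - CARD('n) * K \<rho> f)"
    using kernel_int_partial_deriv[OF \<rho>(1) fi d\<sigma> inv_rad_pos[OF x], of i] Ki Kj
    unfolding K_def[symmetric] s_def[symmetric]
    by (simp add: ds_def partial_deriv_def[of i "inv_rad n"] sum_subtractf S_def sum_divide_distrib)
  have hK: "(kernel_int \<rho> (inv_rad n) f has_derivative
      frechet_derivative (kernel_int \<rho> (inv_rad n) f) (at x)) (at x)"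
    using has_derivative_kernel_int[OF \<rho>(1) fi d\<sigma> inv_rad_pos[OF x]]
    by (auto simp: frechet_derivative_works[symmetric] differentiable_def)
  have "partial_deriv i (moll \<rho> n f) x
      = partial_deriv i (\<lambda>x. inv_rad n x ^ CARD('n) * kernel_int \<rho> (inv_rad n) f x) x"
    by (rule partial_deriv_cong_open[OF open_D x]) (simp add: moll_def)
  also have "\<dots> = s ^ CARD('n) * partial_deriv i (kernel_int \<rho> (inv_rad n) f) x
      + CARD('n) * ds * s ^ (CARD('n) - 1) * K \<rho> f"
    using partial_deriv_eq[OF has_derivative_mult[OF has_derivative_power[OF d\<sigma>] hK]]
    by (simp add: partial_deriv_def ds_def s_def K_def)
  also have "s ^ (CARD('n) - 1) = s ^ CARD('n) / s" using s by (simp add: power_diff)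
  \<comment> \<open>One copy of \<open>K \<rho> f\<close> for each coordinate cancels against the
    derivative of the normalising power of the scale.\<close>
  also have "s ^ CARD('n) * partial_deriv i (kernel_int \<rho> (inv_rad n) f) x
      + CARD('n) * ds * (s ^ CARD('n) / s) * K \<rho> f
      = s ^ CARD('n) * K \<rho> (G i) + (ds / s\<^sup>2) * (s ^ CARD('n) * S)"
    unfolding dK using s by (simp add: field_simps power2_eq_square)
  \<comment> \<open>The left side is minus the derivative of the radius
    \<open>1 / inv_rad n\<close>, that is, of \<open>\<eta> / (real n + 7)\<close>.\<close>
  also have "ds / s\<^sup>2 = - (partial_deriv i \<eta> x / (real n + 7))"
  proof -
    have d\<eta>: "(\<eta> has_derivative frechet_derivative \<eta> (at x)) (at x)"
      by (rule Cinf_has_derivative[OF open_D \<eta>_Cinf x])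
    have e: "\<eta> x > 0" by (rule \<eta>_pos[OF x])
    have "(inv_rad n has_derivative (\<lambda>v. (real n + 7) *
        (- (inverse (\<eta> x) * frechet_derivative \<eta> (at x) v * inverse (\<eta> x))))) (at x)"
      unfolding inv_rad_def[abs_def]
      by (rule has_derivative_mult_right[OF Deriv.has_derivative_inverse[OF _ d\<eta>]]) (use e in simp)
    from partial_deriv_eq[OF this]
    have "ds = (real n + 7) * (- (inverse (\<eta> x) * partial_deriv i \<eta> x * inverse (\<eta> x)))"
      by (simp add: ds_def partial_deriv_def)
    moreover have "s = (real n + 7) / \<eta> x" by (simp add: s_def inv_rad_def divide_inverse)
    moreover have "N * (- (inverse e * t * inverse e)) / (N / e)\<^sup>2 = - (t / N)" if "N > 0" "e > 0" for N e t :: real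
      using that by (simp add: field_simps power2_eq_square)
    ultimately show ?thesis using e by simp
  qed
  finally have calc: "partial_deriv i (moll \<rho> n f) x = s ^ CARD('n) * K \<rho> (G i)
      + - (partial_deriv i \<eta> x / (real n + 7)) * (s ^ CARD('n) * S)" .
  have eval: "moll Q n g x = s ^ CARD('n) * K Q g" for Q g
    using x by (simp add: moll_def K_def s_def)
  have "(\<Sum>j\<in>UNIV. moll (\<rho>w j) n (G j) x) = s ^ CARD('n) * S"
    by (simp add: eval S_def sum_distrib_left)
  then show ?thesis unfolding calc eval[of \<rho> "G i"] by simp
qed

text \<open>The main term converges by \<open>moll_tendsto\<close>. The correction is a function
  bounded in L2 uniformly in \<open>n\<close>, times a factor of order
  \<open>1 / (real n + 7)\<close>.\<close>

lemma moll_grad_tendsto: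
  assumes rep: "weak_grad_rep D f G"
  shows "zero_ext D (partial_deriv i (moll \<rho> n f)) \<in> L2_supp D"
    and "(\<lambda>n. L2sq (\<lambda>x. zero_ext D (partial_deriv i (moll \<rho> n f)) x - G i x)) \<longlonglongrightarrow> 0"
proof -
  have G: "\<And>j. G j \<in> L2_supp D" using rep by (simp add: weak_grad_rep_def)
  obtain K0 where K0: "\<And>n g. g \<in> L2_supp D \<Longrightarrow> moll \<rho> n g \<in> L2_supp D"
    using moll_L2_bound[OF \<rho>(1)] by blast
  have "\<exists>K. \<forall>n g. g \<in> L2_supp D \<longrightarrow> moll (\<rho>w j) n g \<in> L2_supp D \<and> L2sq (moll (\<rho>w j) n g) \<le> K * L2sq g" for j
  proof (rule moll_L2_bound[OF unit_kernels_component[OF \<rho>(1), of j]])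
    fix K assume "\<And>n g. g \<in> L2_supp D \<Longrightarrow> moll (\<rho>w j) n g \<in> L2_supp D"
      "\<And>n g. g \<in> L2_supp D \<Longrightarrow> L2sq (moll (\<rho>w j) n g) \<le> K * L2sq g"
    then show "\<exists>K. \<forall>n g. g \<in> L2_supp D \<longrightarrow> moll (\<rho>w j) n g \<in> L2_supp D \<and> L2sq (moll (\<rho>w j) n g) \<le> K * L2sq g"
      by (intro exI[of _ K]) simp
  qed
  then have "\<forall>j. \<exists>K. \<forall>n g. g \<in> L2_supp D \<longrightarrow> moll (\<rho>w j) n g \<in> L2_supp D \<and> L2sq (moll (\<rho>w j) n g) \<le> K * L2sq g"
    by (rule allI)
  from choice[OF this] obtain K where K: "\<And>j n g. g \<in> L2_supp D \<Longrightarrow> moll (\<rho>w j) n g \<in> L2_supp D"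
    "\<And>j n g. g \<in> L2_supp D \<Longrightarrow> L2sq (moll (\<rho>w j) n g) \<le> K j * L2sq g" by blast
  define S where "S n x = (\<Sum>j\<in>UNIV. moll (\<rho>w j) n (G j) x)" for n x
  define M where "M = CARD('n) * (\<Sum>j\<in>UNIV. K j * L2sq (G j))"
  have S: "S n \<in> L2_supp D" for n
    unfolding S_def[abs_def] by (intro L2_supp_sum K G)
  have S_le: "L2sq (S n) \<le> M" for n
  proof -
    have "L2sq (S n) \<le> CARD('n) * (\<Sum>j\<in>UNIV. L2sq (moll (\<rho>w j) n (G j)))"
      unfolding S_def[abs_def] by (rule L2sq_sum[where D = D]) (intro K G)
    also have "\<dots> \<le> M" unfolding M_def by (intro mult_left_mono sum_mono K G) simp
    finally show ?thesis .
  qed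
  define c where "c n = \<bar>C\<bar> * inverse (real (n + 7))" for n
  define P where "P n = zero_ext D (\<lambda>x. - (partial_deriv i \<eta> x / (real n + 7) * S n x))" for n
  have P_le: "\<bar>P n x\<bar> \<le> \<bar>c n * S n x\<bar>" for n x
  proof (cases "x \<in> D")
    case True
    have "\<bar>partial_deriv i \<eta> x / (real n + 7)\<bar> \<le> c n"
      using \<eta>_grad[OF True, of i] by (simp add: c_def divide_inverse add_ac abs_mult mult_right_mono)
    then have "\<bar>partial_deriv i \<eta> x / (real n + 7)\<bar> * \<bar>S n x\<bar> \<le> c n * \<bar>S n x\<bar>" by (rule mult_right_mono) simp
    then show ?thesis using True by (simp add: P_def zero_ext_def abs_mult c_def)
  qed (simp add: P_def zero_ext_def)
  have contS: "continuous_on D (S n)" for n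
    unfolding S_def[abs_def]
    by (intro continuous_on_sum Cinf_continuous moll_Cinf unit_kernels_component \<rho>(1) G)
  have P_meas: "P n \<in> borel_measurable borel" for n
    unfolding P_def
    by (intro continuous_imp_borel_zero_ext continuous_on_minus continuous_on_mult continuous_on_divide
        continuous_on_const contS Cinf_continuous[OF Cinf_partial_deriv[OF \<eta>_Cinf]])
      (auto simp: add_nonneg_eq_0_iff)
  have P: "P n \<in> L2_supp D" for n
    by (rule L2_supp_dominated[OF L2_supp_cmult[OF S] P_meas P_le])
  have P_lim: "(\<lambda>n. L2sq (P n)) \<longlonglongrightarrow> 0"
  proof (rule tendsto_sandwich[OF always_eventually always_eventually tendsto_const])
    show "\<forall>n. L2sq (P n) \<le> (c n)\<^sup>2 * M"
    proof
      fix n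
      have "L2sq (P n) \<le> (c n)\<^sup>2 * L2sq (S n)"
        using L2sq_mono[OF P L2_supp_cmult[OF S] P_le] by (simp add: L2sq_cmult)
      also have "\<dots> \<le> (c n)\<^sup>2 * M" by (intro mult_left_mono S_le) simp
      finally show "L2sq (P n) \<le> (c n)\<^sup>2 * M" .
    qed
    have "c \<longlonglongrightarrow> \<bar>C\<bar> * 0"
      unfolding c_def[abs_def] by (intro tendsto_mult_left LIMSEQ_ignore_initial_segment lim_inverse_n)
    then have "(\<lambda>n. (c n)\<^sup>2 * M) \<longlonglongrightarrow> (\<bar>C\<bar> * 0)\<^sup>2 * M" by (intro tendsto_intros)
    then show "(\<lambda>n. (c n)\<^sup>2 * M) \<longlonglongrightarrow> 0" by simp
  qed (simp add: L2sq_nonneg)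
  have eq: "zero_ext D (partial_deriv i (moll \<rho> n f)) = (\<lambda>x. moll \<rho> n (G i) x + P n x)" for n
    using moll_partial_deriv[OF rep] by (auto simp: fun_eq_iff zero_ext_def P_def S_def moll_def)
  show "zero_ext D (partial_deriv i (moll \<rho> n f)) \<in> L2_supp D"
    unfolding eq by (rule L2_supp_add[OF K0[OF G] P])
  show "(\<lambda>n. L2sq (\<lambda>x. zero_ext D (partial_deriv i (moll \<rho> n f)) x - G i x)) \<longlonglongrightarrow> 0"
  proof (rule tendsto_sandwich[OF always_eventually always_eventually tendsto_const])
    show "\<forall>n. L2sq (\<lambda>x. zero_ext D (partial_deriv i (moll \<rho> n f)) x - G i x)
        \<le> 2 * L2sq (\<lambda>x. moll \<rho> n (G i) x - G i x) + 2 * L2sq (P n)"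
    proof
      fix n
      have "(\<lambda>x. zero_ext D (partial_deriv i (moll \<rho> n f)) x - G i x) = (\<lambda>x. (moll \<rho> n (G i) x - G i x) + P n x)"
        unfolding eq by auto
      then show "L2sq (\<lambda>x. zero_ext D (partial_deriv i (moll \<rho> n f)) x - G i x)
        \<le> 2 * L2sq (\<lambda>x. moll \<rho> n (G i) x - G i x) + 2 * L2sq (P n)"
        using L2sq_add[OF L2_supp_diff[OF K0[OF G] G] P] by simp
    qed
    show "(\<lambda>n. 2 * L2sq (\<lambda>x. moll \<rho> n (G i) x - G i x) + 2 * L2sq (P n)) \<longlonglongrightarrow> 0"
      using tendsto_add[OF tendsto_mult_left[OF moll_tendsto[OF G], of 2] tendsto_mult_left[OF P_lim, of 2]] by simp
  qed (simp add: L2sq_nonneg)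
qed

text \<open>Here \<open>n\<close> is fixed and \<open>A\<close> may depend on it: the averaging
  radius is at least \<open>depth D x / a\<close>, so normalising by the depth costs
  \<open>a ^ CARD('n)\<close>. The majorant \<open>H\<close> is a parameter so that one function can
  serve all components of a gradient.\<close>

lemma moll_sq_local_bound:
  assumes Q: "Q \<in> unit_kernels"
  obtains A where "A \<ge> 0" "\<And>g H x. g \<in> L2_supp D \<Longrightarrow> (\<And>y. ennreal ((g y)\<^sup>2) \<le> H y) \<Longrightarrow> x \<in> D \<Longrightarrow>
    ennreal ((moll Q n g x)\<^sup>2) \<le> ennreal A * (ennreal ((1 / depth D x) ^ CARD('n)) *
      (\<integral>\<^sup>+y. indicator (cball x (depth D x / 2)) y * H y \<partial>lborel))"
proof -
  obtain B where B: "B > 0" "\<And>w. \<bar>Q w\<bar> \<le> B" using unit_kernels_bounded[OF Q] by blast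
  define a where "a = 5 * (real n + 7) / 4"
  define A where "A = 2 ^ CARD('n) * B\<^sup>2 * a ^ CARD('n)"
  have a: "a \<ge> 0" by (simp add: a_def)
  show thesis
  proof (rule that[of A])
    show "A \<ge> 0" using a by (simp add: A_def)
    fix g x and H :: "real ^ 'n \<Rightarrow> ennreal"
    assume g: "g \<in> L2_supp D" and H: "\<And>y. ennreal ((g y)\<^sup>2) \<le> H y" and x: "x \<in> D"
    let ?I = "\<integral>\<^sup>+y. indicator (cball x (1 / inv_rad n x)) y * ennreal ((g y)\<^sup>2) \<partial>lborel"
    let ?J = "\<integral>\<^sup>+y. indicator (cball x (depth D x / 2)) y * H y \<partial>lborel"
    have m: "depth D x > 0" by (rule depth_pos[OF x])
    have s: "inv_rad n x > 0" by (rule inv_rad_pos[OF x])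
    have IJ: "?I \<le> ?J"
      using rad_le_half_depth[OF x, of n] H by (intro nn_integral_mono mult_mono) (auto simp: indicator_def)
    have "inv_rad n x \<le> a * (1 / depth D x)"
      using rad_bounds(1)[OF x, of n] m s by (simp add: a_def field_simps)
    then have pow: "inv_rad n x ^ CARD('n) \<le> a ^ CARD('n) * (1 / depth D x) ^ CARD('n)"
      using power_mono[of "inv_rad n x" "a * (1 / depth D x)" "CARD('n)"] s by (simp only: power_mult_distrib less_imp_le)
    have "ennreal ((moll Q n g x)\<^sup>2) \<le> ennreal (2 ^ CARD('n) * B\<^sup>2) * (ennreal (inv_rad n x ^ CARD('n)) * ?I)"
      using kernel_int_sq_bound[where \<sigma> = "inv_rad n" and x = x, OF Q B(2) L2_supp_integrable[OF g] s] x
      by (simp add: moll_def)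
    also have "\<dots> \<le> ennreal (2 ^ CARD('n) * B\<^sup>2) *
        (ennreal (a ^ CARD('n) * (1 / depth D x) ^ CARD('n)) * ?J)"
      by (intro mult_left_mono mult_mono IJ ennreal_leI pow) auto
    also have "ennreal (a ^ CARD('n) * (1 / depth D x) ^ CARD('n)) = ennreal (a ^ CARD('n)) * ennreal ((1 / depth D x) ^ CARD('n))"
      using a m by (intro ennreal_mult) auto
    also have "ennreal (2 ^ CARD('n) * B\<^sup>2) * (ennreal (a ^ CARD('n)) * ennreal ((1 / depth D x) ^ CARD('n)) * ?J)
        = ennreal A * (ennreal ((1 / depth D x) ^ CARD('n)) * ?J)"
    proof -
      have "ennreal A = ennreal (2 ^ CARD('n) * B\<^sup>2) * ennreal (a ^ CARD('n))"
        unfolding A_def using a by (intro ennreal_mult) auto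
      then show ?thesis by (simp only: mult.assoc)
    qed
    finally show "ennreal ((moll Q n g x)\<^sup>2) \<le> ennreal A * (ennreal ((1 / depth D x) ^ CARD('n)) * ?J)" .
  qed
qed

text \<open>By \<open>moll_partial_deriv\<close> the gradient consists of averages of the weak
  gradient, whose squares are all bounded by local integrals of the single function
  \<open>H\<close>, the squared norm of that gradient.\<close>

lemma moll_energy_controlled:
  assumes rep: "weak_grad_rep D f G"
  shows "energy_controlled D (moll \<rho> n f)"
proof -
  have G: "\<And>j. G j \<in> L2_supp D" using rep by (simp add: weak_grad_rep_def)
  define H where "H y = ennreal (\<Sum>j\<in>UNIV. (G j y)\<^sup>2)" for y
  have GH: "ennreal ((G j y)\<^sup>2) \<le> H y" for j y
    unfolding H_def by (intro ennreal_leI member_le_sum) auto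
  have H_meas [measurable]: "H \<in> borel_measurable borel"
    unfolding H_def[abs_def] using L2_supp_measurable[OF G] by measurable
  define I where "I x = ennreal ((1 / depth D x) ^ CARD('n)) *
      (\<integral>\<^sup>+y. indicator (cball x (depth D x / 2)) y * H y \<partial>lborel)" for x
  have loc: "\<exists>A. A \<ge> 0 \<and> (\<forall>j. \<forall>x\<in>D. ennreal ((moll Q n (G j) x)\<^sup>2) \<le> ennreal A * I x)"
    if Q: "Q \<in> unit_kernels" for Q
  proof (rule moll_sq_local_bound[OF Q, of n])
    fix A :: real assume A: "A \<ge> 0" "\<And>g H x. g \<in> L2_supp D \<Longrightarrow> (\<And>y. ennreal ((g y)\<^sup>2) \<le> H y) \<Longrightarrow> x \<in> D \<Longrightarrow>
      ennreal ((moll Q n g x)\<^sup>2) \<le> ennreal A * (ennreal ((1 / depth D x) ^ CARD('n)) *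
        (\<integral>\<^sup>+y. indicator (cball x (depth D x / 2)) y * H y \<partial>lborel))"
    show "\<exists>A. A \<ge> 0 \<and> (\<forall>j. \<forall>x\<in>D. ennreal ((moll Q n (G j) x)\<^sup>2) \<le> ennreal A * I x)" unfolding I_def
      by (intro exI[of _ A] conjI A(1) allI ballI A(2)[OF G GH])
  qed
  obtain A where A: "A \<ge> 0" "\<And>j x. x \<in> D \<Longrightarrow> ennreal ((moll \<rho> n (G j) x)\<^sup>2) \<le> ennreal A * I x"
    using loc[OF \<rho>(1)] by blast
  have "\<forall>j. \<exists>A. A \<ge> 0 \<and> (\<forall>x\<in>D. ennreal ((moll (\<rho>w j) n (G j) x)\<^sup>2) \<le> ennreal A * I x)"
    using loc[OF unit_kernels_component[OF \<rho>(1)]] by blast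
  from choice[OF this] obtain B where B: "\<And>j. B j \<ge> 0"
    "\<And>j x. x \<in> D \<Longrightarrow> ennreal ((moll (\<rho>w j) n (G j) x)\<^sup>2) \<le> ennreal (B j) * I x" by blast
  let ?d = "CARD('n)"
  define c where "c = \<bar>C\<bar>"
  \<comment> \<open>The summand 1 makes \<open>K\<close> positive, so that
    \<open>ennreal K * I x\<close> is infinite whenever \<open>I x\<close> is.\<close>
  define K where "K = ?d * (2 * A + 2 * c\<^sup>2 * (?d * (\<Sum>j\<in>UNIV. B j))) + 1"
  have K: "K > 0"
    using A(1) B(1) by (simp add: K_def add_nonneg_pos sum_nonneg)
  have main: "ennreal ((norm (grad (moll \<rho> n f) x))\<^sup>2) \<le> ennreal K * I x" if x: "x \<in> D" for x
  proof (cases "I x")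
    case (real r)
    have a: "(moll \<rho> n (G i) x)\<^sup>2 \<le> A * r" for i
      using A(2)[OF x, of i] A(1) real by (simp add: ennreal_mult'[symmetric] ennreal_le_iff)
    have b: "(moll (\<rho>w j) n (G j) x)\<^sup>2 \<le> B j * r" for j
      using B(2)[OF x, of j] B(1)[of j] real by (simp add: ennreal_mult'[symmetric] ennreal_le_iff)
    have p: "(partial_deriv i (moll \<rho> n f) x)\<^sup>2 \<le> 2 * (A * r) + 2 * (c\<^sup>2 * (?d * (\<Sum>j\<in>UNIV. B j * r)))" for i
    proof -
      let ?t = "partial_deriv i \<eta> x / (real n + 7)" and ?S = "\<Sum>j\<in>UNIV. moll (\<rho>w j) n (G j) x"
      have "\<bar>?t\<bar> \<le> \<bar>partial_deriv i \<eta> x\<bar> / 1" unfolding abs_divide by (intro divide_left_mono) auto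
      also have "\<dots> \<le> \<bar>c\<bar>" using \<eta>_grad[OF x, of i] by (simp add: c_def)
      finally have "\<bar>?t\<bar> \<le> \<bar>c\<bar>" .
      then have t: "?t\<^sup>2 \<le> c\<^sup>2" by (simp only: abs_le_square_iff)
      have "?S\<^sup>2 \<le> (\<Sum>j\<in>UNIV. (moll (\<rho>w j) n (G j) x)\<^sup>2) * ?d" by (rule sum_squared_le_sum_of_squares)
      also have "\<dots> \<le> (\<Sum>j\<in>UNIV. B j * r) * ?d" by (intro mult_right_mono sum_mono b) simp
      finally have "(?t * ?S)\<^sup>2 \<le> c\<^sup>2 * (?d * (\<Sum>j\<in>UNIV. B j * r))"
        unfolding power_mult_distrib by (intro mult_mono t) (auto simp: mult.commute)
      moreover have "(partial_deriv i (moll \<rho> n f) x)\<^sup>2 \<le> 2 * (moll \<rho> n (G i) x)\<^sup>2 + 2 * (?t * ?S)\<^sup>2"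
        unfolding moll_partial_deriv[OF rep x] using sum_sq_le[of "moll \<rho> n (G i) x" "- (?t * ?S)"] by simp
      ultimately show ?thesis using a[of i] by linarith
    qed
    have "(norm (grad (moll \<rho> n f) x))\<^sup>2 \<le> ?d * (2 * (A * r) + 2 * (c\<^sup>2 * (?d * (\<Sum>j\<in>UNIV. B j * r))))"
    proof -
      have "(\<Sum>i\<in>UNIV. (partial_deriv i (moll \<rho> n f) x)\<^sup>2)
          \<le> (\<Sum>i\<in>(UNIV :: 'n set). 2 * (A * r) + 2 * (c\<^sup>2 * (?d * (\<Sum>j\<in>UNIV. B j * r))))"
        by (intro sum_mono p)
      then show ?thesis by (simp only: norm_grad_sq sum_constant)
    qed
    also have "\<dots> = (K - 1) * r" unfolding K_def sum_distrib_right[symmetric] by (simp add: algebra_simps)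
    also have "\<dots> \<le> K * r" using real by (simp add: algebra_simps)
    finally show ?thesis using real K by (simp add: ennreal_mult'[symmetric] ennreal_leI)
  next
    case top
    then show ?thesis using K by (simp add: ennreal_mult_top)
  qed
  show ?thesis
    unfolding energy_controlled_def
  proof (intro bexI[of _ "\<lambda>y. ennreal K * H y"] conjI allI impI ballI)
    show "ennreal K * H y = 0" if "y \<notin> D" for y using L2_supp_zero[OF G that] by (simp add: H_def)
    have "integrable lborel (\<lambda>y. \<Sum>j\<in>UNIV. (G j y)\<^sup>2)" using L2_supp_sq_integrable[OF G] by simp
    then have "(\<integral>\<^sup>+y. H y \<partial>lborel) < \<infinity>"
      unfolding H_def by (simp add: nn_integral_eq_integral sum_nonneg)
    then show "(\<integral>\<^sup>+y. ennreal K * H y \<partial>lborel) < \<infinity>"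
      by (subst nn_integral_cmult) (auto simp: ennreal_mult_less_top)
    fix x assume x: "x \<in> D"
    have [measurable]: "cball x (depth D x / 2) \<in> sets borel" by simp
    have "ennreal K * I x = ennreal ((1 / depth D x) ^ ?d) *
        (\<integral>\<^sup>+y. ennreal K * (indicator (cball x (depth D x / 2)) y * H y) \<partial>lborel)"
      unfolding I_def by (subst nn_integral_cmult) (auto simp: mult.left_commute)
    then show "ennreal ((norm (grad (moll \<rho> n f) x))\<^sup>2) \<le> ennreal ((1 / depth D x) ^ ?d) *
        (\<integral>\<^sup>+y. indicator (cball x (depth D x / 2)) y * (ennreal K * H y) \<partial>lborel)"
      using main[OF x] by (simp add: mult.left_commute)
  qed measurable
qed

text \<open>Composing with \<open>v \<mapsto> M sin (v / M)\<close> makes a smooth function bounded without increasing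
  its gradient, so no chain rule for truncations of weakly differentiable functions is needed.\<close>

lemma approximants_dense:
  assumes rep: "weak_grad_rep D f G" and "e > 0"
  shows "\<exists>\<phi>\<in>approximants D. L2sq (\<lambda>x. zero_ext D \<phi> x - f x)
    + (\<Sum>i\<in>UNIV. L2sq (\<lambda>x. zero_ext D (partial_deriv i \<phi>) x - G i x)) < e"
proof -
  have f: "f \<in> L2_supp D" and G: "\<And>j. G j \<in> L2_supp D" using rep by (auto simp: weak_grad_rep_def)
  have "(\<lambda>n. L2sq (\<lambda>x. moll \<rho> n f x - f x)
      + (\<Sum>i\<in>UNIV. L2sq (\<lambda>x. zero_ext D (partial_deriv i (moll \<rho> n f)) x - G i x))) \<longlonglongrightarrow> 0 + (\<Sum>i\<in>(UNIV :: 'n set). 0)"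
    by (intro tendsto_add tendsto_sum moll_tendsto[OF f] moll_grad_tendsto(2)[OF rep])
  then have "(\<lambda>n. L2sq (\<lambda>x. moll \<rho> n f x - f x)
      + (\<Sum>i\<in>UNIV. L2sq (\<lambda>x. zero_ext D (partial_deriv i (moll \<rho> n f)) x - G i x))) \<longlonglongrightarrow> 0" by simp
  \<comment> \<open>Averaging and the bounded sine each contribute less than \<open>e / 4\<close>,
    and the squared triangle inequality doubles both.\<close>
  moreover have e4: "e / 4 > 0" using \<open>e > 0\<close> by simp
  ultimately have "\<forall>\<^sub>F n in sequentially. L2sq (\<lambda>x. moll \<rho> n f x - f x)
      + (\<Sum>i\<in>UNIV. L2sq (\<lambda>x. zero_ext D (partial_deriv i (moll \<rho> n f)) x - G i x)) < e / 4"
    by (rule order_tendstoD(2))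
  then obtain n where n: "L2sq (\<lambda>x. moll \<rho> n f x - f x)
      + (\<Sum>i\<in>UNIV. L2sq (\<lambda>x. zero_ext D (partial_deriv i (moll \<rho> n f)) x - G i x)) < e / 4"
    unfolding eventually_sequentially by blast
  define v where "v = moll \<rho> n f"
  have v_Cinf: "v \<in> Cinf D" unfolding v_def by (rule moll_Cinf[OF \<rho>(1) f])
  have v_ext: "zero_ext D v = v" by (auto simp: v_def zero_ext_def moll_def fun_eq_iff)
  obtain K0 where K0: "\<And>n g. g \<in> L2_supp D \<Longrightarrow> moll \<rho> n g \<in> L2_supp D"
    using moll_L2_bound[OF \<rho>(1)] by blast
  have vL: "v \<in> L2_supp D" unfolding v_def by (rule K0[OF f])
  define dv where "dv i = zero_ext D (partial_deriv i v)" for i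
  have dvL: "dv i \<in> L2_supp D" for i unfolding dv_def v_def by (rule moll_grad_tendsto(1)[OF rep])
  \<comment> \<open>\<open>r k\<close> is the reciprocal of the bound M in the composition with the
    sine.\<close>
  define r where "r k = inverse (real (Suc k))" for k
  have r: "r k > 0" for k by (simp add: r_def)
  define \<phi> where "\<phi> k x = inverse (r k) * sin (v x * r k)" for k x
  have \<phi>_Cinf: "\<phi> k \<in> Cinf D" for k
    unfolding \<phi>_def[abs_def]
    by (intro CinfI Ck_on_mult Ck_on_const conjunct1[OF Ck_on_sin_cos] open_D Cinf_Ck[OF v_Cinf])
  have \<phi>_deriv: "partial_deriv i (\<phi> k) x = cos (v x * r k) * partial_deriv i v x" if x: "x \<in> D" for i k x
  proof -
    have dsin: "((\<lambda>s. inverse (r k) * sin (s * r k)) has_derivative (*) (cos (v x * r k))) (at (v x))"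
      using r[of k] unfolding has_field_derivative_def[symmetric]
      by (auto intro!: derivative_eq_intros)
    have "(\<phi> k has_derivative (\<lambda>h. cos (v x * r k) * frechet_derivative v (at x) h)) (at x)"
      unfolding \<phi>_def[abs_def]
      by (rule has_derivative_compose[where f = v and g = "\<lambda>s. inverse (r k) * sin (s * r k)",
            OF Cinf_has_derivative[OF open_D v_Cinf x] dsin])
    from partial_deriv_eq[OF this, of i] show ?thesis by (simp add: partial_deriv_def)
  qed
  have \<phi>_approx: "\<phi> k \<in> approximants D" for k
  proof -
    have "bounded (\<phi> k ` D)"
    proof (rule boundedI[of _ "inverse (r k) * 1"])
      fix y assume "y \<in> \<phi> k ` D"
      then obtain x where "y = \<phi> k x" by blast
      then have "norm y = inverse (r k) * \<bar>sin (v x * r k)\<bar>" using r[of k] by (simp add: \<phi>_def abs_mult)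
      also have "\<dots> \<le> inverse (r k) * 1" using r[of k] by (intro mult_left_mono) auto
      finally show "norm y \<le> inverse (r k) * 1" .
    qed
    moreover have "energy_controlled D (\<phi> k)"
    proof (rule energy_controlled_mono[OF moll_energy_controlled[OF rep, of n]])
      fix x assume x: "x \<in> D"
      have "grad (\<phi> k) x = cos (v x * r k) *\<^sub>R grad v x"
        using \<phi>_deriv[OF x] by (simp add: grad_def vec_eq_iff)
      then have "norm (grad (\<phi> k) x) = \<bar>cos (v x * r k)\<bar> * norm (grad v x)" by simp
      also have "\<dots> \<le> 1 * norm (grad v x)" by (intro mult_right_mono) auto
      finally show "norm (grad (\<phi> k) x) \<le> norm (grad (moll \<rho> n f) x)" by (simp add: v_def)
    qed
    ultimately show ?thesis using \<phi>_Cinf by (simp add: approximants_def)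
  qed
  have \<phi>L: "zero_ext D (\<phi> k) \<in> L2_supp D" "zero_ext D (partial_deriv i (\<phi> k)) \<in> L2_supp D" for k i
    using approximants_weak_grad_rep[OF \<phi>_approx] by (auto simp: weak_grad_rep_def)
  have r_lim: "r \<longlonglongrightarrow> 0" unfolding r_def[abs_def] by (rule LIMSEQ_inverse_real_of_nat)
  \<comment> \<open>Pointwise convergence is the derivative of the sine at 0, and the majorant is
    \<open>v\<close> itself, since the sine of t is at most t in absolute value.\<close>
  have lim0: "(\<lambda>k. L2sq (\<lambda>x. zero_ext D (\<phi> k) x - v x)) \<longlonglongrightarrow> 0"
  proof (rule L2sq_dominated_tendsto[OF \<phi>L(1) vL vL])
    have "(\<lambda>k. inverse (r k) * sin (a * r k)) \<longlonglongrightarrow> a" for a :: real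
    proof -
      have "((\<lambda>t. sin (a * t)) has_real_derivative a) (at 0)" by (auto intro!: derivative_eq_intros)
      then have "((\<lambda>t. sin (a * t) / t) \<longlongrightarrow> a) (at 0)" by (simp add: has_field_derivative_iff)
      moreover have "filterlim r (at 0) sequentially"
        unfolding filterlim_at using r_lim r by (auto simp: less_imp_neq[symmetric] intro!: always_eventually)
      ultimately have "(\<lambda>k. sin (a * r k) / r k) \<longlonglongrightarrow> a" by (rule filterlim_compose)
      then show ?thesis by (simp add: divide_inverse mult.commute)
    qed
    then have "(\<lambda>k. zero_ext D (\<phi> k) x) \<longlonglongrightarrow> zero_ext D v x" for x
      by (cases "x \<in> D") (simp_all add: zero_ext_def \<phi>_def)
    then show "AE x in lborel. (\<lambda>k. zero_ext D (\<phi> k) x) \<longlonglongrightarrow> v x" by (simp add: v_ext)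
    fix k x
    have "\<bar>\<phi> k x\<bar> = inverse (r k) * \<bar>sin (v x * r k)\<bar>" using r[of k] by (simp add: \<phi>_def abs_mult)
    also have "\<dots> \<le> inverse (r k) * \<bar>v x * r k\<bar>"
      using r[of k] by (intro mult_left_mono abs_sin_x_le_abs_x) auto
    also have "\<dots> = \<bar>v x\<bar>" using r[of k] by (simp add: abs_mult)
    finally show "\<bar>zero_ext D (\<phi> k) x\<bar> \<le> \<bar>v x\<bar>" by (simp add: zero_ext_def)
  qed
  have lim1: "(\<lambda>k. L2sq (\<lambda>x. zero_ext D (partial_deriv i (\<phi> k)) x - dv i x)) \<longlonglongrightarrow> 0" for i
  proof (rule L2sq_dominated_tendsto[OF \<phi>L(2) dvL dvL])
    have "(\<lambda>k. cos (a * r k) * b) \<longlonglongrightarrow> cos (a * 0) * b" for a b :: real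
      by (intro tendsto_intros r_lim)
    then have "(\<lambda>k. zero_ext D (partial_deriv i (\<phi> k)) x) \<longlonglongrightarrow> dv i x" for x
      by (cases "x \<in> D") (simp_all add: zero_ext_def dv_def \<phi>_deriv)
    then show "AE x in lborel. (\<lambda>k. zero_ext D (partial_deriv i (\<phi> k)) x) \<longlonglongrightarrow> dv i x" by simp
    fix k x
    have "\<bar>cos (v x * r k)\<bar> * \<bar>partial_deriv i v x\<bar> \<le> 1 * \<bar>partial_deriv i v x\<bar>"
      by (intro mult_right_mono) auto
    then show "\<bar>zero_ext D (partial_deriv i (\<phi> k)) x\<bar> \<le> \<bar>dv i x\<bar>"
      by (cases "x \<in> D") (simp_all add: zero_ext_def dv_def \<phi>_deriv abs_mult)
  qed
  have "(\<lambda>k. L2sq (\<lambda>x. zero_ext D (\<phi> k) x - v x)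
      + (\<Sum>i\<in>UNIV. L2sq (\<lambda>x. zero_ext D (partial_deriv i (\<phi> k)) x - dv i x))) \<longlonglongrightarrow> 0 + (\<Sum>i\<in>(UNIV :: 'n set). 0)"
    by (intro tendsto_add tendsto_sum lim0 lim1)
  then have "(\<lambda>k. L2sq (\<lambda>x. zero_ext D (\<phi> k) x - v x)
      + (\<Sum>i\<in>UNIV. L2sq (\<lambda>x. zero_ext D (partial_deriv i (\<phi> k)) x - dv i x))) \<longlonglongrightarrow> 0" by simp
  from order_tendstoD(2)[OF this e4] obtain k where k: "L2sq (\<lambda>x. zero_ext D (\<phi> k) x - v x)
      + (\<Sum>i\<in>UNIV. L2sq (\<lambda>x. zero_ext D (partial_deriv i (\<phi> k)) x - dv i x)) < e / 4"
    unfolding eventually_sequentially by blast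
  have t0: "L2sq (\<lambda>x. zero_ext D (\<phi> k) x - f x)
      \<le> 2 * L2sq (\<lambda>x. zero_ext D (\<phi> k) x - v x) + 2 * L2sq (\<lambda>x. v x - f x)"
    by (rule L2sq_triangle[OF \<phi>L(1) vL f])
  have "(\<Sum>i\<in>UNIV. L2sq (\<lambda>x. zero_ext D (partial_deriv i (\<phi> k)) x - G i x))
      \<le> (\<Sum>i\<in>UNIV. 2 * L2sq (\<lambda>x. zero_ext D (partial_deriv i (\<phi> k)) x - dv i x) + 2 * L2sq (\<lambda>x. dv i x - G i x))"
    by (intro sum_mono L2sq_triangle[OF \<phi>L(2) dvL G])
  also have "\<dots> = 2 * (\<Sum>i\<in>UNIV. L2sq (\<lambda>x. zero_ext D (partial_deriv i (\<phi> k)) x - dv i x))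
      + 2 * (\<Sum>i\<in>UNIV. L2sq (\<lambda>x. dv i x - G i x))"
    by (simp only: sum.distrib sum_distrib_left)
  finally have t1: "(\<Sum>i\<in>UNIV. L2sq (\<lambda>x. zero_ext D (partial_deriv i (\<phi> k)) x - G i x))
      \<le> 2 * (\<Sum>i\<in>UNIV. L2sq (\<lambda>x. zero_ext D (partial_deriv i (\<phi> k)) x - dv i x))
      + 2 * (\<Sum>i\<in>UNIV. L2sq (\<lambda>x. dv i x - G i x))" .
  show ?thesis
  proof (rule bexI[OF _ \<phi>_approx[of k]])
    show "L2sq (\<lambda>x. zero_ext D (\<phi> k) x - f x)
        + (\<Sum>i\<in>UNIV. L2sq (\<lambda>x. zero_ext D (partial_deriv i (\<phi> k)) x - G i x)) < e"
      using t0 t1 k n[folded v_def, folded dv_def] by linarith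
  qed
qed

text \<open>The averages of the difference of the two gradients are integrals against test
  functions, hence 0, and they converge to that difference in L2.\<close>

lemma weak_grad_rep_unique:
  assumes "weak_grad_rep D u G" "weak_grad_rep D v H" "AE x in lborel. u x = v x"
  shows "AE x in lborel. G i x = H i x"
proof -
  have m: "u \<in> L2_supp D" "v \<in> L2_supp D" "\<And>i. G i \<in> L2_supp D" "\<And>i. H i \<in> L2_supp D"
    using assms by (auto simp: weak_grad_rep_def)
  define k where "k x = G i x - H i x" for x
  have k: "k \<in> L2_supp D" unfolding k_def[abs_def] by (intro L2_supp_diff m)
  have z: "(LINT x|lborel. k x * \<psi> x) = 0" if \<psi>: "\<psi> \<in> test_functions D" for \<psi>
  proof -
    note [measurable] = L2_supp_measurable[OF m(1)] L2_supp_measurable[OF m(2)] test_function_measurable[OF \<psi>]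
    have "(LINT x|lborel. (u x - v x) * partial_deriv i \<psi> x) = (LINT x|(lborel :: (real ^ 'n) measure). 0)"
    proof (rule integral_cong_AE)
      show "AE x in lborel. (u x - v x) * partial_deriv i \<psi> x = 0"
        using assms(3) by eventually_elim simp
    qed measurable
    moreover have "(LINT x|lborel. (u x - v x) * partial_deriv i \<psi> x) = - (LINT x|lborel. k x * \<psi> x)"
      using weak_grad_rep_diff[OF assms(1,2)] \<psi> unfolding weak_grad_rep_def k_def by blast
    ultimately show ?thesis by simp
  qed
  have "moll \<rho> n k = (\<lambda>x. 0)" for n
  proof
    fix x
    show "moll \<rho> n k x = 0"
      using z[OF unit_kernels_test_function[OF \<rho>(1) inv_rad_pos rad_cball_subset, of x n]]
      by (simp add: moll_def kernel_int_def)
  qed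
  then have "(\<lambda>n. L2sq (\<lambda>x. 0 - k x)) \<longlonglongrightarrow> 0" using moll_tendsto[OF k] by simp
  then have "L2sq k = 0" by (simp add: LIMSEQ_const_iff L2sq_def)
  then have "AE x in lborel. (k x)\<^sup>2 = 0"
    using integral_nonneg_eq_0_iff_AE[OF L2_supp_sq_integrable[OF k]] by (simp add: L2sq_def)
  then show ?thesis by eventually_elim (simp add: k_def)
qed

text \<open>\<open>W12_norm\<close> uses a chosen weak gradient; uniqueness shows that every
  representative gives the same value, so the norm can be computed from any of them.\<close>

lemma W12_norm_rep:
  assumes f: "f \<in> borel_measurable (lebesgue_on D)" and rep: "weak_grad_rep D u G"
    and eq: "AE x in lborel. x \<in> D \<longrightarrow> f x = u x"
  shows "W12_norm D f = sqrt (L2sq u + (\<Sum>i\<in>UNIV. L2sq (G i)))"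
proof -
  have u: "u \<in> L2_supp D" and G: "\<And>i. G i \<in> L2_supp D" using rep by (auto simp: weak_grad_rep_def)
  note fW = weak_grad_rep_imp_W12[OF rep f eq]
  define W where "W = weak_grad D f"
  have W: "has_L2_weak_grad D f W"
    unfolding W_def weak_grad_def by (rule someI[of "has_L2_weak_grad D f"]) (rule fW(2))
  obtain v H where vH: "weak_grad_rep D v H" "AE x in lborel. x \<in> D \<longrightarrow> f x = v x"
    "\<And>i. AE x in lborel. x \<in> D \<longrightarrow> W x $ i = H i x"
    by (rule weak_grad_rep_exists[OF fW(1) W]) blast
  have v: "v \<in> L2_supp D" using vH(1) by (simp add: weak_grad_rep_def)
  have "AE x in lborel. u x = v x"
    using eq vH(2)
  proof eventually_elim
    case (elim x)
    then show ?case by (cases "x \<in> D") (auto simp: L2_supp_zero[OF u] L2_supp_zero[OF v])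
  qed
  then have GH: "AE x in lborel. G i x = H i x" for i
    by (rule weak_grad_rep_unique[OF rep vH(1)])
  have "AE x in lborel. \<forall>i\<in>UNIV. x \<in> D \<longrightarrow> W x $ i = G i x"
  proof (rule AE_finite_allI)
    fix i show "AE x in lborel. x \<in> D \<longrightarrow> W x $ i = G i x"
      using GH[of i] vH(3)[of i] by eventually_elim simp
  qed simp
  then have AE: "AE x in lborel. x \<in> D \<longrightarrow> (norm (W x))\<^sup>2 = (\<Sum>i\<in>UNIV. (G i x)\<^sup>2)"
    by eventually_elim (simp add: norm_vec_def L2_set_def real_sqrt_pow2 sum_nonneg)
  note [measurable] = L2_supp_measurable[OF u] L2_supp_measurable[OF G]
  have "(LINT x|lebesgue_on D. (norm (W x))\<^sup>2) = (LINT x|lborel. (\<Sum>i\<in>UNIV. (G i x)\<^sup>2))"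
  proof (rule integral_lebesgue_on_rep[OF _ _ _ AE])
    have "W \<in> borel_measurable (lebesgue_on D)" using W by (simp add: has_L2_weak_grad_def L2_on_def)
    then show "(\<lambda>x. (norm (W x))\<^sup>2) \<in> borel_measurable (lebesgue_on D)" by simp
  qed (auto simp: L2_supp_zero[OF G])
  also have "\<dots> = (\<Sum>i\<in>UNIV. L2sq (G i))"
    unfolding L2sq_def by (rule Bochner_Integration.integral_sum) (rule L2_supp_sq_integrable[OF G])
  finally have 1: "(LINT x|lebesgue_on D. (norm (W x))\<^sup>2) = (\<Sum>i\<in>UNIV. L2sq (G i))" .
  have "(LINT x|lebesgue_on D. (norm (f x))\<^sup>2) = (LINT x|lborel. (u x)\<^sup>2)"
  proof (rule integral_lebesgue_on_rep)
    show "(\<lambda>x. (norm (f x))\<^sup>2) \<in> borel_measurable (lebesgue_on D)" using f by simp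
    show "AE x in lborel. x \<in> D \<longrightarrow> (norm (f x))\<^sup>2 = (u x)\<^sup>2" using eq by eventually_elim simp
  qed (auto simp: L2_supp_zero[OF u])
  with 1 show ?thesis by (simp add: W12_norm_def W_def L2sq_def)
qed

end

section \<open>Grid cubes and their edges\<close>

lemma axis_shift_nth: "(p + t *\<^sub>R axis i 1) $ j = p $ j + (if j = i then t else (0 :: real))"
  by (simp add: axis_def)

text \<open>A coordinate strictly inside its interval could be moved both ways, which would exhibit
  the point as a midpoint of two points of the cube.\<close>

lemma cube_extreme_point:
  fixes a :: "real ^ 'n"
  assumes x: "x extreme_point_of cbox a (\<chi> i. a $ i + h)" and "h > 0"
  shows "x $ j = a $ j \<or> x $ j = a $ j + h"
proof (rule ccontr)
  assume neg: "\<not> (x $ j = a $ j \<or> x $ j = a $ j + h)"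
  have xQ: "a $ i \<le> x $ i \<and> x $ i \<le> a $ i + h" for i
  proof -
    have "x \<in> cbox a (\<chi> i. a $ i + h)" using x unfolding extreme_point_of_def by blast
    then show ?thesis unfolding mem_box_cart vec_lambda_beta by blast
  qed
  define e where "e = min (x $ j - a $ j) (a $ j + h - x $ j)"
  have e: "e > 0" "e \<le> x $ j - a $ j" "e \<le> a $ j + h - x $ j"
    using xQ[of j] neg unfolding e_def by linarith+
  let ?u = "x + (- e) *\<^sub>R axis j 1" and ?w = "x + e *\<^sub>R axis j 1"
  have uw: "?u $ l = x $ l - (if l = j then e else 0)" "?w $ l = x $ l + (if l = j then e else 0)" for l
    unfolding axis_shift_nth by simp_all
  have "a $ l \<le> ?u $ l \<and> ?u $ l \<le> a $ l + h" "a $ l \<le> ?w $ l \<and> ?w $ l \<le> a $ l + h" for l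
    unfolding uw using xQ[of l] e by (cases "l = j"; simp)+
  then have "?u \<in> cbox a (\<chi> i. a $ i + h)" "?w \<in> cbox a (\<chi> i. a $ i + h)"
    unfolding mem_box_cart vec_lambda_beta by blast+
  moreover have "x \<in> open_segment ?u ?w"
  proof -
    have "?u \<noteq> ?w"
    proof
      assume "?u = ?w"
      then have "?u $ j = ?w $ j" by (rule arg_cong)
      then show False unfolding uw using e(1) by simp
    qed
    moreover have "midpoint ?u ?w = x"
      by (simp add: midpoint_def scaleR_2[symmetric])
    ultimately show ?thesis using midpoint_in_open_segment[of ?u ?w] by simp
  qed
  ultimately show False using x unfolding extreme_point_of_def by blast
qed

text \<open>The endpoints of an edge are extreme points of the cube, hence corners. They cannot
  differ in two coordinates: exchanging one of them gives two further corners with the same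
  midpoint, and the face property would put these on the segment.\<close>

lemma cube_edge_endpoints:
  fixes a x y :: "real ^ 'n"
  assumes e: "closed_segment x y edge_of cbox a (\<chi> i. a $ i + h)" and h: "h > 0"
  obtains i p where "\<And>j. p $ j = a $ j \<or> p $ j = a $ j + h"
    "(x = p \<and> y = p + h *\<^sub>R axis i 1) \<or> (y = p \<and> x = p + h *\<^sub>R axis i 1)"
    "closed_segment p (p + h *\<^sub>R axis i 1) \<subseteq> cbox a (\<chi> i. a $ i + h)"
proof -
  let ?Q = "cbox a (\<chi> i. a $ i + h)" and ?F = "closed_segment x y"
  have face: "?F face_of ?Q" and dim: "aff_dim ?F = 1" using e by (auto simp: edge_of_def)
  have ne: "x \<noteq> y"
  proof
    assume "x = y"
    then have "?F = {x}" by simp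
    then show False using dim by simp
  qed
  have "{x} face_of ?F" "{y} face_of ?F" by (auto simp: face_of_singleton extreme_point_of_segment)
  then have "{x} face_of ?Q" "{y} face_of ?Q" using face_of_trans[OF _ face] by simp_all
  then have ext: "x extreme_point_of ?Q" "y extreme_point_of ?Q" by (auto simp: face_of_singleton)
  have xv: "x $ j = a $ j \<or> x $ j = a $ j + h" and yv: "y $ j = a $ j \<or> y $ j = a $ j + h" for j
    using cube_extreme_point[OF ext(1) h] cube_extreme_point[OF ext(2) h] by blast+
  have FQ: "?F \<subseteq> ?Q" by (rule face_of_imp_subset[OF face])
  obtain i where i: "x $ i \<noteq> y $ i" using ne by (auto simp: vec_eq_iff)
  have same: "x $ j = y $ j" if "j \<noteq> i" for j
  proof (rule ccontr)
    assume j: "x $ j \<noteq> y $ j"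
    define x' where "x' = (\<chi> l. if l = i then y $ l else x $ l)"
    define y' where "y' = (\<chi> l. if l = i then x $ l else y $ l)"
    have between: "a $ l \<le> x $ l \<and> x $ l \<le> a $ l + h" "a $ l \<le> y $ l \<and> y $ l \<le> a $ l + h" for l
      using xv[of l] yv[of l] h by auto
    have Q: "x' \<in> ?Q" "y' \<in> ?Q"
      unfolding mem_box_cart x'_def y'_def vec_lambda_beta using between by simp_all
    have "x' \<noteq> y'"
    proof
      assume "x' = y'"
      then have "x' $ j = y' $ j" by (rule arg_cong)
      with j \<open>j \<noteq> i\<close> show False by (simp add: x'_def y'_def)
    qed
    moreover have "midpoint x' y' = midpoint x y"
      by (simp add: midpoint_def vec_eq_iff x'_def y'_def)
    ultimately have "midpoint x y \<in> open_segment x' y'"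
      using midpoint_in_open_segment[of x' y'] by simp
    moreover have "midpoint x y \<in> ?F" by simp
    ultimately have "x' \<in> ?F" using face Q unfolding face_of_def by blast
    then obtain u where u: "x' = (1 - u) *\<^sub>R x + u *\<^sub>R y" by (auto simp: closed_segment_def)
    from arg_cong[OF u, of "\<lambda>v. v $ i"] have "(1 - u) * (x $ i - y $ i) = 0"
      by (simp add: x'_def algebra_simps)
    then have "u = 1" using i by simp
    from arg_cong[OF u, of "\<lambda>v. v $ j"] \<open>u = 1\<close> have "x $ j = y $ j"
      using \<open>j \<noteq> i\<close> by (simp add: x'_def)
    with j show False by simp
  qed
  show thesis
  proof (cases "x $ i < y $ i")
    case True
    then have "y $ i = x $ i + h" using xv[of i] yv[of i] h by auto
    then have "y = x + h *\<^sub>R axis i 1"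
      using same by (simp add: vec_eq_iff axis_def)
    then show thesis using that[of x i] xv FQ by blast
  next
    case False
    then have "x $ i = y $ i + h" using xv[of i] yv[of i] h i by auto
    then have "x = y + h *\<^sub>R axis i 1"
      using same by (simp add: vec_eq_iff axis_def)
    moreover have "closed_segment y x \<subseteq> ?Q" using FQ by (simp only: closed_segment_commute[of y x])
    ultimately show thesis using that[of y i] yv by blast
  qed
qed

text \<open>Makes the condition on the vertices of an admissible cube applicable to its lower
  corner, from which all other corners are grid points too.\<close>

lemma corner_extreme_point:
  fixes a :: "real ^ 'n"
  assumes "h > 0"
  shows "a extreme_point_of cbox a (\<chi> i. a $ i + h)"
  unfolding extreme_point_of_def
proof (intro conjI ballI notI)
  show "a \<in> cbox a (\<chi> i. a $ i + h)" using assms by (simp add: mem_box_cart)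
  fix u w assume u: "u \<in> cbox a (\<chi> i. a $ i + h)" and w: "w \<in> cbox a (\<chi> i. a $ i + h)"
    and "a \<in> open_segment u w"
  then obtain t where t: "u \<noteq> w" "0 < t" "t < 1" "a = (1 - t) *\<^sub>R u + t *\<^sub>R w"
    by (auto simp: in_segment)
  have "u $ j = a $ j \<and> w $ j = a $ j" for j
  proof -
    have "a $ j = (1 - t) * u $ j + t * w $ j" using arg_cong[OF t(4), of "\<lambda>v. v $ j"] by simp
    then have "(1 - t) * (u $ j - a $ j) + t * (w $ j - a $ j) = 0" by (simp add: algebra_simps)
    moreover have "0 \<le> (1 - t) * (u $ j - a $ j)" "0 \<le> t * (w $ j - a $ j)"
      using t u w by (auto simp: mem_box_cart)
    ultimately have "(1 - t) * (u $ j - a $ j) = 0" "t * (w $ j - a $ j) = 0" by linarith+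
    then show ?thesis using t by simp
  qed
  then show False using t(1) by (simp add: vec_eq_iff)
qed

text \<open>Open cubes, so that cells of distinct grid points are disjoint and not merely without
  common interior.\<close>

definition cell :: "real \<Rightarrow> real ^ 'n \<Rightarrow> (real ^ 'n) set" where
  "cell h p = box p (\<chi> j. p $ j + h)"

lemma mem_cell: "z \<in> cell h p \<longleftrightarrow> (\<forall>j. p $ j < z $ j \<and> z $ j < p $ j + h)"
  by (simp add: cell_def mem_box_cart)

lemma cell_measurable [measurable]: "cell h p \<in> sets borel"
  by (simp add: cell_def)

lemma emeasure_cell:
  fixes p :: "real ^ 'n"
  assumes "h > 0"
  shows "emeasure lborel (cell h p) = ennreal (h ^ CARD('n))"
proof -
  let ?y = "\<chi> j. p $ j + h / 2"
  have "(\<chi> i. ?y $ i - h / 2) = p" "(\<chi> i. ?y $ i + h / 2) = (\<chi> j. p $ j + h)"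
    by (simp_all add: vec_eq_iff)
  then have "emeasure lborel (cbox p (\<chi> j. p $ j + h)) = ennreal ((2 * (h / 2)) ^ CARD('n))"
    using emeasure_cube[of "h / 2" ?y] assms by simp
  then show ?thesis
    unfolding cell_def emeasure_lborel_box_eq emeasure_lborel_cbox_eq by simp
qed

lemma grid_cells_disjoint:
  fixes p q z :: "real ^ 'n"
  assumes p: "p \<in> grid k" and q: "q \<in> grid k" and z: "z \<in> cell (2 powi (- k)) p" "z \<in> cell (2 powi (- k)) q"
  shows "p = q"
  unfolding vec_eq_iff
proof
  fix j
  define h :: real where "h = 2 powi (- k)"
  have h: "h > 0" by (simp add: h_def)
  obtain a b :: int where ab: "p $ j = of_int a * h" "q $ j = of_int b * h"
    using p q unfolding grid_def h_def by blast
  have "of_int a * h < z $ j" "z $ j < of_int a * h + h" "of_int b * h < z $ j" "z $ j < of_int b * h + h"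
    using z[folded h_def] unfolding mem_cell ab[symmetric] by blast+
  then have "of_int a * h < (of_int b + 1) * h" "of_int b * h < (of_int a + 1) * h"
    by (auto simp: algebra_simps)
  then have "real_of_int a < of_int b + 1" "real_of_int b < of_int a + 1"
    using h mult_less_cancel_right_pos by blast+
  then have "a = b" by linarith
  then show "p $ j = q $ j" by (simp add: ab)
qed

text \<open>Counting by volume, used to bound the number of edges whose averaging ball contains a
  given point.\<close>

lemma card_cells_le:
  fixes P :: "(real ^ 'n) set"
  assumes fin: "finite P" and grid: "P \<subseteq> grid k" and B: "B \<in> sets borel"
    and sub: "\<And>p. p \<in> P \<Longrightarrow> cell (2 powi (- k)) p \<subseteq> B"
  shows "of_nat (card P) * ennreal ((2 powi (- k)) ^ CARD('n)) \<le> emeasure lborel B"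
proof -
  let ?h = "2 powi (- k) :: real"
  have "of_nat (card P) * ennreal (?h ^ CARD('n)) = (\<Sum>p\<in>P. emeasure lborel (cell ?h p))"
    by (simp add: emeasure_cell)
  also have "\<dots> = emeasure lborel (\<Union>p\<in>P. cell ?h p)"
  proof (rule sum_emeasure[OF _ _ fin])
    show "disjoint_family_on (cell ?h) P"
      unfolding disjoint_family_on_def using grid_cells_disjoint grid by blast
  qed auto
  also have "\<dots> \<le> emeasure lborel B" using sub B by (intro emeasure_mono) auto
  finally show ?thesis .
qed

text \<open>Edges are represented by their lower endpoint and direction; membership only records
  that the edge keeps the distance of the admissible cubes from the boundary.\<close>

definition edge_set :: "(real ^ 'n) set \<Rightarrow> real \<Rightarrow> int \<Rightarrow> ((real ^ 'n) \<times> 'n) set" where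
  "edge_set D c k = {(p, i). p \<in> grid k \<and>
    (\<forall>z\<in>closed_segment p (p + (2 powi (- k)) *\<^sub>R axis i 1). c * 2 powi (- k) \<le> depth D z)}"

section \<open>Grid edges as pairs of a grid point and a direction\<close>

context finite_domain
begin

text \<open>A segment from a point of the cube to a point outside \<open>D\<close> crosses the
  frontier, so distance to the frontier bounds distance to the complement. For
  \<open>k \<ge> 0\<close> the mesh is at most 1, hence the cap in \<open>depth\<close> does not
  interfere.\<close>

lemma admissible_cube_depth:
  assumes Q: "admissible_cube D c k Q" and z: "z \<in> Q" and k: "k \<ge> 0" and c: "0 < c" "c < 1"
  shows "c * 2 powi (- k) \<le> depth D z"
proof -
  let ?h = "2 powi (- k) :: real"
  have QD: "Q \<subseteq> D" and sd: "setdist Q (frontier D) > c * ?h" using Q by (auto simp: admissible_cube_def)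
  have "c * ?h \<le> dist z w" if w: "w \<in> - D" for w
  proof -
    have "closed_segment z w \<inter> frontier D \<noteq> {}"
      by (rule connected_Int_frontier) (use z QD w in auto)
    then obtain q where q: "q \<in> closed_segment z w" "q \<in> frontier D" by blast
    have "setdist Q (frontier D) \<le> dist z q" by (rule setdist_le_dist[OF z q(2)])
    also have "\<dots> \<le> dist z w" using segment_bound(1)[OF q(1)] by (simp add: dist_norm norm_minus_commute)
    finally show ?thesis using sd by simp
  qed
  then have "c * ?h \<le> infdist z (- D)"
    unfolding infdist_notempty[OF Compl_nonempty] by (intro cINF_greatest Compl_nonempty)
  moreover have "?h \<le> 1"
    using power_int_increasing[of "- k" 0 "2 :: real"] k by simp
  then have "c * ?h \<le> 1 * 1" using c by (intro mult_mono) auto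
  ultimately show ?thesis by (simp add: depth_def)
qed

lemma grid_edges_cases:
  assumes xy: "(x, y) \<in> grid_edges D c x0 k" and k: "k \<ge> 0" and c: "0 < c" "c < 1"
  obtains p i where "(p, i) \<in> edge_set D c k"
    "(x, y) = (p, p + (2 powi (- k)) *\<^sub>R axis i 1) \<or> (x, y) = (p + (2 powi (- k)) *\<^sub>R axis i 1, p)"
proof -
  let ?h = "2 powi (- k) :: real"
  have h: "?h > 0" by simp
  obtain Q where Q: "admissible_cube D c k Q" "closed_segment x y edge_of Q"
    using xy by (auto simp: grid_edges_def grid_cubes_def)
  obtain a :: "real ^ 'n" and J where J: "card J = CARD('n)" "Q = cbox a (\<chi> i. a $ i + (if i \<in> J then ?h else 0))"
    using Q(1) by (auto simp: admissible_cube_def is_cube_def)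
  have "J = UNIV" using J(1) by (simp add: card_eq_UNIV_imp_eq_UNIV)
  then have Qa: "Q = cbox a (\<chi> i. a $ i + ?h)" using J(2) by simp
  have "a \<in> grid k"
    using Q(1) corner_extreme_point[OF h, of a] unfolding admissible_cube_def Qa by blast
  then have az: "\<exists>z::int. a $ j = of_int z * ?h" for j by (simp add: grid_def)
  show thesis
  proof (rule cube_edge_endpoints[OF Q(2)[unfolded Qa] h])
    fix i p assume p: "\<And>j. p $ j = a $ j \<or> p $ j = a $ j + ?h"
      "(x = p \<and> y = p + ?h *\<^sub>R axis i 1) \<or> (y = p \<and> x = p + ?h *\<^sub>R axis i 1)"
      "closed_segment p (p + ?h *\<^sub>R axis i 1) \<subseteq> cbox a (\<chi> i. a $ i + ?h)"
    have "\<exists>z::int. p $ j = of_int z * ?h" for j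
    proof -
      obtain z :: int where z: "a $ j = of_int z * ?h" using az by blast
      have "a $ j + ?h = of_int (z + 1) * ?h" unfolding z of_int_add of_int_1 distrib_right by simp
      then have "a $ j + ?h = of_int (z + 1) * ?h" .
      then show ?thesis using p(1)[of j] z by (elim disjE) (simp_all only:, blast+)
    qed
    then have "p \<in> grid k" by (simp add: grid_def)
    moreover have "c * ?h \<le> depth D z" if "z \<in> closed_segment p (p + ?h *\<^sub>R axis i 1)" for z
      using admissible_cube_depth[OF Q(1) _ k c, of z] p(3) that Qa by blast
    ultimately have "(p, i) \<in> edge_set D c k" by (simp add: edge_set_def)
    then show thesis using p(2) by (intro that) auto
  qed
qed

text \<open>The maps \<open>up\<close> and \<open>dn\<close> are the two orientations of a lower
  endpoint with a direction; their images cover the ordered pairs, and each contributes one copy of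
  the same sum.\<close>

lemma edge_sum_le:
  assumes k: "k \<ge> 0" and c: "0 < c" "c < 1"
  obtains E where "finite E" "E \<subseteq> edge_set D c k"
    "(\<Sum>(x, y)\<in>grid_edges D c x0 k. (\<phi> x - \<phi> y)\<^sup>2)
      \<le> 2 * (\<Sum>(p, i)\<in>E. (\<phi> (p + (2 powi (- k)) *\<^sub>R axis i 1) - \<phi> p)\<^sup>2 :: real)"
proof (cases "finite (grid_edges D c x0 k)")
  case False
  \<comment> \<open>A sum over an infinite set is 0 by convention.\<close>
  show thesis by (rule that[of "{}"]) (use False in auto)
next
  case True
  let ?h = "2 powi (- k) :: real" and ?S = "grid_edges D c x0 k"
  define up where "up e = (fst e, fst e + ?h *\<^sub>R axis (snd e) 1)" for e :: "(real ^ 'n) \<times> 'n"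
  define dn where "dn e = (fst e + ?h *\<^sub>R axis (snd e) 1, fst e)" for e :: "(real ^ 'n) \<times> 'n"
  define g where "g e = (\<phi> (fst e) - \<phi> (snd e))\<^sup>2" for e
  have inj: "inj up" "inj dn"
    by (auto intro!: injI simp: up_def dn_def prod_eq_iff axis_eq_axis)
  define E where "E = (up -` ?S \<union> dn -` ?S) \<inter> edge_set D c k"
  have fin: "finite E" unfolding E_def using True inj by (auto intro: finite_vimageI)
  have cover: "?S \<subseteq> up ` E \<union> dn ` E"
  proof
    fix e assume e: "e \<in> ?S"
    then obtain x y where xy: "e = (x, y)" "(x, y) \<in> ?S" by (cases e) auto
    show "e \<in> up ` E \<union> dn ` E"
    proof (rule grid_edges_cases[OF xy(2) k c])
      fix p i assume pi: "(p, i) \<in> edge_set D c k"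
        "(x, y) = (p, p + ?h *\<^sub>R axis i 1) \<or> (x, y) = (p + ?h *\<^sub>R axis i 1, p)"
      then have "e = up (p, i) \<or> e = dn (p, i)" using xy(1) by (simp add: up_def dn_def)
      then show ?thesis using e pi(1) unfolding E_def by blast
    qed
  qed
  have "(\<Sum>(x, y)\<in>?S. (\<phi> x - \<phi> y)\<^sup>2) = sum g ?S" by (simp add: g_def case_prod_beta)
  also have "\<dots> \<le> sum g (up ` E \<union> dn ` E)"
    using fin cover by (intro sum_mono2) (auto simp: g_def)
  also have "\<dots> \<le> sum g (up ` E) + sum g (dn ` E)"
    using fin sum.union_inter[of "up ` E" "dn ` E" g] sum_nonneg[of "up ` E \<inter> dn ` E" g]
    by (simp add: g_def)
  also have "\<dots> \<le> sum (g \<circ> up) E + sum (g \<circ> dn) E"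
    by (intro add_mono sum_image_le fin) (auto simp: g_def)
  also have "\<dots> = 2 * (\<Sum>(p, i)\<in>E. (\<phi> (p + ?h *\<^sub>R axis i 1) - \<phi> p)\<^sup>2)"
    by (simp add: g_def up_def dn_def case_prod_beta power2_commute[of "\<phi> (fst _)" "\<phi> (fst _ + _)"])
  finally show thesis using that[OF fin] unfolding E_def by blast
qed

text \<open>The mean value theorem applies because the edge stays at positive depth, hence inside
  \<open>D\<close>.\<close>

lemma edge_mean_value:
  assumes e: "(p, i) \<in> edge_set D c k" and c: "0 < c" and \<phi>: "\<phi> \<in> Cinf D"
  obtains \<xi> where "\<xi> \<in> closed_segment p (p + (2 powi (- k)) *\<^sub>R axis i 1)"
    "(\<phi> (p + (2 powi (- k)) *\<^sub>R axis i 1) - \<phi> p)\<^sup>2 = (2 powi (- k))\<^sup>2 * (partial_deriv i \<phi> \<xi>)\<^sup>2"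
proof -
  let ?h = "2 powi (- k) :: real"
  have h: "?h > 0" by simp
  have seg: "p + t *\<^sub>R axis i 1 \<in> closed_segment p (p + ?h *\<^sub>R axis i 1)" if "0 \<le> t" "t \<le> ?h" for t
  proof -
    have "p + t *\<^sub>R axis i 1 = (1 - t / ?h) *\<^sub>R p + (t / ?h) *\<^sub>R (p + ?h *\<^sub>R axis i 1)"
      by (simp add: algebra_simps)
    then show ?thesis using that h by (auto simp: closed_segment_def intro!: exI[of _ "t / ?h"])
  qed
  have "c * ?h > 0" using c by simp
  then have segD: "z \<in> D" if "z \<in> closed_segment p (p + ?h *\<^sub>R axis i 1)" for z
    using e that unfolding edge_set_def by (auto simp flip: depth_pos_iff intro: less_le_trans)
  have "DERIV (\<lambda>t. \<phi> (p + t *\<^sub>R axis i 1)) t :> partial_deriv i \<phi> (p + t *\<^sub>R axis i 1)"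
    if t: "0 \<le> t" "t \<le> ?h" for t
  proof -
    let ?F = "frechet_derivative \<phi> (at (p + t *\<^sub>R axis i 1))"
    have F: "(\<phi> has_derivative ?F) (at (p + t *\<^sub>R axis i 1))"
      by (rule Cinf_has_derivative[OF open_D \<phi> segD[OF seg[OF t]]])
    have "((\<lambda>t. \<phi> (p + t *\<^sub>R axis i 1)) has_derivative (\<lambda>r. ?F (r *\<^sub>R axis i 1))) (at t)"
      by (rule has_derivative_compose[where f = "\<lambda>t. p + t *\<^sub>R axis i 1" and g = \<phi>
            and f' = "\<lambda>r. r *\<^sub>R axis i 1" and g' = ?F, OF _ F]) (auto intro!: derivative_eq_intros)
    then show ?thesis
      using linear_scale[OF has_derivative_linear[OF F]]
      by (simp add: has_field_derivative_def mult_commute_abs partial_deriv_def)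
  qed
  then obtain t where t: "0 < t" "t < ?h"
    "\<phi> (p + ?h *\<^sub>R axis i 1) - \<phi> (p + 0 *\<^sub>R axis i 1) = (?h - 0) * partial_deriv i \<phi> (p + t *\<^sub>R axis i 1)"
    using MVT2[OF h, of "\<lambda>t. \<phi> (p + t *\<^sub>R axis i 1)" "\<lambda>t. partial_deriv i \<phi> (p + t *\<^sub>R axis i 1)"] by blast
  show thesis
  proof (rule that[OF seg[of t]])
    show "(\<phi> (p + ?h *\<^sub>R axis i 1) - \<phi> p)\<^sup>2 = ?h\<^sup>2 * (partial_deriv i \<phi> (p + t *\<^sub>R axis i 1))\<^sup>2"
      using t(3) by (simp only: power_mult_distrib scaleR_zero_left add_0_right diff_zero)
  qed (use t in auto)
qed

section \<open>The discrete energy\<close>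

lemma edge_point_near_cell:
  assumes \<xi>: "\<xi> \<in> closed_segment p (p + h *\<^sub>R axis i 1)" and z: "z \<in> cell h p" and h: "h > 0"
  shows "\<bar>z $ j - \<xi> $ j\<bar> \<le> h"
proof -
  obtain u where u: "0 \<le> u" "u \<le> 1" "\<xi> = (1 - u) *\<^sub>R p + u *\<^sub>R (p + h *\<^sub>R axis i 1)"
    using \<xi> by (auto simp: closed_segment_def)
  have "\<xi> $ j = p $ j + (if j = i then u * h else 0)"
    unfolding u(3) by (simp add: axis_def algebra_simps)
  moreover have "0 \<le> u * h" "u * h \<le> h" using u h by (auto simp: mult_left_le_one_le)
  ultimately have "p $ j \<le> \<xi> $ j" "\<xi> $ j \<le> p $ j + h" using h by auto
  moreover have "p $ j < z $ j" "z $ j < p $ j + h" using z unfolding mem_cell by blast+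
  ultimately show ?thesis by linarith
qed

text \<open>Bounded overlap. Fix \<open>y\<close> of depth m. The edges whose ball contains
  \<open>y\<close> have depth comparable to m, and the cells of their lower endpoints lie in a cube
  of edge \<open>2 * R\<close> around \<open>y\<close>. Volume bounds the number of endpoints, each
  endpoint has at most \<open>CARD('n)\<close> edges, and the powers of \<open>h\<close> and m
  cancel.\<close>

lemma local_average_overlap:
  fixes k :: int and c :: real
  defines "h \<equiv> 2 powi (- k)"
  assumes c: "0 < c" and E: "finite E" "E \<subseteq> edge_set D c k"
    and \<xi>: "\<And>e. e \<in> E \<Longrightarrow> \<xi> e \<in> closed_segment (fst e) (fst e + h *\<^sub>R axis (snd e) 1)" and y: "y \<in> D"
  shows "(\<Sum>e\<in>E. ennreal (h ^ CARD('n) * (1 / depth D (\<xi> e)) ^ CARD('n))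
      * indicator (cball (\<xi> e) (depth D (\<xi> e) / 2)) y)
    \<le> ennreal (CARD('n) * (3 * (1 + 4 / c)) ^ CARD('n))"
proof -
  let ?d = "CARD('n)"
  define m where "m = depth D y"
  have m: "m > 0" using depth_pos[OF y] by (simp add: m_def)
  have h: "h > 0" by (simp add: h_def)
  define E' where "E' = {e \<in> E. y \<in> cball (\<xi> e) (depth D (\<xi> e) / 2)}"
  have fin: "finite E'" using E(1) by (simp add: E'_def)
  have near: "2 / 3 * m \<le> depth D (\<xi> e)" "depth D (\<xi> e) \<le> 2 * m" "dist (\<xi> e) y \<le> m" if "e \<in> E'" for e
  proof -
    have d: "dist (\<xi> e) y \<le> depth D (\<xi> e) / 2" using that by (simp add: E'_def)
    show "2 / 3 * m \<le> depth D (\<xi> e)" "depth D (\<xi> e) \<le> 2 * m"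
      unfolding m_def by (rule depth_comparable[OF d])+
    then show "dist (\<xi> e) y \<le> m" using d by linarith
  qed
  define P where "P = fst ` E'"
  define T where "T = h ^ ?d * (3 / (2 * m)) ^ ?d"
  have T: "T \<ge> 0" using h m by (simp add: T_def)
  have "card E' \<le> card (P \<times> (UNIV :: 'n set))"
    using fin unfolding P_def by (intro card_mono subsetI) (auto simp: mem_Times_iff)
  then have cardE: "real (card E') \<le> real ?d * real (card P)"
    by (simp add: card_cartesian_product mult.commute flip: of_nat_mult)
  have bound: "real (card E') * T \<le> ?d * (3 * (1 + 4 / c)) ^ ?d"
  proof (cases "E' = {}")
    case True
    then show ?thesis using c by simp
  next
    case False
    then obtain e0 where e0: "e0 \<in> E'" by blast
    have "c * h \<le> depth D (\<xi> e0)"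
      using E(2) \<xi>[of e0] e0 unfolding edge_set_def h_def E'_def by (cases e0) auto
    then have "c * h \<le> 2 * m" using near(2)[OF e0] by linarith
    \<comment> \<open>This is where the distance condition on the cubes enters: the mesh is at most
      a multiple of the depth of \<open>y\<close>, so the cells do not spread beyond a multiple of
      m.\<close>
    then have hm: "h \<le> 2 * m / c" using c by (simp add: field_simps)
    define R where "R = m + 2 * h"
    have R: "R \<ge> 0" using m h by (simp add: R_def)
    let ?B = "cbox (\<chi> i. y $ i - R) (\<chi> i. y $ i + R)"
    have "of_nat (card P) * ennreal (h ^ ?d) \<le> emeasure lborel ?B"
      unfolding h_def
    proof (rule card_cells_le)
      show "finite P" using fin by (simp add: P_def)
      show "P \<subseteq> grid k" using E(2) by (auto simp: P_def E'_def edge_set_def)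
      fix p assume "p \<in> P"
      then obtain e where e: "e \<in> E'" "p = fst e" by (auto simp: P_def)
      show "cell (2 powi (- k)) p \<subseteq> ?B"
      proof
        fix z assume "z \<in> cell (2 powi (- k)) p"
        then have zc: "z \<in> cell h (fst e)" by (simp add: h_def e(2))
        have "\<xi> e \<in> closed_segment (fst e) (fst e + h *\<^sub>R axis (snd e) 1)"
          using \<xi> e(1) by (simp add: E'_def)
        note n = edge_point_near_cell[OF this zc h]
        have "\<bar>z $ j - y $ j\<bar> \<le> R" for j
        proof -
          have "\<bar>\<xi> e $ j - y $ j\<bar> \<le> m"
            using component_le_norm_cart[of "\<xi> e - y" j] near(3)[OF e(1)] by (simp add: dist_norm)
          then show ?thesis using n[of j] h unfolding R_def by linarith
        qed
        then have "y $ j - R \<le> z $ j \<and> z $ j \<le> y $ j + R" for j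
          by (simp add: abs_le_iff) (smt (verit))
        then show "z \<in> ?B" unfolding mem_box_cart vec_lambda_beta by blast
      qed
    qed simp
    then have "ennreal (real (card P) * h ^ ?d) \<le> ennreal ((2 * R) ^ ?d)"
      unfolding emeasure_cube[OF R] using h by (simp add: ennreal_mult ennreal_of_nat_eq_real_of_nat)
    then have "real (card P) * h ^ ?d \<le> (2 * R) ^ ?d"
      using R by (simp add: ennreal_le_iff)
    moreover have "(2 * R) ^ ?d * (3 / (2 * m)) ^ ?d \<le> (3 * (1 + 4 / c)) ^ ?d"
    proof -
      have "m * (1 + 4 / c) = m + 2 * (2 * m / c)" using c by (simp add: field_simps)
      then have "R \<le> m * (1 + 4 / c)" using hm by (simp only: R_def)
      then have "2 * R * (3 / (2 * m)) \<le> 2 * (m * (1 + 4 / c)) * (3 / (2 * m))"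
        using m by (intro mult_right_mono) auto
      also have "\<dots> = 3 * (1 + 4 / c)" using m by simp
      finally have "(2 * R * (3 / (2 * m))) ^ ?d \<le> (3 * (1 + 4 / c)) ^ ?d"
        using R m by (intro power_mono) auto
      then show ?thesis by (simp only: power_mult_distrib)
    qed
    ultimately have "real (card P) * h ^ ?d * (3 / (2 * m)) ^ ?d \<le> (3 * (1 + 4 / c)) ^ ?d"
      using m by (meson mult_right_mono order_trans zero_le_divide_iff zero_le_power less_imp_le
          zero_le_numeral mult_nonneg_nonneg)
    then have "real ?d * (real (card P) * T) \<le> real ?d * (3 * (1 + 4 / c)) ^ ?d"
      unfolding T_def by (intro mult_left_mono) (simp_all add: mult.assoc)
    moreover have "real (card E') * T \<le> real ?d * (real (card P) * T)"
      using mult_right_mono[OF cardE T] by (simp only: mult.assoc)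
    ultimately show ?thesis by linarith
  qed
  have "(\<Sum>e\<in>E. ennreal (h ^ ?d * (1 / depth D (\<xi> e)) ^ ?d) * indicator (cball (\<xi> e) (depth D (\<xi> e) / 2)) y)
      = (\<Sum>e\<in>E'. ennreal (h ^ ?d * (1 / depth D (\<xi> e)) ^ ?d))"
    by (rule sum.mono_neutral_cong_right) (use E(1) in \<open>auto simp: E'_def indicator_def\<close>)
  also have "\<dots> \<le> (\<Sum>e\<in>E'. ennreal T)"
  proof (intro sum_mono ennreal_leI)
    fix e assume e: "e \<in> E'"
    have "1 / depth D (\<xi> e) \<le> 1 / (2 / 3 * m)"
      using near(1)[OF e] m by (intro divide_left_mono) (auto intro!: mult_pos_pos)
    also have "\<dots> = 3 / (2 * m)" by simp
    finally have "(1 / depth D (\<xi> e)) ^ ?d \<le> (3 / (2 * m)) ^ ?d"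
      by (rule power_mono) (simp add: depth_nonneg)
    then show "h ^ ?d * (1 / depth D (\<xi> e)) ^ ?d \<le> T"
      unfolding T_def using h by (intro mult_left_mono) auto
  qed
  also have "\<dots> = ennreal (real (card E') * T)"
    using T by (simp add: ennreal_mult ennreal_of_nat_eq_real_of_nat)
  also have "\<dots> \<le> ennreal (?d * (3 * (1 + 4 / c)) ^ ?d)" using bound by (rule ennreal_leI)
  finally show ?thesis .
qed

definition exhaustion :: "nat \<Rightarrow> (real ^ 'n) set" where
  "exhaustion n = {z. norm z \<le> real n \<and> inverse (real (Suc n)) \<le> depth D z}"

lemma exhaustion_closed: "closed (exhaustion n)"
  unfolding exhaustion_def by (intro closed_Collect_conj closed_Collect_le continuous_intros)

lemma exhaustion_compact: "compact (exhaustion n)"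
proof -
  have "exhaustion n \<subseteq> cball 0 (real n)" by (auto simp: exhaustion_def)
  then show ?thesis
    using exhaustion_closed bounded_subset[OF bounded_cball] by (auto simp: compact_eq_bounded_closed)
qed

lemma exhaustion_subset: "exhaustion n \<subseteq> D"
proof
  fix z assume "z \<in> exhaustion n"
  then have "inverse (real (Suc n)) \<le> depth D z" by (simp add: exhaustion_def)
  moreover have "inverse (real (Suc n)) > 0" by simp
  ultimately have "depth D z > 0" by linarith
  then show "z \<in> D" by (simp add: depth_pos_iff)
qed

text \<open>The index \<open>2 * n + 1\<close> makes the depth threshold exactly half of that for
  \<open>n\<close> and leaves room in norm for a displacement of 1/2.\<close>

lemma exhaustion_near:
  assumes "y \<in> exhaustion n" "dist z y \<le> 1 / 2" "inverse (real (Suc n)) / 2 \<le> depth D z"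
  shows "z \<in> exhaustion (2 * n + 1)"
proof -
  have "norm z \<le> norm y + dist z y"
    using norm_triangle_ineq[of y "z - y"] by (simp add: dist_norm)
  then have "norm z \<le> real (2 * n + 1)" using assms(1,2) by (simp add: exhaustion_def)
  moreover have "inverse (real (Suc (2 * n + 1))) = inverse (real (Suc n)) / 2"
    by (simp add: field_simps)
  ultimately show ?thesis using assms(3) by (simp add: exhaustion_def)
qed

text \<open>\<open>N\<close> does not depend on the mesh, on the edges or on the chosen points. By
  bounded overlap the sum is at most a constant times the integral of the controlling function over
  the part of \<open>D\<close> outside \<open>exhaustion n\<close>, which tends to 0.\<close>

lemma boundary_energy_small:
  assumes ec: "energy_controlled D \<phi>" and c: "0 < c" and e: "e > 0"
  obtains N where "\<And>k E \<xi>. finite E \<Longrightarrow> E \<subseteq> edge_set D c k \<Longrightarrow>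
    (\<And>e. e \<in> E \<Longrightarrow> \<xi> e \<in> closed_segment (fst e) (fst e + (2 powi (- k)) *\<^sub>R axis (snd e) 1)) \<Longrightarrow>
    (\<And>e. e \<in> E \<Longrightarrow> \<xi> e \<notin> exhaustion N) \<Longrightarrow>
    (\<Sum>e\<in>E. ennreal ((2 powi (- k)) ^ CARD('n) * (partial_deriv (snd e) \<phi> (\<xi> e))\<^sup>2)) \<le> ennreal e"
proof -
  obtain g where g: "g \<in> borel_measurable borel" "\<And>y. y \<notin> D \<Longrightarrow> g y = 0" "(\<integral>\<^sup>+y. g y \<partial>lborel) < \<infinity>"
    "\<And>x. x \<in> D \<Longrightarrow> ennreal ((norm (grad \<phi> x))\<^sup>2) \<le> ennreal ((1 / depth D x) ^ CARD('n)) *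
      (\<integral>\<^sup>+y. indicator (cball x (depth D x / 2)) y * g y \<partial>lborel)"
    using ec unfolding energy_controlled_def by blast
  note [measurable] = g(1)
  define C2 where "C2 = CARD('n) * (3 * (1 + 4 / c)) ^ CARD('n)"
  have C2: "C2 > 0" using c by (simp add: C2_def zero_less_mult_iff add_pos_pos)
  have K_meas [measurable]: "exhaustion n \<in> sets borel" for n using exhaustion_closed by simp
  have "(\<lambda>n. \<integral>\<^sup>+y. indicator (- exhaustion n) y * g y \<partial>lborel) \<longlonglongrightarrow> (\<integral>\<^sup>+y. 0 \<partial>(lborel :: (real ^ 'n) measure))"
  proof (rule nn_integral_dominated_convergence[where w = g])
    show "AE y in lborel. (\<lambda>n. indicator (- exhaustion n) y * g y) \<longlonglongrightarrow> 0"
    proof (rule AE_I2, rule tendsto_eventually)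
      fix y
      show "\<forall>\<^sub>F n in sequentially. indicator (- exhaustion n) y * g y = 0"
      proof (cases "y \<in> D")
        case True
        obtain n1 where n1: "norm y \<le> real n1" using real_arch_simple by blast
        obtain n2 where n2: "inverse (real (Suc n2)) < depth D y"
          using reals_Archimedean[OF depth_pos[OF True]] by blast
        have "y \<in> exhaustion n" if "n \<ge> max n1 n2" for n
        proof -
          have "inverse (real (Suc n)) \<le> inverse (real (Suc n2))" using that by (intro le_imp_inverse_le) auto
          then have "inverse (real (Suc n)) \<le> depth D y" using n2 by linarith
          moreover have "real n1 \<le> real n" using that by simp
          then have "norm y \<le> real n" using n1 by linarith
          ultimately show ?thesis by (simp only: exhaustion_def mem_Collect_eq)
        qed
        then show ?thesis unfolding eventually_sequentially by (intro exI[of _ "max n1 n2"]) simp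
      qed (simp add: g(2))
    qed
    show "AE y in lborel. indicator (- exhaustion n) y * g y \<le> g y" for n
      by (rule AE_I2) (simp add: indicator_def)
  qed (use g in \<open>simp_all\<close>)
  then have lim: "(\<lambda>n. \<integral>\<^sup>+y. indicator (- exhaustion n) y * g y \<partial>lborel) \<longlonglongrightarrow> 0" by simp
  have "0 < ennreal (e / C2)" using e C2 by simp
  from order_tendstoD(2)[OF lim this] obtain n
    where n: "(\<integral>\<^sup>+y. indicator (- exhaustion n) y * g y \<partial>lborel) < ennreal (e / C2)"
    unfolding eventually_sequentially by blast
  show thesis
  proof (rule that[of "2 * n + 1"])
    fix k :: int and E and \<xi> :: "(real ^ 'n) \<times> 'n \<Rightarrow> real ^ 'n"
    assume E: "finite E" "E \<subseteq> edge_set D c k"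
      and \<xi>: "\<And>e. e \<in> E \<Longrightarrow> \<xi> e \<in> closed_segment (fst e) (fst e + (2 powi (- k)) *\<^sub>R axis (snd e) 1)"
      and out: "\<And>e. e \<in> E \<Longrightarrow> \<xi> e \<notin> exhaustion (2 * n + 1)"
    let ?h = "2 powi (- k) :: real" and ?d = "CARD('n)"
    let ?I = "\<lambda>e y. indicator (cball (\<xi> e) (depth D (\<xi> e) / 2)) y :: ennreal"
    define a where "a e = ennreal (?h ^ ?d * (1 / depth D (\<xi> e)) ^ ?d)" for e
    have [measurable]: "cball (\<xi> e) (depth D (\<xi> e) / 2) \<in> sets borel" for e by simp
    have \<xi>D: "\<xi> e \<in> D" if "e \<in> E" for e
    proof -
      have "c * ?h \<le> depth D (\<xi> e)"
        using E(2) \<xi>[OF that] that unfolding edge_set_def by (cases e) auto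
      moreover have "c * ?h > 0" using c by simp
      ultimately have "depth D (\<xi> e) > 0" by linarith
      then show ?thesis by (simp add: depth_pos_iff)
    qed
    have "(\<Sum>e\<in>E. ennreal (?h ^ ?d * (partial_deriv (snd e) \<phi> (\<xi> e))\<^sup>2))
        \<le> (\<Sum>e\<in>E. \<integral>\<^sup>+y. a e * ?I e y * g y \<partial>lborel)"
    proof (rule sum_mono)
      fix e assume e: "e \<in> E"
      have "(partial_deriv (snd e) \<phi> (\<xi> e))\<^sup>2 \<le> (norm (grad \<phi> (\<xi> e)))\<^sup>2"
        unfolding norm_grad_sq by (rule member_le_sum) auto
      then have "ennreal ((partial_deriv (snd e) \<phi> (\<xi> e))\<^sup>2) \<le> ennreal ((1 / depth D (\<xi> e)) ^ ?d) *
          (\<integral>\<^sup>+y. ?I e y * g y \<partial>lborel)"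
        using g(4)[OF \<xi>D[OF e]] by (meson ennreal_leI order_trans)
      then have "ennreal (?h ^ ?d) * ennreal ((partial_deriv (snd e) \<phi> (\<xi> e))\<^sup>2)
          \<le> ennreal (?h ^ ?d) * (ennreal ((1 / depth D (\<xi> e)) ^ ?d) * (\<integral>\<^sup>+y. ?I e y * g y \<partial>lborel))"
        by (rule mult_left_mono) simp
      also have "\<dots> = a e * (\<integral>\<^sup>+y. ?I e y * g y \<partial>lborel)"
        unfolding a_def using depth_nonneg[of D "\<xi> e"] by (subst ennreal_mult) (auto simp: mult.assoc)
      also have "\<dots> = (\<integral>\<^sup>+y. a e * (?I e y * g y) \<partial>lborel)"
        by (rule nn_integral_cmult[symmetric]) measurable
      finally show "ennreal (?h ^ ?d * (partial_deriv (snd e) \<phi> (\<xi> e))\<^sup>2) \<le> (\<integral>\<^sup>+y. a e * ?I e y * g y \<partial>lborel)"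
        by (simp add: ennreal_mult mult.assoc)
    qed
    also have "\<dots> = (\<integral>\<^sup>+y. (\<Sum>e\<in>E. a e * ?I e y * g y) \<partial>lborel)"
      by (rule nn_integral_sum[symmetric]) measurable
    also have "\<dots> \<le> (\<integral>\<^sup>+y. ennreal C2 * (indicator (- exhaustion n) y * g y) \<partial>lborel)"
    proof (rule nn_integral_mono)
      fix y
      have eq: "(\<Sum>e\<in>E. a e * ?I e y * g y) = (\<Sum>e\<in>E. a e * ?I e y) * g y"
        by (rule sum_distrib_right[symmetric])
      consider "y \<notin> D" | "y \<in> exhaustion n" | "y \<in> D" "y \<notin> exhaustion n" by blast
      then show "(\<Sum>e\<in>E. a e * ?I e y * g y) \<le> ennreal C2 * (indicator (- exhaustion n) y * g y)"
      proof cases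
        case 1
        then show ?thesis by (simp add: g(2))
      next
        case 2
        \<comment> \<open>A ball that meets \<open>exhaustion n\<close> has its centre in
          \<open>exhaustion (2 * n + 1)\<close>, by comparability of depths.\<close>
        have "?I e y = 0" if e: "e \<in> E" for e
        proof (rule ccontr)
          assume "?I e y \<noteq> 0"
          then have d: "dist (\<xi> e) y \<le> depth D (\<xi> e) / 2" by (auto simp: indicator_def split: if_splits)
          then have "dist (\<xi> e) y \<le> 1 / 2" using depth_le_1[of D "\<xi> e"] by linarith
          moreover have "inverse (real (Suc n)) \<le> depth D y" using 2 by (simp add: exhaustion_def)
          then have "inverse (real (Suc n)) / 2 \<le> depth D (\<xi> e)"
            using depth_comparable(1)[OF d] depth_nonneg[of D y] by linarith
          ultimately show False using exhaustion_near[OF 2] out[OF e] by blast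
        qed
        then show ?thesis unfolding eq by simp
      next
        case 3
        have "(\<Sum>e\<in>E. a e * ?I e y) \<le> ennreal C2"
          unfolding a_def C2_def by (rule local_average_overlap[OF c E \<xi> 3(1)])
        then show ?thesis unfolding eq using 3(2) by (simp add: mult_right_mono)
      qed
    qed
    also have "\<dots> = ennreal C2 * (\<integral>\<^sup>+y. indicator (- exhaustion n) y * g y \<partial>lborel)"
      by (rule nn_integral_cmult) measurable
    also have "\<dots> \<le> ennreal C2 * ennreal (e / C2)" using n by (intro mult_left_mono) auto
    also have "\<dots> = ennreal e" using C2 e by (simp add: ennreal_mult[symmetric])
    finally show "(\<Sum>e\<in>E. ennreal (?h ^ ?d * (partial_deriv (snd e) \<phi> (\<xi> e))\<^sup>2)) \<le> ennreal e" .
  qed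
qed

text \<open>The squared derivative at the chosen edge point is compared with its values on the whole
  cell, up to an error from uniform continuity on a slightly larger compact set. Integrating over
  disjoint cells for each direction gives the energy itself.\<close>

lemma interior_energy:
  assumes \<phi>: "\<phi> \<in> Cinf D" and L2: "\<And>i. zero_ext D (partial_deriv i \<phi>) \<in> L2_supp D" and \<epsilon>: "\<epsilon> > 0"
  obtains k0 :: nat where "\<And>k E \<xi>. k \<ge> int k0 \<Longrightarrow> finite E \<Longrightarrow> E \<subseteq> edge_set D c k \<Longrightarrow>
    (\<And>e. e \<in> E \<Longrightarrow> \<xi> e \<in> closed_segment (fst e) (fst e + (2 powi (- k)) *\<^sub>R axis (snd e) 1)) \<Longrightarrow>
    (\<And>e. e \<in> E \<Longrightarrow> \<xi> e \<in> exhaustion N) \<Longrightarrow>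
    (\<Sum>e\<in>E. ennreal ((2 powi (- k)) ^ CARD('n) * (partial_deriv (snd e) \<phi> (\<xi> e))\<^sup>2))
      \<le> ennreal ((\<Sum>i\<in>UNIV. L2sq (zero_ext D (partial_deriv i \<phi>))) + \<epsilon>)"
proof -
  let ?d = "CARD('n)"
  define K where "K = exhaustion (2 * N + 1)"
  define V where "V = measure lborel D"
  have V: "V \<ge> 0" "emeasure lborel D = ennreal V"
    using finite_D by (auto simp: V_def emeasure_eq_ennreal_measure less_top)
  \<comment> \<open>The error is incurred once per direction on all of \<open>D\<close>, in total
    \<open>?d * (\<epsilon>' * V)\<close>.\<close>
  define \<epsilon>' where "\<epsilon>' = \<epsilon> / (?d * (V + 1))"
  have \<epsilon>': "\<epsilon>' > 0" using \<epsilon> V(1) by (simp add: \<epsilon>'_def)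
  have "\<exists>\<delta>>0. \<forall>z\<in>K. \<forall>x\<in>K. dist z x < \<delta> \<longrightarrow> dist ((partial_deriv i \<phi> z)\<^sup>2) ((partial_deriv i \<phi> x)\<^sup>2) < \<epsilon>'" for i
  proof -
    have "continuous_on K (\<lambda>z. (partial_deriv i \<phi> z)\<^sup>2)"
      by (intro continuous_on_power continuous_on_subset[OF Cinf_continuous[OF Cinf_partial_deriv[OF \<phi>]]])
        (simp add: K_def exhaustion_subset)
    then have "uniformly_continuous_on K (\<lambda>z. (partial_deriv i \<phi> z)\<^sup>2)"
      by (rule compact_uniformly_continuous) (simp add: K_def exhaustion_compact)
    then show ?thesis using \<epsilon>' unfolding uniformly_continuous_on_def by (metis dist_commute)
  qed
  then have "\<forall>i. \<exists>\<delta>. \<delta> > 0 \<and> (\<forall>z\<in>K. \<forall>x\<in>K. dist z x < \<delta> \<longrightarrow>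
      dist ((partial_deriv i \<phi> z)\<^sup>2) ((partial_deriv i \<phi> x)\<^sup>2) < \<epsilon>')" by blast
  from choice[OF this] obtain \<delta> where \<delta>: "\<And>i. \<delta> i > 0"
    "\<And>i z x. z \<in> K \<Longrightarrow> x \<in> K \<Longrightarrow> dist z x < \<delta> i \<Longrightarrow>
      dist ((partial_deriv i \<phi> z)\<^sup>2) ((partial_deriv i \<phi> x)\<^sup>2) < \<epsilon>'" by blast
  \<comment> \<open>The second bound keeps cells near \<open>exhaustion N\<close> inside
    \<open>K\<close>, where uniform continuity is available.\<close>
  define \<delta>0 where "\<delta>0 = min (Min (range \<delta>)) (inverse (real (Suc N)) / 2)"
  have \<delta>0: "\<delta>0 > 0" "\<And>i. \<delta>0 \<le> \<delta> i" "\<delta>0 \<le> inverse (real (Suc N)) / 2"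
    using \<delta>(1) by (auto simp: \<delta>0_def min_le_iff_disj)
  obtain k0 where k0: "(1/2 :: real) ^ k0 < \<delta>0 / ?d"
    using real_arch_pow_inv[of "\<delta>0 / ?d" "1/2"] \<delta>0(1) by auto
  define u where "u i z = ennreal ((zero_ext D (partial_deriv i \<phi>) z)\<^sup>2 + \<epsilon>' * indicator D z)" for i z
  have u_meas [measurable]: "u i \<in> borel_measurable borel" for i
    unfolding u_def[abs_def] using L2_supp_measurable[OF L2] by measurable
  have u_int: "(\<integral>\<^sup>+z. u i z \<partial>lborel) = ennreal (L2sq (zero_ext D (partial_deriv i \<phi>)) + \<epsilon>' * V)" for i
  proof -
    have ind: "integrable lborel (indicator D :: real ^ 'n \<Rightarrow> real)"
      using finite_D by (simp add: integrable_indicator_iff)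
    have int: "integrable lborel (\<lambda>z. (zero_ext D (partial_deriv i \<phi>) z)\<^sup>2 + \<epsilon>' * indicator D z)"
      using L2_supp_sq_integrable[OF L2] ind by simp
    have "(\<integral>\<^sup>+z. u i z \<partial>lborel) = ennreal (LINT z|lborel. (zero_ext D (partial_deriv i \<phi>) z)\<^sup>2 + \<epsilon>' * indicator D z)"
      unfolding u_def using \<epsilon>' by (intro nn_integral_eq_integral int) simp
    also have "(LINT z|lborel. (zero_ext D (partial_deriv i \<phi>) z)\<^sup>2 + \<epsilon>' * indicator D z)
        = L2sq (zero_ext D (partial_deriv i \<phi>)) + \<epsilon>' * V"
      using L2_supp_sq_integrable[OF L2] ind by (simp add: L2sq_def V_def)
    finally show ?thesis .
  qed
  show thesis
  proof (rule that[of k0])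
    fix k :: int and E and \<xi> :: "(real ^ 'n) \<times> 'n \<Rightarrow> real ^ 'n"
    assume k: "k \<ge> int k0" and E: "finite E" "E \<subseteq> edge_set D c k"
      and \<xi>: "\<And>e. e \<in> E \<Longrightarrow> \<xi> e \<in> closed_segment (fst e) (fst e + (2 powi (- k)) *\<^sub>R axis (snd e) 1)"
      and inside: "\<And>e. e \<in> E \<Longrightarrow> \<xi> e \<in> exhaustion N"
    let ?h = "2 powi (- k) :: real"
    have h: "?h > 0" by simp
    have "?h \<le> 2 powi (- int k0)" using k by (intro power_int_increasing) auto
    also have "\<dots> = (1/2) ^ k0" by (simp add: power_int_minus power_one_over inverse_eq_divide)
    finally have "?d * ?h \<le> ?d * (1/2) ^ k0" by (rule mult_left_mono) simp
    also have "\<dots> < \<delta>0" using k0 by (simp add: pos_less_divide_eq mult.commute)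
    finally have hd: "?d * ?h < \<delta>0" .
    have cell_bound: "(partial_deriv (snd e) \<phi> (\<xi> e))\<^sup>2 \<le> (zero_ext D (partial_deriv (snd e) \<phi>) z)\<^sup>2 + \<epsilon>' * indicator D z"
      if e: "e \<in> E" and z: "z \<in> cell ?h (fst e)" for e z
    proof -
      have "norm (z - \<xi> e) \<le> (\<Sum>j\<in>UNIV. \<bar>(z - \<xi> e) $ j\<bar>)" by (rule norm_le_l1_cart)
      also have "\<dots> \<le> (\<Sum>j\<in>(UNIV :: 'n set). ?h)"
        using edge_point_near_cell[OF \<xi>[OF e] z h] by (intro sum_mono) simp
      finally have near: "dist z (\<xi> e) < \<delta>0" using hd by (simp add: dist_norm)
      have \<xi>K: "\<xi> e \<in> exhaustion N" by (rule inside[OF e])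
      then have dep: "inverse (real (Suc N)) \<le> depth D (\<xi> e)" by (simp add: exhaustion_def)
      have "inverse (real (Suc N)) \<le> 1" by (simp add: field_simps)
      then have "dist z (\<xi> e) \<le> 1 / 2" using near \<delta>0(3) by linarith
      moreover have "inverse (real (Suc N)) / 2 \<le> depth D z"
        using depth_Lipschitz[of D "\<xi> e" z] dep near \<delta>0(3) dist_commute[of z "\<xi> e"] by linarith
      ultimately have zK: "z \<in> K" unfolding K_def by (rule exhaustion_near[OF \<xi>K])
      have pos: "inverse (real (Suc N)) > 0" by simp
      have \<xi>K': "\<xi> e \<in> K"
      proof -
        have "dist (\<xi> e) (\<xi> e) \<le> 1 / 2" by simp
        moreover have "inverse (real (Suc N)) / 2 \<le> depth D (\<xi> e)" using dep pos by linarith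
        ultimately show ?thesis unfolding K_def by (rule exhaustion_near[OF \<xi>K])
      qed
      have "dist ((partial_deriv (snd e) \<phi> z)\<^sup>2) ((partial_deriv (snd e) \<phi> (\<xi> e))\<^sup>2) < \<epsilon>'"
        using near \<delta>0(2)[of "snd e"] by (intro \<delta>(2)[OF zK \<xi>K']) linarith
      moreover have "z \<in> D" using zK exhaustion_subset by (auto simp: K_def)
      ultimately show ?thesis by (simp add: zero_ext_def dist_real_def)
    qed
    have "(\<Sum>e\<in>E. ennreal (?h ^ ?d * (partial_deriv (snd e) \<phi> (\<xi> e))\<^sup>2))
        \<le> (\<Sum>e\<in>E. \<integral>\<^sup>+z. indicator (cell ?h (fst e)) z * u (snd e) z \<partial>lborel)"
    proof (rule sum_mono)
      fix e assume e: "e \<in> E"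
      let ?a = "(partial_deriv (snd e) \<phi> (\<xi> e))\<^sup>2"
      have "ennreal (?h ^ ?d * ?a) = ennreal ?a * emeasure lborel (cell ?h (fst e))"
        unfolding emeasure_cell[OF h] by (simp add: ennreal_mult mult.commute)
      also have "\<dots> = (\<integral>\<^sup>+z. ennreal ?a * indicator (cell ?h (fst e)) z \<partial>lborel)"
        by (rule nn_integral_cmult_indicator[symmetric]) simp
      also have "\<dots> \<le> (\<integral>\<^sup>+z. indicator (cell ?h (fst e)) z * u (snd e) z \<partial>lborel)"
      proof (rule nn_integral_mono)
        fix z
        show "ennreal ?a * indicator (cell ?h (fst e)) z \<le> indicator (cell ?h (fst e)) z * u (snd e) z"
          using cell_bound[OF e, of z] by (cases "z \<in> cell ?h (fst e)") (simp_all add: u_def ennreal_leI)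
      qed
      finally show "ennreal (?h ^ ?d * ?a) \<le> (\<integral>\<^sup>+z. indicator (cell ?h (fst e)) z * u (snd e) z \<partial>lborel)" .
    qed
    also have "\<dots> = (\<integral>\<^sup>+z. (\<Sum>e\<in>E. indicator (cell ?h (fst e)) z * u (snd e) z) \<partial>lborel)"
      by (rule nn_integral_sum[symmetric]) measurable
    also have "\<dots> \<le> (\<integral>\<^sup>+z. (\<Sum>i\<in>UNIV. u i z) \<partial>lborel)"
    proof (rule nn_integral_mono)
      fix z
      \<comment> \<open>A point lies in the cell of at most one grid point, so among the edges
        counted at \<open>z\<close> there is at most one per direction.\<close>
      define E' where "E' = {e \<in> E. z \<in> cell ?h (fst e)}"
      have "inj_on snd E'"
      proof (rule inj_onI)
        fix e e' assume ee: "e \<in> E'" "e' \<in> E'" "snd e = snd e'"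
        have g: "fst e \<in> grid k" "fst e' \<in> grid k" using ee E(2) by (auto simp: E'_def edge_set_def)
        have "fst e = fst e'"
          using grid_cells_disjoint[OF g, of z] ee by (simp add: E'_def)
        then show "e = e'" using ee(3) by (rule prod_eqI)
      qed
      have "(\<Sum>e\<in>E. indicator (cell ?h (fst e)) z * u (snd e) z) = (\<Sum>e\<in>E'. u (snd e) z)"
        by (rule sum.mono_neutral_cong_right) (use E(1) in \<open>auto simp: E'_def indicator_def\<close>)
      also have "\<dots> = (\<Sum>i\<in>snd ` E'. u i z)" by (rule sum.reindex_cong[OF \<open>inj_on snd E'\<close> refl, symmetric]) simp
      also have "\<dots> \<le> (\<Sum>i\<in>UNIV. u i z)" by (intro sum_mono2) auto
      finally show "(\<Sum>e\<in>E. indicator (cell ?h (fst e)) z * u (snd e) z) \<le> (\<Sum>i\<in>UNIV. u i z)" .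
    qed
    also have "\<dots> = (\<Sum>i\<in>UNIV. \<integral>\<^sup>+z. u i z \<partial>lborel)" by (rule nn_integral_sum) measurable
    also have "\<dots> = ennreal ((\<Sum>i\<in>UNIV. L2sq (zero_ext D (partial_deriv i \<phi>))) + ?d * (\<epsilon>' * V))"
    proof -
      have "0 \<le> L2sq (zero_ext D (partial_deriv i \<phi>)) + \<epsilon>' * V" for i
        using V(1) \<epsilon>' by (intro add_nonneg_nonneg mult_nonneg_nonneg L2sq_nonneg) auto
      then show ?thesis unfolding u_int by (subst sum_ennreal) (simp_all only: sum.distrib sum_constant)
    qed
    also have "\<dots> \<le> ennreal ((\<Sum>i\<in>UNIV. L2sq (zero_ext D (partial_deriv i \<phi>))) + \<epsilon>)"
    proof (intro ennreal_leI add_left_mono)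
      have "?d * (\<epsilon>' * V) \<le> ?d * (\<epsilon>' * (V + 1))" using \<epsilon>' by (intro mult_left_mono) auto
      also have "\<dots> = \<epsilon>" using V(1) by (simp add: \<epsilon>'_def)
      finally show "?d * (\<epsilon>' * V) \<le> \<epsilon>" .
    qed
    finally show "(\<Sum>e\<in>E. ennreal (?h ^ ?d * (partial_deriv (snd e) \<phi> (\<xi> e))\<^sup>2))
      \<le> ennreal ((\<Sum>i\<in>UNIV. L2sq (zero_ext D (partial_deriv i \<phi>))) + \<epsilon>)" .
  qed
qed

text \<open>The reason for the exponent in the normalisation: it turns the squared edge length of
  the mean value theorem into the volume of a cell.\<close>

lemma power_scaling: "2 powi (k * (2 - int d)) * ((2 powi (- k))\<^sup>2 * a) = (2 powi (- k)) ^ d * (a :: real)"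
proof -
  have "(2 powi (- k))\<^sup>2 = (2 :: real) powi ((- k) * 2)"
    by (simp only: power_int_mult power_int_numeral)
  then have "2 powi (k * (2 - int d)) * (2 powi (- k))\<^sup>2 = (2 :: real) powi (k * (2 - int d) + (- k) * 2)"
    by (simp add: power_int_add del: mult_minus_left)
  also have "k * (2 - int d) + (- k) * 2 = (- k) * int d" by (simp add: algebra_simps)
  also have "(2 :: real) powi \<dots> = (2 powi (- k)) ^ d" by (simp only: power_int_mult power_int_of_nat)
  finally show ?thesis by (simp add: mult.assoc[symmetric])
qed

text \<open>Edges are split by whether their mean value point lies in \<open>exhaustion N\<close>.
  The two parts are at most \<open>S + e / 4\<close> and \<open>e / 4\<close>, and the two
  orientations double the total to at most \<open>2 * S + e\<close>. \<open>N\<close> is fixed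
  before the mesh is refined.\<close>

lemma discrete_energy_limsup:
  assumes \<phi>: "\<phi> \<in> approximants D" and c: "0 < c" "c < 1"
  shows "Limsup at_top (\<lambda>k::int. ereal (2 powi (k * (2 - int CARD('n))) *
      (\<Sum>(x, y)\<in>grid_edges D c x0 k. (\<phi> x - \<phi> y)\<^sup>2)))
    \<le> ereal (2 * (\<Sum>i\<in>UNIV. L2sq (zero_ext D (partial_deriv i \<phi>))))"
proof (rule ereal_le_epsilon2)
  fix e :: real assume e: "e > 0"
  let ?d = "CARD('n)"
  define S where "S = (\<Sum>i\<in>UNIV. L2sq (zero_ext D (partial_deriv i \<phi>)))"
  have S: "S \<ge> 0" unfolding S_def by (intro sum_nonneg L2sq_nonneg)
  have Cinf: "\<phi> \<in> Cinf D" and ec: "energy_controlled D \<phi>" using \<phi> by (auto simp: approximants_def)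
  have e4: "e / 4 > 0" using e by simp
  show "Limsup at_top (\<lambda>k::int. ereal (2 powi (k * (2 - int ?d)) *
      (\<Sum>(x, y)\<in>grid_edges D c x0 k. (\<phi> x - \<phi> y)\<^sup>2)))
    \<le> ereal (2 * (\<Sum>i\<in>UNIV. L2sq (zero_ext D (partial_deriv i \<phi>)))) + ereal e"
  proof (rule boundary_energy_small[OF ec c(1) e4])
    fix N
    assume tail: "\<And>k E \<xi>. finite E \<Longrightarrow> E \<subseteq> edge_set D c k \<Longrightarrow>
      (\<And>e. e \<in> E \<Longrightarrow> \<xi> e \<in> closed_segment (fst e) (fst e + (2 powi (- k)) *\<^sub>R axis (snd e) 1)) \<Longrightarrow>
      (\<And>e. e \<in> E \<Longrightarrow> \<xi> e \<notin> exhaustion N) \<Longrightarrow>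
      (\<Sum>e\<in>E. ennreal ((2 powi (- k)) ^ ?d * (partial_deriv (snd e) \<phi> (\<xi> e))\<^sup>2)) \<le> ennreal (e / 4)"
    show ?thesis
    proof (rule interior_energy[OF Cinf energy_controlled_L2[OF Cinf ec] e4, of c N])
      fix k0 :: nat
      assume main: "\<And>k E \<xi>. k \<ge> int k0 \<Longrightarrow> finite E \<Longrightarrow> E \<subseteq> edge_set D c k \<Longrightarrow>
        (\<And>e. e \<in> E \<Longrightarrow> \<xi> e \<in> closed_segment (fst e) (fst e + (2 powi (- k)) *\<^sub>R axis (snd e) 1)) \<Longrightarrow>
        (\<And>e. e \<in> E \<Longrightarrow> \<xi> e \<in> exhaustion N) \<Longrightarrow>
        (\<Sum>e\<in>E. ennreal ((2 powi (- k)) ^ ?d * (partial_deriv (snd e) \<phi> (\<xi> e))\<^sup>2))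
          \<le> ennreal ((\<Sum>i\<in>UNIV. L2sq (zero_ext D (partial_deriv i \<phi>))) + e / 4)"
      have bound: "2 powi (k * (2 - int ?d)) * (\<Sum>(x, y)\<in>grid_edges D c x0 k. (\<phi> x - \<phi> y)\<^sup>2) \<le> 2 * S + e"
        if k: "k \<ge> int k0" for k :: int
      proof -
        let ?h = "2 powi (- k) :: real"
        have k': "k \<ge> 0" using k by simp
        show ?thesis
        proof (rule edge_sum_le[where ?x0.0 = x0 and \<phi> = \<phi>, OF k' c])
          fix E
          assume E: "finite E" "E \<subseteq> edge_set D c k"
            and le: "(\<Sum>(x, y)\<in>grid_edges D c x0 k. (\<phi> x - \<phi> y)\<^sup>2)
              \<le> 2 * (\<Sum>(p, i)\<in>E. (\<phi> (p + ?h *\<^sub>R axis i 1) - \<phi> p)\<^sup>2)"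
          have "\<exists>\<xi>. \<xi> \<in> closed_segment (fst e) (fst e + ?h *\<^sub>R axis (snd e) 1) \<and>
            (\<phi> (fst e + ?h *\<^sub>R axis (snd e) 1) - \<phi> (fst e))\<^sup>2 = ?h\<^sup>2 * (partial_deriv (snd e) \<phi> \<xi>)\<^sup>2"
            if "e \<in> E" for e
          proof -
            have "(fst e, snd e) \<in> edge_set D c k" using that E(2) by auto
            from edge_mean_value[OF this c(1) Cinf] show ?thesis by blast
          qed
          then have "\<forall>e\<in>E. \<exists>\<xi>. \<xi> \<in> closed_segment (fst e) (fst e + ?h *\<^sub>R axis (snd e) 1) \<and>
            (\<phi> (fst e + ?h *\<^sub>R axis (snd e) 1) - \<phi> (fst e))\<^sup>2 = ?h\<^sup>2 * (partial_deriv (snd e) \<phi> \<xi>)\<^sup>2"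
            by blast
          from bchoice[OF this] obtain \<xi> where \<xi>:
            "\<And>e. e \<in> E \<Longrightarrow> \<xi> e \<in> closed_segment (fst e) (fst e + ?h *\<^sub>R axis (snd e) 1)"
            "\<And>e. e \<in> E \<Longrightarrow> (\<phi> (fst e + ?h *\<^sub>R axis (snd e) 1) - \<phi> (fst e))\<^sup>2 = ?h\<^sup>2 * (partial_deriv (snd e) \<phi> (\<xi> e))\<^sup>2"
            by blast
          define t where "t e = ?h ^ ?d * (partial_deriv (snd e) \<phi> (\<xi> e))\<^sup>2" for e
          have t0: "t e \<ge> 0" for e by (simp add: t_def)
          define E1 where "E1 = {e \<in> E. \<xi> e \<in> exhaustion N}"
          define E2 where "E2 = {e \<in> E. \<xi> e \<notin> exhaustion N}"
          have fin: "finite E1" "finite E2" and sub: "E1 \<subseteq> E" "E2 \<subseteq> E"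
            using E(1) by (auto simp: E1_def E2_def)
          have "(\<Sum>e\<in>E1. ennreal (t e)) \<le> ennreal (S + e / 4)"
            unfolding t_def S_def using E(2) sub \<xi>(1) by (intro main[OF k fin(1)]) (auto simp: E1_def)
          then have "ennreal (sum t E1) \<le> ennreal (S + e / 4)" unfolding sum_ennreal[OF t0] .
          then have "sum t E1 \<le> S + e / 4"
            by (rule iffD1[OF ennreal_le_iff, rotated]) (use S e in simp)
          moreover have "(\<Sum>e\<in>E2. ennreal (t e)) \<le> ennreal (e / 4)"
            unfolding t_def using E(2) sub \<xi>(1) by (intro tail[OF fin(2)]) (auto simp: E2_def)
          then have "ennreal (sum t E2) \<le> ennreal (e / 4)" unfolding sum_ennreal[OF t0] .
          then have "sum t E2 \<le> e / 4"
            by (rule iffD1[OF ennreal_le_iff, rotated]) (use e in simp)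
          moreover have "sum t E = sum t E1 + sum t E2"
          proof -
            have "E = E1 \<union> E2" "E1 \<inter> E2 = {}" by (auto simp: E1_def E2_def)
            then show ?thesis using fin by (simp add: sum.union_disjoint)
          qed
          ultimately have sumE: "sum t E \<le> S + e / 2" by linarith
          have "2 powi (k * (2 - int ?d)) * (\<Sum>(x, y)\<in>grid_edges D c x0 k. (\<phi> x - \<phi> y)\<^sup>2)
              \<le> 2 powi (k * (2 - int ?d)) * (2 * (\<Sum>(p, i)\<in>E. (\<phi> (p + ?h *\<^sub>R axis i 1) - \<phi> p)\<^sup>2))"
            by (intro mult_left_mono le) simp
          also have "(\<Sum>(p, i)\<in>E. (\<phi> (p + ?h *\<^sub>R axis i 1) - \<phi> p)\<^sup>2)
              = (\<Sum>e\<in>E. ?h\<^sup>2 * (partial_deriv (snd e) \<phi> (\<xi> e))\<^sup>2)"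
            unfolding case_prod_beta by (intro sum.cong refl \<xi>(2))
          also have "2 powi (k * (2 - int ?d)) * (2 * (\<Sum>e\<in>E. ?h\<^sup>2 * (partial_deriv (snd e) \<phi> (\<xi> e))\<^sup>2))
              = 2 * (\<Sum>e\<in>E. 2 powi (k * (2 - int ?d)) * (?h\<^sup>2 * (partial_deriv (snd e) \<phi> (\<xi> e))\<^sup>2))"
            unfolding sum_distrib_left[symmetric] by (rule mult.left_commute)
          also have "\<dots> = 2 * sum t E" unfolding power_scaling t_def ..
          finally show ?thesis using sumE by linarith
        qed
      qed
      show ?thesis
      proof (rule Limsup_bounded)
        show "\<forall>\<^sub>F k in at_top. ereal (2 powi (k * (2 - int ?d)) *
            (\<Sum>(x, y)\<in>grid_edges D c x0 k. (\<phi> x - \<phi> y)\<^sup>2))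
          \<le> ereal (2 * (\<Sum>i\<in>UNIV. L2sq (zero_ext D (partial_deriv i \<phi>)))) + ereal e"
          using eventually_ge_at_top[of "int k0"]
        proof eventually_elim
          case (elim k)
          show ?case using bound[OF elim] by (simp add: S_def)
        qed
      qed
    qed
  qed
qed

section \<open>The dense sequence\<close>

lemma continuous_lebesgue_on_measurable:
  fixes u :: "real ^ 'n \<Rightarrow> real"
  assumes "continuous_on D u" shows "u \<in> borel_measurable (lebesgue_on D)"
  by (rule continuous_imp_measurable_on_sets_lebesgue[OF assms D_lebesgue])

lemma approximants_subset_W12:
  assumes "\<phi> \<in> approximants D" shows "\<phi> \<in> W12 D"
proof -
  have "\<phi> \<in> Cinf D" using assms by (simp add: approximants_def)
  then have m: "\<phi> \<in> borel_measurable (lebesgue_on D)"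
    by (intro continuous_lebesgue_on_measurable Cinf_continuous)
  have "AE x in lborel. x \<in> D \<longrightarrow> \<phi> x = zero_ext D \<phi> x" by (simp add: zero_ext_def)
  from weak_grad_rep_imp_W12[OF approximants_weak_grad_rep[OF assms] m this]
  show ?thesis unfolding W12_def by blast
qed

lemma approximants_energy:
  assumes "\<phi> \<in> approximants D"
  shows "(LINT x|lebesgue_on D. (norm (grad \<phi> x))\<^sup>2) = (\<Sum>i\<in>UNIV. L2sq (zero_ext D (partial_deriv i \<phi>)))"
proof -
  have Cinf: "\<phi> \<in> Cinf D" using assms by (simp add: approximants_def)
  have L2: "zero_ext D (partial_deriv i \<phi>) \<in> L2_supp D" for i
    using approximants_weak_grad_rep[OF assms] by (simp add: weak_grad_rep_def)
  note [measurable] = L2_supp_measurable[OF L2]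
  have "(LINT x|lebesgue_on D. (norm (grad \<phi> x))\<^sup>2)
      = (LINT x|lborel. (\<Sum>i\<in>UNIV. (zero_ext D (partial_deriv i \<phi>) x)\<^sup>2))"
  proof (rule integral_lebesgue_on_rep)
    show "(\<lambda>x. (norm (grad \<phi> x))\<^sup>2) \<in> borel_measurable (lebesgue_on D)"
      unfolding norm_grad_sq
      by (intro continuous_lebesgue_on_measurable continuous_on_sum continuous_on_power
          Cinf_continuous Cinf_partial_deriv Cinf)
    show "AE x in lborel. x \<in> D \<longrightarrow> (norm (grad \<phi> x))\<^sup>2 = (\<Sum>i\<in>UNIV. (zero_ext D (partial_deriv i \<phi>) x)\<^sup>2)"
      unfolding norm_grad_sq by (simp add: zero_ext_def)
  qed (measurable, simp add: zero_ext_def)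
  also have "\<dots> = (\<Sum>i\<in>UNIV. L2sq (zero_ext D (partial_deriv i \<phi>)))"
    unfolding L2sq_def by (rule Bochner_Integration.integral_sum) (rule L2_supp_sq_integrable[OF L2])
  finally show ?thesis .
qed

end

lemma sum_UNIV_option:
  fixes f :: "'a :: finite option \<Rightarrow> real"
  shows "(\<Sum>j\<in>UNIV. f j) = f None + (\<Sum>i\<in>UNIV. f (Some i))"
  by (simp add: UNIV_option_conv sum.reindex)

text \<open>Dividing a differing coordinate by a large integer brings both values into [-1, 1],
  where the sine is injective.\<close>

lemma sin_component_separates:
  fixes x y :: "real ^ 'n"
  assumes "x \<noteq> y"
  obtains i N where "sin (x $ i * inverse (real (Suc N))) \<noteq> sin (y $ i * inverse (real (Suc N)))"
proof -
  obtain i where i: "x $ i \<noteq> y $ i" using assms by (auto simp: vec_eq_iff)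
  obtain N where N: "max \<bar>x $ i\<bar> \<bar>y $ i\<bar> \<le> real N" using real_arch_simple by blast
  have le: "\<bar>t * inverse (real (Suc N))\<bar> \<le> pi / 2" if "\<bar>t\<bar> \<le> real N" for t
  proof -
    have "\<bar>t * inverse (real (Suc N))\<bar> = \<bar>t\<bar> / real (Suc N)" by (simp add: abs_mult divide_inverse)
    also have "\<dots> \<le> 1" using that by (simp add: pos_divide_le_eq)
    finally show ?thesis using pi_gt3 by linarith
  qed
  have "x $ i * inverse (real (Suc N)) \<noteq> y $ i * inverse (real (Suc N))" using i by simp
  moreover have "\<bar>x $ i * inverse (real (Suc N))\<bar> \<le> pi / 2" "\<bar>y $ i * inverse (real (Suc N))\<bar> \<le> pi / 2"
    by (rule le, use N in simp)+
  ultimately have "sin (x $ i * inverse (real (Suc N))) \<noteq> sin (y $ i * inverse (real (Suc N)))"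
    by (metis sin_inj_pi abs_le_iff minus_le_iff)
  then show thesis by (rule that)
qed

section \<open>Choice of a countable dense family\<close>

context mollification
begin

text \<open>Separability passes to subsets: for each element \<open>q\<close> of a countable dense
  set of tuples and each \<open>n\<close>, one approximant within \<open>1 / Suc n\<close> of
  \<open>q\<close> is picked whenever there is one. The tuples \<open>q\<close> themselves need not
  come from any function.\<close>

lemma dense_sequence:
  obtains \<Phi> :: "nat \<Rightarrow> real ^ 'n \<Rightarrow> real" where "\<And>j. \<Phi> j \<in> approximants D"
    "\<And>f e. f \<in> W12 D \<Longrightarrow> e > 0 \<Longrightarrow> \<exists>j. W12_norm D (\<lambda>x. f x - \<Phi> j x) < e"
    "\<And>x y. x \<noteq> y \<Longrightarrow> \<exists>j. \<Phi> j x \<noteq> \<Phi> j y"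
proof -
  \<comment> \<open>The index type \<open>'n option\<close> holds the function at
    \<open>None\<close> and its partial derivatives at \<open>Some i\<close>, so that the Sobolev
    distance becomes a sum of L2 distances.\<close>
  define jet where "jet \<phi> = case_option (zero_ext D \<phi>) (\<lambda>i. zero_ext D (partial_deriv i \<phi>))" for \<phi>
  define E where "E u v = (\<Sum>j\<in>UNIV. L2sq (\<lambda>x. u j x - v j x))" for u v :: "'n option \<Rightarrow> real ^ 'n \<Rightarrow> real"
  have E_commute: "E u v = E v u" for u v
    unfolding E_def by (intro sum.cong refl L2sq_diff_commute)
  have E_triangle: "E u w \<le> 2 * E u v + 2 * E v w"
    if "\<And>j. u j \<in> L2_supp D" "\<And>j. v j \<in> L2_supp D" "\<And>j. w j \<in> L2_supp D" for u v w
    unfolding E_def sum_distrib_left sum.distrib[symmetric] by (rule sum_mono) (rule L2sq_triangle[OF that])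
  have jetL: "jet \<phi> j \<in> L2_supp D" if "\<phi> \<in> approximants D" for \<phi> j
    using approximants_weak_grad_rep[OF that] by (cases j) (simp_all add: jet_def weak_grad_rep_def)
  obtain Q where Q: "countable Q" "Q \<subseteq> L2_supp D"
    "\<And>f e. f \<in> L2_supp D \<Longrightarrow> e > 0 \<Longrightarrow> \<exists>q\<in>Q. L2sq (\<lambda>x. q x - f x) < e"
    by (rule L2_separable) blast
  define T where "T = (\<Pi>\<^sub>E j\<in>(UNIV :: 'n option set). Q)"
  have "countable T" unfolding T_def using Q(1) by (intro countable_PiE) auto
  define near where "near q n \<phi> \<longleftrightarrow> \<phi> \<in> approximants D \<and> E (jet \<phi>) q < inverse (real (Suc n))" for q n \<phi>
  define pick where "pick p = (SOME \<phi>. near (fst p) (snd p) \<phi>)" for p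
  define F1 where "F1 = pick ` {p \<in> T \<times> (UNIV :: nat set). \<exists>\<phi>. near (fst p) (snd p) \<phi>}"
  define F2 where "F2 = (\<lambda>(i :: 'n, N :: nat) (x :: real ^ 'n). sin (x $ i * inverse (real (Suc N)))) ` UNIV"
  define F where "F = F1 \<union> F2"
  have "countable {p \<in> T \<times> (UNIV :: nat set). \<exists>\<phi>. near (fst p) (snd p) \<phi>}"
    by (rule countable_subset[of _ "T \<times> UNIV"]) (use \<open>countable T\<close> in auto)
  then have F_countable: "countable F" unfolding F_def F1_def F2_def by (intro countable_Un countable_image) auto
  have F_ne: "F \<noteq> {}" by (auto simp: F_def F2_def)
  have pick: "near (fst p) (snd p) (pick p)" if "near (fst p) (snd p) \<phi>" for p \<phi>
    unfolding pick_def by (rule someI[of "near (fst p) (snd p)"]) (rule that)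
  have F1: "F1 \<subseteq> approximants D"
  proof
    fix \<psi> assume "\<psi> \<in> F1"
    then obtain p \<phi> where "\<psi> = pick p" "near (fst p) (snd p) \<phi>" by (auto simp: F1_def)
    then show "\<psi> \<in> approximants D" using pick[of p \<phi>] by (simp add: near_def)
  qed
  have F2: "F2 \<subseteq> approximants D"
    by (auto simp: F2_def inverse_le_1_iff intro!: sin_component_approximant simp del: of_nat_Suc)
  define \<Phi> where "\<Phi> = from_nat_into F"
  have range: "range \<Phi> = F" unfolding \<Phi>_def by (rule range_from_nat_into[OF F_ne F_countable])
  show thesis
  proof (rule that[of \<Phi>])
    show "\<Phi> j \<in> approximants D" for j using range F1 F2 by (auto simp: F_def)
  next
    fix x y :: "real ^ 'n" assume "x \<noteq> y"
    from sin_component_separates[OF this]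
    obtain i N where "sin (x $ i * inverse (real (Suc N))) \<noteq> sin (y $ i * inverse (real (Suc N)))" .
    moreover have "(\<lambda>x. sin (x $ i * inverse (real (Suc N)))) \<in> range \<Phi>"
      unfolding range F_def F2_def by (auto intro!: image_eqI[of _ _ "(i, N)"])
    then obtain j where "(\<lambda>x. sin (x $ i * inverse (real (Suc N)))) = \<Phi> j" by (rule rangeE)
    ultimately show "\<exists>j. \<Phi> j x \<noteq> \<Phi> j y" by (metis (no_types))
  next
    fix f :: "real ^ 'n \<Rightarrow> real" and e :: real assume f: "f \<in> W12 D" and e: "e > 0"
    obtain H where H: "f \<in> L2_on D" "has_L2_weak_grad D f H" using f by (auto simp: W12_def)
    obtain u G where uG: "weak_grad_rep D u G" "AE x in lborel. x \<in> D \<longrightarrow> f x = u x"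
      by (rule weak_grad_rep_exists[OF H]) blast
    have uL: "u \<in> L2_supp D" "\<And>i. G i \<in> L2_supp D" using uG(1) by (auto simp: weak_grad_rep_def)
    define w where "w = case_option u G"
    have wL: "w j \<in> L2_supp D" for j using uL by (cases j) (simp_all add: w_def)
    obtain n where n: "inverse (real (Suc n)) < e\<^sup>2 / 3"
      using reals_Archimedean[of "e\<^sup>2 / 3"] e by auto
    \<comment> \<open>Both \<open>jet \<phi>\<close> and \<open>q\<close> are within \<delta> of the
      target \<open>w\<close>, so their distance is below \<open>4 * \<delta>\<close>, the tolerance
      of \<open>near\<close>. The picked function then has distance below
      \<open>2 / Suc n + 2 * \<delta>\<close>, which is less than \<open>3 / Suc n\<close> and hence
      than \<open>e\<^sup>2\<close>.\<close>
    define \<delta> where "\<delta> = inverse (real (Suc n)) / 4"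
    have \<delta>: "\<delta> > 0" by (simp add: \<delta>_def)
    obtain \<phi> where \<phi>: "\<phi> \<in> approximants D" "L2sq (\<lambda>x. zero_ext D \<phi> x - u x)
        + (\<Sum>i\<in>UNIV. L2sq (\<lambda>x. zero_ext D (partial_deriv i \<phi>) x - G i x)) < \<delta>"
      using approximants_dense[OF uG(1) \<delta>] by blast
    have E\<phi>: "E (jet \<phi>) w < \<delta>"
      unfolding E_def sum_UNIV_option using \<phi>(2) by (simp add: jet_def w_def)
    have "\<delta> / CARD('n option) > 0" using \<delta> by simp
    then have "\<forall>j. \<exists>q. q \<in> Q \<and> L2sq (\<lambda>x. q x - w j x) < \<delta> / CARD('n option)"
      unfolding Bex_def[symmetric] by (intro allI Q(3)[OF wL])
    from choice[OF this] obtain q where q: "\<And>j. q j \<in> Q"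
      "\<And>j. L2sq (\<lambda>x. q j x - w j x) < \<delta> / CARD('n option)" by blast
    have qL: "q j \<in> L2_supp D" for j using q(1) Q(2) by blast
    have "E q w \<le> (\<Sum>j\<in>(UNIV :: 'n option set). \<delta> / CARD('n option))"
      unfolding E_def by (intro sum_mono less_imp_le q)
    also have "\<dots> = \<delta>" by simp
    finally have Eq: "E q w \<le> \<delta>" .
    have "E (jet \<phi>) q \<le> 2 * E (jet \<phi>) w + 2 * E w q"
      by (rule E_triangle[OF jetL[OF \<phi>(1)] wL qL])
    then have "E (jet \<phi>) q < inverse (real (Suc n))"
      using E\<phi> Eq E_commute[of w q] unfolding \<delta>_def by linarith
    then have near\<phi>: "near (fst (q, n)) (snd (q, n)) \<phi>" using \<phi>(1) by (simp add: near_def)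
    define \<psi> where "\<psi> = pick (q, n)"
    have \<psi>: "\<psi> \<in> approximants D" "E (jet \<psi>) q < inverse (real (Suc n))"
      using pick[OF near\<phi>] by (auto simp: near_def \<psi>_def)
    have "q \<in> T" using q(1) by (simp add: T_def PiE_UNIV_domain)
    then have "\<psi> \<in> range \<Phi>" unfolding range F_def F1_def \<psi>_def
      by (intro UnI1 imageI CollectI conjI exI[of _ \<phi>] near\<phi>) simp
    then obtain j where j: "\<Phi> j = \<psi>" by blast
    have "E (jet \<psi>) w \<le> 2 * E (jet \<psi>) q + 2 * E q w"
      by (rule E_triangle[OF jetL[OF \<psi>(1)] qL wL])
    then have small: "E w (jet \<psi>) < e\<^sup>2"
      using \<psi>(2) Eq n E_commute[of w "jet \<psi>"] zero_le_power2[of e] unfolding \<delta>_def by linarith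
    have \<psi>_meas: "\<psi> \<in> borel_measurable (lebesgue_on D)"
      using \<psi>(1) by (intro continuous_lebesgue_on_measurable Cinf_continuous) (simp add: approximants_def)
    have "W12_norm D (\<lambda>x. f x - \<psi> x) = sqrt (L2sq (\<lambda>x. u x - zero_ext D \<psi> x)
        + (\<Sum>i\<in>UNIV. L2sq (\<lambda>x. G i x - zero_ext D (partial_deriv i \<psi>) x)))"
    proof (rule W12_norm_rep[OF _ weak_grad_rep_diff[OF uG(1) approximants_weak_grad_rep[OF \<psi>(1)]]])
      show "(\<lambda>x. f x - \<psi> x) \<in> borel_measurable (lebesgue_on D)"
        using H(1) \<psi>_meas unfolding L2_on_def by (intro borel_measurable_diff) auto
      show "AE x in lborel. x \<in> D \<longrightarrow> f x - \<psi> x = u x - zero_ext D \<psi> x"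
        using uG(2) by eventually_elim (simp add: zero_ext_def)
    qed
    also have "\<dots> = sqrt (E w (jet \<psi>))"
      unfolding E_def sum_UNIV_option by (simp add: jet_def w_def)
    also have "\<dots> < e" using small e by (intro real_less_lsqrt) auto
    finally show "\<exists>j. W12_norm D (\<lambda>x. f x - \<Phi> j x) < e" using j by blast
  qed
qed

end

theorem theorem2p1:
  fixes D :: "(real ^ 'n) set" and c\<^sub>1 :: real and x\<^sub>0 :: "real ^ 'n"
  assumes "open D" and "connected D" and "emeasure lebesgue D < \<infinity>"
    and "0 < c\<^sub>1" and "c\<^sub>1 < 1" and "x\<^sub>0 \<in> D"
  shows "\<exists>\<phi> :: nat \<Rightarrow> real ^ 'n \<Rightarrow> real.
    (\<forall>j. \<phi> j \<in> W12 D \<inter> Cinf D \<and> bounded (\<phi> j ` D)) \<and>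
    (\<forall>f \<in> W12 D. \<forall>e>0. \<exists>j. W12_norm D (\<lambda>x. f x - \<phi> j x) < e) \<and>
    (\<forall>x\<in>D. \<forall>y\<in>D. x \<noteq> y \<longrightarrow> (\<exists>j. \<phi> j x \<noteq> \<phi> j y)) \<and>
    (\<forall>j. Limsup at_top (\<lambda>k::int. ereal (2 powi (k * (2 - int CARD('n))) *
            (\<Sum>(x, y)\<in>grid_edges D c\<^sub>1 x\<^sub>0 k. (\<phi> j x - \<phi> j y)\<^sup>2)))
          \<le> ereal (2 * (LINT x|lebesgue_on D. (norm (grad (\<phi> j) x))\<^sup>2)))"
proof -
  interpret finite_domain D
  proof
    show "emeasure lborel D < \<infinity>" using assms(1,3) by (simp add: borel_open)
  qed (rule assms(1))
  obtain \<eta> C where \<eta>: "\<eta> \<in> Cinf D"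
    "\<And>x. x \<in> D \<Longrightarrow> 4 / 5 * depth D x \<le> \<eta> x \<and> \<eta> x \<le> 16 / 5 * depth D x"
    "\<And>x i. x \<in> D \<Longrightarrow> \<bar>partial_deriv i \<eta> x\<bar> \<le> C"
    using exists_smooth_scale by blast
  obtain \<rho> :: "real ^ 'n \<Rightarrow> real"
    where \<rho>: "\<rho> \<in> unit_kernels" "\<And>w. \<rho> w \<ge> 0" "(LINT w|lborel. \<rho> w) = 1"
    using exists_mollifier by blast
  interpret mollification D \<rho> \<eta> C
    by unfold_locales (use \<rho> \<eta> in auto)
  obtain \<Phi> :: "nat \<Rightarrow> real ^ 'n \<Rightarrow> real" where \<Phi>: "\<And>j. \<Phi> j \<in> approximants D"
    "\<And>f e. f \<in> W12 D \<Longrightarrow> e > 0 \<Longrightarrow> \<exists>j. W12_norm D (\<lambda>x. f x - \<Phi> j x) < e"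
    "\<And>x y. x \<noteq> y \<Longrightarrow> \<exists>j. \<Phi> j x \<noteq> \<Phi> j y"
    using dense_sequence by blast
  show ?thesis
  proof (intro exI[of _ \<Phi>] conjI allI ballI impI)
    fix j
    show "\<Phi> j \<in> W12 D \<inter> Cinf D" "bounded (\<Phi> j ` D)"
      using \<Phi>(1)[of j] approximants_subset_W12 by (auto simp: approximants_def)
    show "Limsup at_top (\<lambda>k::int. ereal (2 powi (k * (2 - int CARD('n))) *
            (\<Sum>(x, y)\<in>grid_edges D c\<^sub>1 x\<^sub>0 k. (\<Phi> j x - \<Phi> j y)\<^sup>2)))
          \<le> ereal (2 * (LINT x|lebesgue_on D. (norm (grad (\<Phi> j) x))\<^sup>2))"
      unfolding approximants_energy[OF \<Phi>(1)]
      by (rule discrete_energy_limsup[OF \<Phi>(1) assms(4,5)])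
  qed (use \<Phi>(2,3) in auto)
qed

end
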